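(* Consider the stochastic network $$dx_i=\Big[f(t,x_i)+\sigma\sum_{j\in\mathcal{N}_i}(x_j-x_i)\Big]dt+\sigma^\ast\sum_{j\in\mathcal{N}_i^\ast}(x_j-x_i)\,db,\qquad i=1,\ldots,N,$$ with $x_i\in\mathbb{R}^n$ and $X=[x_1^T,\ldots,x_N^T]^T\in\mathbb{R}^{Nn}$, written compactly as $$dX=[F(t,X)-\sigma(L\otimes I_n)X]\,dt-\sigma^\ast(L^\ast\otimes I_n)X\,db,$$ where $L$ and $L^\ast$ are the Laplacian matrices of the communication layer and of the noise diffusion layer respectively. Let $\lambda_2$ be the algebraic connectivity of the communication layer, $\lambda_N^\ast$ the largest eigenvalue of $L^\ast$, and $\lambda_2^\ast$ the algebraic connectivity of the noise diffusion layer. Assume that: 1. there exists a constant $K_f$ such that $(X-Y)^T(F(t,X)-F(t,Y))\le K_f(X-Y)^T(X-Y)$ for all $X,Y\in\mathbb{R}^{Nn}$ and all $t\ge 0$; 2. $(\sigma^\ast)^2\left((\lambda_2^\ast)^2-\dfrac{(\lambda_N^\ast)^2}{2}\right)>K_f-\sigma\lambda_2$. Then the network achieves complete stochastic synchronization: with $s_n(t)$ satisfying $\dot s_n(t)=\frac1N\sum_{i=1}^N f(t,x_i(t))$ and $s_n(0)=\frac1N\sum_{i=1}^N x_i(0)$, for every $i=1,\ldots,N$, $$\limsup_{t\to+\infty}\frac1t\log|x_i(t)-s_n(t)|<0\quad\text{almost surely}.$$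
   Context: Notation: $I_n$ is the $n\times n$ identity matrix, $1_N$ the $N$-vector of ones, $\otimes$ the Kronecker product, $|\cdot|$ the Euclidean norm. We use $\log 0=-\infty$. Network: there are two undirected graphs on the same set of $N$ nodes ($N\ge2$), whose topologies may differ: the communication layer, in which $\mathcal{N}_i$ denotes the set of neighbors of node $i$, and the noise diffusion layer, in which $\mathcal{N}_i^\ast$ denotes the set of neighbors of node $i$. For each graph the Laplacian is the degree matrix minus the adjacency matrix; these are denoted $L$ and $L^\ast$. The algebraic connectivity of a graph with Laplacian $M$ is $\min_{v^T1_N=0,\,v\neq0}\frac{v^TMv}{v^Tv}$. The constant $\sigma\ge0$ is the coupling strength of the communication layer and $\sigma^\ast$ is the coupling strength of the noise diffusion layer. Dynamics: $f:\mathbb{R}^+\times\mathbb{R}^n\to\mathbb{R}^n$ is smooth, $F(t,X)=[f(t,x_1)^T,\ldots,f(t,x_N)^T]^T$, and $b$ is a standard scalar Brownian motion common to all nodes. The stochastic differential equations are in the Ito sense, and their drift and diffusion coefficients are assumed to satisfy the local Lipschitz and linear growth conditions, so that for any given initial condition there is a unique global solution. The $x_i(t)$ appearing in the definition of $s_n$ are the components of the solution of the network. *)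

theory Defs
  imports "HOL-Probability.Probability"
begin

section \<open>Graphs and spectra\<close>

text \<open>A graph on the node type \<^typ>\<open>'m\<close> is its adjacency relation; the neighbours of \<open>i\<close> are
  \<open>E `` {i}\<close>.\<close>

definition simple_graph :: "'m rel \<Rightarrow> bool" where
  "simple_graph E \<longleftrightarrow> sym E \<and> irrefl E"

definition adjacency_matrix :: "'m::finite rel \<Rightarrow> real^'m^'m" where
  "adjacency_matrix E = (\<chi> i j. of_bool ((i, j) \<in> E))"

definition degree_matrix :: "'m::finite rel \<Rightarrow> real^'m^'m" where
  "degree_matrix E = (\<chi> i j. if i = j then real (card (E `` {i})) else 0)"

definition laplacian :: "'m::finite rel \<Rightarrow> real^'m^'m" where
  "laplacian E = degree_matrix E - adjacency_matrix E"

definition eigenvalues :: "real^'m^'m \<Rightarrow> real set" where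
  "eigenvalues A = {l. \<exists>v. v \<noteq> 0 \<and> A *v v = l *\<^sub>R v}"

definition largest_eigenvalue :: "real^'m^'m \<Rightarrow> real" where
  "largest_eigenvalue A = Max (eigenvalues A)"

definition rayleigh :: "real^'m^'m \<Rightarrow> real^'m \<Rightarrow> real" where
  "rayleigh A v = (v \<bullet> (A *v v)) / (v \<bullet> v)"

text \<open>The infimum is attained as soon as there are two nodes, see
  \<open>algebraic_connectivity_is_min\<close> below.\<close>

definition algebraic_connectivity :: "real^'m^'m \<Rightarrow> real" where
  "algebraic_connectivity A = Inf (rayleigh A ` {v. v \<bullet> (\<chi> i. 1) = 0 \<and> v \<noteq> 0})"

lemma algebraic_connectivity_is_min:
  fixes A :: "real^'m^'m"
  assumes "CARD('m) \<ge> 2"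
  obtains v where "v \<bullet> (\<chi> i. 1) = 0" "v \<noteq> 0" "algebraic_connectivity A = rayleigh A v"
    "\<And>w. w \<bullet> (\<chi> i. 1) = 0 \<Longrightarrow> w \<noteq> 0 \<Longrightarrow> rayleigh A v \<le> rayleigh A w"
proof -
  define H where "H = {v::real^'m. v \<bullet> (\<chi> i. 1) = 0}"
  define S where "S = sphere 0 1 \<inter> H"
  have "closed H"
    unfolding H_def by (intro closed_Collect_eq continuous_intros)
  then have "compact S"
    unfolding S_def by (intro compact_Int_closed) auto
  obtain i j :: 'm where "i \<noteq> j"
  proof -
    have "\<not> is_singleton (UNIV :: 'm set)"
      using assms by (simp add: is_singleton_altdef)
    then have "UNIV \<noteq> {undefined :: 'm}"
      unfolding is_singleton_def by blast
    then obtain i :: 'm where "i \<noteq> undefined"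
      by blast
    then show ?thesis
      by (rule that)
  qed
  define u :: "real^'m" where "u = axis i 1 - axis j 1"
  have "u $ i = 1"
    using \<open>i \<noteq> j\<close> by (simp add: u_def axis_def)
  then have "u \<noteq> 0"
    by auto
  have scale: "inverse (norm w) *\<^sub>R w \<in> S" if "w \<in> H" "w \<noteq> 0" for w
    using that by (simp add: S_def H_def)
  have "u \<in> H"
    by (simp add: H_def u_def inner_diff_left inner_axis' )
  then have "S \<noteq> {}"
    using scale \<open>u \<noteq> 0\<close> by auto
  have rs: "rayleigh A (c *\<^sub>R w) = rayleigh A w" if "c \<noteq> 0" for c w
    using that by (simp add: rayleigh_def matrix_vector_mult_scaleR)
  have "continuous_on S (rayleigh A)"
    unfolding rayleigh_def
    by (intro continuous_intros matrix_vector_mult_linear_continuous_on) (auto simp: S_def)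
  from continuous_attains_inf[OF \<open>compact S\<close> \<open>S \<noteq> {}\<close> this]
  obtain v where v: "v \<in> S" "\<And>w. w \<in> S \<Longrightarrow> rayleigh A v \<le> rayleigh A w"
    by auto
  have le: "rayleigh A v \<le> rayleigh A w" if "w \<in> H" "w \<noteq> 0" for w
    using v(2)[OF scale[OF that]] rs[of "inverse (norm w)" w] that by simp
  have vH: "v \<bullet> (\<chi> i. 1) = 0" "v \<noteq> 0"
    using v(1) by (auto simp: S_def H_def)
  have "algebraic_connectivity A = rayleigh A v"
    unfolding algebraic_connectivity_def
    by (rule cInf_eq_minimum) (use vH le in \<open>auto simp: H_def\<close>)
  with vH le show ?thesis
    by (intro that) (auto simp: H_def)
qed

text \<open>For a Laplacian the \<^const>\<open>Max\<close> in \<^const>\<open>largest_eigenvalue\<close> ranges over a finite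
  non-empty set.\<close>

lemma laplacian_mult_nth:
  "(laplacian E *v v) $ i = (\<Sum>j\<in>E `` {i}. v $ i - v $ j)"
proof -
  have "(laplacian E *v v) $ i = (\<Sum>j\<in>UNIV. laplacian E $ i $ j * v $ j)"
    by (simp add: matrix_vector_mult_def)
  also have "\<dots> = (\<Sum>j\<in>UNIV. (if i = j then real (card (E `` {i})) * v $ j else 0)
      - (if j \<in> E `` {i} then v $ j else 0))"
    by (rule sum.cong)
      (simp_all add: laplacian_def degree_matrix_def adjacency_matrix_def left_diff_distrib)
  also have "\<dots> = real (card (E `` {i})) * v $ i - (\<Sum>j\<in>E `` {i}. v $ j)"
    unfolding sum_subtractf by (simp add: sum.If_cases Image_singleton)
  finally show ?thesis
    by (simp add: sum_subtractf)
qed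

lemma eigenvalues_laplacian_nonempty:
  fixes E :: "'m::finite rel"
  shows "eigenvalues (laplacian E) \<noteq> {}"
proof -
  have "laplacian E *v (\<chi> i. 1) = (0::real) *\<^sub>R (\<chi> i. 1)"
    by (simp add: vec_eq_iff laplacian_mult_nth)
  moreover have "(\<chi> i. 1) \<noteq> (0 :: real^'m)"
    by (simp add: vec_eq_iff)
  ultimately show ?thesis
    unfolding eigenvalues_def by blast
qed

lemma finite_eigenvalues_laplacian:
  fixes E :: "'m::finite rel"
  assumes "simple_graph E"
  shows "finite (eigenvalues (laplacian E))"
proof -
  let ?A = "laplacian E"
  have E: "(j, i) \<in> E \<longleftrightarrow> (i, j) \<in> E" for i j
    using assms symD[of E i j] symD[of E j i] unfolding simple_graph_def by auto
  have A: "?A $ j $ i = ?A $ i $ j" for i j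
    unfolding laplacian_def degree_matrix_def adjacency_matrix_def
    by (cases "i = j") (simp_all add: E[of i j])
  have "transpose ?A = ?A"
    unfolding vec_eq_iff transpose_def vec_lambda_beta by (intro allI A)
  then have symm: "x \<bullet> (?A *v y) = (?A *v x) \<bullet> y" for x y
    using dot_lmul_matrix[of x ?A y] vector_transpose_matrix[of x ?A] by (simp only:)
  have "\<forall>l\<in>eigenvalues ?A. \<exists>v. v \<noteq> 0 \<and> ?A *v v = l *\<^sub>R v"
    by (simp add: eigenvalues_def)
  from bchoice[OF this]
  obtain g where "\<forall>l\<in>eigenvalues ?A. g l \<noteq> 0 \<and> ?A *v g l = l *\<^sub>R g l"
    by (rule exE)
  then have g: "g l \<noteq> 0" "?A *v g l = l *\<^sub>R g l" if "l \<in> eigenvalues ?A" for l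
    using that by simp_all
  have orth: "g l \<bullet> g k = 0" if "l \<in> eigenvalues ?A" "k \<in> eigenvalues ?A" "l \<noteq> k" for l k
  proof -
    have "k * (g l \<bullet> g k) = l * (g l \<bullet> g k)"
      using symm[of "g l" "g k"]
      unfolding g(2)[OF that(1)] g(2)[OF that(2)] inner_scaleR_left inner_scaleR_right .
    with that(3) show ?thesis
      by simp
  qed
  have inj: "inj_on g (eigenvalues ?A)"
  proof (rule inj_onI, rule ccontr)
    fix l k
    assume lk: "l \<in> eigenvalues ?A" "k \<in> eigenvalues ?A" "g l = g k" "l \<noteq> k"
    have "g l \<bullet> g l = 0"
      using orth[OF lk(1,2,4)] unfolding lk(3) .
    with g(1)[OF lk(1)] show False
      by simp
  qed
  have "independent (g ` eigenvalues ?A)"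
  proof (rule pairwise_orthogonal_independent)
    show "pairwise orthogonal (g ` eigenvalues ?A)"
      unfolding pairwise_image using orth by (simp add: pairwise_def orthogonal_def)
    show "0 \<notin> g ` eigenvalues ?A"
      using g(1) by force
  qed
  then have "finite (g ` eigenvalues ?A)"
    by (rule independent_imp_finite)
  then show ?thesis
    using inj by (rule finite_imageD)
qed

section \<open>Smoothness\<close>

text \<open>\<open>C_k_on k f S\<close> says that \<open>f\<close> is \<open>k\<close> times continuously differentiable on \<open>S\<close>, through the
  directional derivatives of the derivative. Derivatives are taken within \<open>S\<close>, hence one-sided
  at boundary points; this is meant for sets \<open>S\<close> on which they are unique, such as
  \<open>{0..} \<times> UNIV\<close>.\<close>

primrec C_k_on ::
  "nat \<Rightarrow> ('a::real_normed_vector \<Rightarrow> 'b::real_normed_vector) \<Rightarrow> 'a set \<Rightarrow> bool" where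
  "C_k_on 0 f S \<longleftrightarrow> continuous_on S f"
| "C_k_on (Suc k) f S \<longleftrightarrow>
     (\<exists>f'. (\<forall>x\<in>S. (f has_derivative f' x) (at x within S)) \<and> (\<forall>v. C_k_on k (\<lambda>x. f' x v) S))"

definition smooth_on :: "('a::real_normed_vector \<Rightarrow> 'b::real_normed_vector) \<Rightarrow> 'a set \<Rightarrow> bool" where
  "smooth_on f S \<longleftrightarrow> (\<forall>k. C_k_on k f S)"

section \<open>Brownian motion and the Ito integral\<close>

text \<open>Processes are functions of time and outcome, of which only times \<open>\<ge> 0\<close> matter.
  A filtration is indexed by all reals in order to use the library locale; one on \<open>{0..}\<close>
  extends by its value at \<open>0\<close>. It need be neither complete nor right-continuous.\<close>

definition brownian_motion ::
  "'w measure \<Rightarrow> (real \<Rightarrow> 'w measure) \<Rightarrow> (real \<Rightarrow> 'w \<Rightarrow> real) \<Rightarrow> bool" where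
  "brownian_motion M Fl b \<longleftrightarrow>
     (\<forall>t\<ge>0. b t \<in> borel_measurable (Fl t)) \<and>
     (\<forall>\<omega>\<in>space M. continuous_on {0..} (\<lambda>t. b t \<omega>)) \<and>
     (AE \<omega> in M. b 0 \<omega> = 0) \<and>
     (\<forall>s t. 0 \<le> s \<longrightarrow> s < t \<longrightarrow>
        distributed M lborel (\<lambda>\<omega>. b t \<omega> - b s \<omega>) (normal_density 0 (sqrt (t - s))) \<and>
        prob_space.indep_set M (sets (Fl s))
          (sets (vimage_algebra (space M) (\<lambda>\<omega>. b t \<omega> - b s \<omega>) borel)))"

text \<open>The simple process with value \<open>\<xi> i\<close> on \<open>{\<tau> i<..\<tau> (Suc i)}\<close> for \<open>i < n\<close>, and its integral
  over \<open>{0..t}\<close>.\<close>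

definition simple_data ::
  "'w measure \<Rightarrow> (real \<Rightarrow> 'w measure) \<Rightarrow> nat \<Rightarrow> (nat \<Rightarrow> real) \<Rightarrow>
   (nat \<Rightarrow> 'w \<Rightarrow> 'a::euclidean_space) \<Rightarrow> bool" where
  "simple_data M Fl n \<tau> \<xi> \<longleftrightarrow>
     0 \<le> \<tau> 0 \<and>
     (\<forall>i<n. \<tau> i < \<tau> (Suc i) \<and> \<xi> i \<in> borel_measurable (Fl (\<tau> i)) \<and>
            (\<exists>C. \<forall>\<omega>\<in>space M. norm (\<xi> i \<omega>) \<le> C))"

definition simple_process ::
  "nat \<Rightarrow> (nat \<Rightarrow> real) \<Rightarrow> (nat \<Rightarrow> 'w \<Rightarrow> 'a::euclidean_space) \<Rightarrow> real \<Rightarrow> 'w \<Rightarrow> 'a" where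
  "simple_process n \<tau> \<xi> t \<omega> = (\<Sum>i<n. indicator {\<tau> i<..\<tau> (Suc i)} t *\<^sub>R \<xi> i \<omega>)"

definition simple_integral ::
  "(real \<Rightarrow> 'w \<Rightarrow> real) \<Rightarrow> nat \<Rightarrow> (nat \<Rightarrow> real) \<Rightarrow> (nat \<Rightarrow> 'w \<Rightarrow> 'a::euclidean_space) \<Rightarrow>
   real \<Rightarrow> 'w \<Rightarrow> 'a" where
  "simple_integral b n \<tau> \<xi> t \<omega> =
     (\<Sum>i<n. (b (min t (\<tau> (Suc i))) \<omega> - b (min t (\<tau> i)) \<omega>) *\<^sub>R \<xi> i \<omega>)"

definition null_in_prob :: "'w measure \<Rightarrow> (nat \<Rightarrow> 'w \<Rightarrow> ennreal) \<Rightarrow> bool" where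
  "null_in_prob M Y \<longleftrightarrow>
     (\<forall>\<epsilon>>0. (\<lambda>k. measure M {\<omega> \<in> space M. Y k \<omega> > ennreal \<epsilon>}) \<longlonglongrightarrow> 0)"

definition progressive ::
  "(real \<Rightarrow> 'w measure) \<Rightarrow> (real \<Rightarrow> 'w \<Rightarrow> 'a::euclidean_space) \<Rightarrow> bool" where
  "progressive Fl H \<longleftrightarrow>
     (\<forall>T\<ge>0. (\<lambda>(t, \<omega>). H t \<omega>) \<in> borel_measurable (restrict_space borel {0..T} \<Otimes>\<^sub>M Fl T))"

text \<open>\<open>ito_integral M Fl b H I\<close>: the process \<open>I\<close> is (a continuous version of) \<open>\<integral>\<^sub>0\<^sup>t H db\<close>, for
  progressive \<open>H\<close> that are almost surely locally square integrable in time. The integral is the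
  limit in probability of the integrals of simple processes converging to \<open>H\<close> in
  \<open>L\<^sup>2({0..t})\<close> in probability, and is unique up to indistinguishability.\<close>

definition ito_integral ::
  "'w measure \<Rightarrow> (real \<Rightarrow> 'w measure) \<Rightarrow> (real \<Rightarrow> 'w \<Rightarrow> real) \<Rightarrow>
   (real \<Rightarrow> 'w \<Rightarrow> 'a::euclidean_space) \<Rightarrow> (real \<Rightarrow> 'w \<Rightarrow> 'a) \<Rightarrow> bool" where
  "ito_integral M Fl b H I \<longleftrightarrow>
     progressive Fl H \<and>
     (\<forall>t\<ge>0. AE \<omega> in M. (\<integral>\<^sup>+s\<in>{0..t}. ennreal ((norm (H s \<omega>))\<^sup>2) \<partial>lborel) < \<infinity>) \<and>
     (\<forall>t\<ge>0. I t \<in> borel_measurable (Fl t)) \<and>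
     (\<forall>\<omega>\<in>space M. continuous_on {0..} (\<lambda>t. I t \<omega>)) \<and>
     (\<forall>t\<ge>0. \<exists>n \<tau> \<xi>.
        (\<forall>k. simple_data M Fl (n k) (\<tau> k) (\<xi> k)) \<and>
        null_in_prob M (\<lambda>k \<omega>. \<integral>\<^sup>+s\<in>{0..t}.
          ennreal ((norm (simple_process (n k) (\<tau> k) (\<xi> k) s \<omega> - H s \<omega>))\<^sup>2) \<partial>lborel) \<and>
        null_in_prob M (\<lambda>k \<omega>.
          ennreal (norm (simple_integral b (n k) (\<tau> k) (\<xi> k) t \<omega> - I t \<omega>))))"

section \<open>Stochastic differential equations\<close>

text \<open>\<open>sde_solution M Fl b \<mu> g X\<close>: the continuous adapted process \<open>X\<close> is a global solution of
  \<open>dX = \<mu>(t, X) dt + g(t, X) db\<close>; its initial value is any \<open>Fl 0\<close>-measurable random vector,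
  in particular any constant.\<close>

definition sde_solution ::
  "'w measure \<Rightarrow> (real \<Rightarrow> 'w measure) \<Rightarrow> (real \<Rightarrow> 'w \<Rightarrow> real) \<Rightarrow>
   (real \<Rightarrow> 'a \<Rightarrow> 'a) \<Rightarrow> (real \<Rightarrow> 'a \<Rightarrow> 'a) \<Rightarrow> (real \<Rightarrow> 'w \<Rightarrow> 'a::euclidean_space) \<Rightarrow> bool" where
  "sde_solution M Fl b \<mu> g X \<longleftrightarrow>
     (\<forall>t\<ge>0. X t \<in> borel_measurable (Fl t)) \<and>
     (\<forall>\<omega>\<in>space M. continuous_on {0..} (\<lambda>t. X t \<omega>)) \<and>
     (\<exists>I. ito_integral M Fl b (\<lambda>t \<omega>. g t (X t \<omega>)) I \<and>
       (\<forall>t\<ge>0. AE \<omega> in M. (\<lambda>s. \<mu> s (X s \<omega>)) absolutely_integrable_on {0..t} \<and>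
          X t \<omega> = X 0 \<omega> + integral {0..t} (\<lambda>s. \<mu> s (X s \<omega>)) + I t \<omega>))"

text \<open>The bound is uniform on each compact time interval, not necessarily on \<open>{0..}\<close>.\<close>

definition linear_growth :: "(real \<Rightarrow> 'a \<Rightarrow> 'a::real_normed_vector) \<Rightarrow> bool" where
  "linear_growth h \<longleftrightarrow> (\<forall>T\<ge>0. \<exists>C. \<forall>t\<in>{0..T}. \<forall>x. norm (h t x) \<le> C * (1 + norm x))"

section \<open>The network\<close>

text \<open>The joint state of the nodes is an element of \<^typ>\<open>real^'n^'m\<close>, whose inner product and norm
  are those of the stacked vector.\<close>

definition stacked :: "(real \<Rightarrow> real^'n \<Rightarrow> real^'n) \<Rightarrow> real \<Rightarrow> real^'n^'m \<Rightarrow> real^'n^'m" where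
  "stacked f t X = (\<chi> i. f t (X $ i))"

definition network_drift ::
  "(real \<Rightarrow> real^'n \<Rightarrow> real^'n) \<Rightarrow> real \<Rightarrow> 'm rel \<Rightarrow> real \<Rightarrow> real^'n^'m \<Rightarrow> real^'n^'m" where
  "network_drift f \<sigma> E t X = (\<chi> i. f t (X $ i) + \<sigma> *\<^sub>R (\<Sum>j\<in>E `` {i}. X $ j - X $ i))"

definition network_diffusion :: "real \<Rightarrow> 'm rel \<Rightarrow> real \<Rightarrow> real^'n^'m \<Rightarrow> real^'n^'m" where
  "network_diffusion \<sigma> E t X = (\<chi> i. \<sigma> *\<^sub>R (\<Sum>j\<in>E `` {i}. X $ j - X $ i))"

text \<open>\<open>kron_id A X\<close> is \<open>(A \<otimes> I\<^sub>n) X\<close>, block by block.\<close>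

definition kron_id :: "real^'m^'m \<Rightarrow> real^'n^'m \<Rightarrow> real^'n^'m" where
  "kron_id A X = (\<chi> i. \<Sum>j\<in>UNIV. A $ i $ j *\<^sub>R X $ j)"

lemma kron_id_laplacian_nth: "kron_id (laplacian E) X $ i = (\<Sum>j\<in>E `` {i}. X $ i - X $ j)"
proof (subst vec_eq_iff, intro allI)
  fix c
  have "kron_id (laplacian E) X $ i $ c = (laplacian E *v (\<chi> j. X $ j $ c)) $ i"
    by (simp add: kron_id_def matrix_vector_mult_def)
  then show "kron_id (laplacian E) X $ i $ c = (\<Sum>j\<in>E `` {i}. X $ i - X $ j) $ c"
    by (simp add: laplacian_mult_nth)
qed

lemma network_drift_compact:
  "network_drift f \<sigma> E t X = stacked f t X - \<sigma> *\<^sub>R kron_id (laplacian E) X"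
  unfolding vec_eq_iff[of "network_drift f \<sigma> E t X"]
  by (simp add: network_drift_def stacked_def kron_id_laplacian_nth sum_subtractf
      scaleR_diff_right)

lemma network_diffusion_compact:
  "network_diffusion \<sigma> E t X = - \<sigma> *\<^sub>R kron_id (laplacian E) X"
  unfolding vec_eq_iff[of "network_diffusion \<sigma> E t X"]
  by (simp add: network_diffusion_def kron_id_laplacian_nth sum_subtractf scaleR_diff_right)

text \<open>Logarithm with \<open>log 0 = -\<infinity>\<close>, to be used at nonnegative arguments.\<close>

definition elog :: "real \<Rightarrow> ereal" where
  "elog x = (if x = 0 then - \<infinity> else ereal (ln x))"

end

theory Submission
  imports Defs
begin

text \<open>Let \<open>e\<close> be the deviation of the solution from the average over the nodes, so that the average is \<open>s\<close>.
  For small \<open>q > 0\<close> the generator of the network sends \<open>(\<bar>e\<bar>\<^sup>2) powr q\<close> below \<open>- \<gamma> * (\<bar>e\<bar>\<^sup>2) powr q\<close> for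
  some \<open>\<gamma> > 0\<close>, as the noise contributes \<open>- 2 * (1 - q) * (e \<bullet> g)\<^sup>2\<close> and \<open>e \<bullet> g\<close> is of order \<open>\<bar>e\<bar>\<^sup>2\<close>. Hence
  \<open>exp (\<gamma> * t) * (\<bar>e t\<bar>\<^sup>2) powr q\<close> is a nonnegative supermartingale, and its almost surely finite
  supremum gives the exponential decay.

  In place of Ito's formula, the argument is carried out for an Euler-like scheme on a dyadic grid that
  evaluates both coefficients along the true solution. The scheme is close to the solution in
  probability, uniformly on the grid, and the Taylor expansion of \<open>(\<epsilon> + \<bar>x\<bar>\<^sup>2) powr q\<close> along it involves
  only moments of Gaussian increments; \<open>\<epsilon>\<close> also disposes of visits of \<open>e\<close> to \<open>0\<close>. The maximal
  inequality comes from stopping the scheme when the Lyapunov function becomes large or the scheme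
  leaves the region where the estimates hold.\<close>

section \<open>Spectra of Laplacians\<close>

text \<open>The noise assumption says exactly \<open>A < 2 * D\<close>, where \<open>A\<close>
  bounds drift plus quadratic variation relative to |e|^2 and \<open>D\<close> bounds
  \<open>(e \<bullet> g)\<^sup>2\<close> from below relative to |e|^4. The noise gain enters as 2 (1
  - q) D, so the strictness of the inequality leaves room for some q > 0. Three obstacles shape the
  rest. The Ito integral is given only as a limit in probability at each time separately, by simple
  processes that may change with the time; a maximal inequality for differences of simple integrals
  yields one approximation that is uniform over finite sets of times. The derivatives of u^q are
  bounded only away from 0, and the shift by \<epsilon> is paid for by negative powers of
  \<epsilon>; so the parameters are chosen in the order radius of the path, bound of the
  coefficients, \<epsilon>, \<delta>, mesh. Finally \<open>s\<close> is given by an ordinary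
  differential equation. It is the node average because an undirected Laplacian has vanishing column
  sums: averaging removes coupling and noise and leaves the mean of f.\<close>

lemma psd_form_cauchy_schwarz:
  fixes A :: "real^'m^'m"
  assumes symm: "\<And>x y. x \<bullet> (A *v y) = (A *v x) \<bullet> y"
    and psd: "\<And>x. x \<bullet> (A *v x) \<ge> 0"
  shows "(v \<bullet> (A *v w))\<^sup>2 \<le> (v \<bullet> (A *v v)) * (w \<bullet> (A *v w))"
proof -
  have q: "v \<bullet> (A *v v) * (s * s) + 2 * (v \<bullet> (A *v w)) * s + w \<bullet> (A *v w) \<ge> 0" for s
  proof -
    have "(s *\<^sub>R v + w) \<bullet> (A *v (s *\<^sub>R v + w))
      = v \<bullet> (A *v v) * (s * s) + s * (v \<bullet> (A *v w)) + s * (w \<bullet> (A *v v)) + w \<bullet> (A *v w)"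
      by (simp add: matrix_vector_mult_scaleR inner_add_left inner_add_right algebra_simps matrix_vector_right_distrib)
    moreover have "w \<bullet> (A *v v) = v \<bullet> (A *v w)"
      using symm[of w v] by (simp add: inner_commute)
    ultimately show ?thesis
      using psd[of "s *\<^sub>R v + w"] by (simp add: algebra_simps)
  qed
  show ?thesis
  proof (cases "v \<bullet> (A *v v) = 0")
    case True
    have "v \<bullet> (A *v w) = 0"
    proof (rule ccontr)
      assume "v \<bullet> (A *v w) \<noteq> 0"
      \<comment> \<open>This \<open>s\<close> makes the remaining affine function of
        \<open>s\<close> equal to -1.\<close>
      then show False
        using q[of "- (w \<bullet> (A *v w) + 1) / (2 * (v \<bullet> (A *v w)))"] True by simp
    qed
    with True show ?thesis by simp
  next
    case False
    then have pos: "v \<bullet> (A *v v) > 0"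
      using psd[of v] by simp
    \<comment> \<open>The quadratic at its minimiser; up to positive factors this is minus its
      discriminant.\<close>
    have "0 \<le> v \<bullet> (A *v v) * ((v \<bullet> (A *v v)) * (w \<bullet> (A *v w)) - (v \<bullet> (A *v w))\<^sup>2) / (v \<bullet> (A *v v))\<^sup>2"
      using q[of "- (v \<bullet> (A *v w)) / (v \<bullet> (A *v v))"] pos
      by (simp add: field_simps power2_eq_square)
    then show ?thesis
      using pos by (simp add: zero_le_divide_iff zero_le_mult_iff)
  qed
qed

text \<open>A maximiser of the quadratic form on the unit sphere is an eigenvector.\<close>

lemma psd_form_le_eigenvalue:
  fixes A :: "real^'m^'m"
  assumes symm: "\<And>x y. x \<bullet> (A *v y) = (A *v x) \<bullet> y"
  obtains l where "l \<in> eigenvalues A" "\<And>v. v \<bullet> (A *v v) \<le> l * (v \<bullet> v)"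
proof -
  have "continuous_on (sphere 0 1) (\<lambda>v. v \<bullet> (A *v v))"
    by (intro continuous_intros matrix_vector_mult_linear_continuous_on)
  moreover have "sphere (0::real^'m) 1 \<noteq> {}"
    by simp
  ultimately obtain u :: "real^'m" where u: "norm u = 1" "\<And>w. norm w = 1 \<Longrightarrow> w \<bullet> (A *v w) \<le> u \<bullet> (A *v u)"
    using continuous_attains_sup[of "sphere 0 1" "\<lambda>v. v \<bullet> (A *v v)"] by auto
  define l where "l = u \<bullet> (A *v u)"
  have le: "v \<bullet> (A *v v) \<le> l * (v \<bullet> v)" for v
  proof (cases "v = 0")
    case False
    then show ?thesis
      using u(2)[of "inverse (norm v) *\<^sub>R v"]
      by (simp add: l_def matrix_vector_mult_scaleR field_simps dot_square_norm power2_eq_square)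
  qed simp
  \<comment> \<open>By maximality of \<open>u\<close> the form of \<open>B\<close> is positive
    semidefinite, and it vanishes at \<open>u\<close>; Cauchy-Schwarz for this form with
    \<open>B *v u\<close> as second vector forces \<open>B *v u = 0\<close>.\<close>
  define B where "B = mat l - A"
  have B: "B *v x = l *\<^sub>R x - A *v x" for x
  proof -
    have "mat l = l *\<^sub>R (mat 1 :: real^'m^'m)"
      by (simp add: mat_def vec_eq_iff)
    then show ?thesis
      by (simp add: B_def matrix_vector_mult_diff_rdistrib scaleR_matrix_vector_assoc[symmetric])
  qed
  have "(B *v u) \<bullet> (B *v u) = 0"
  proof -
    have s: "x \<bullet> (B *v y) = (B *v x) \<bullet> y" for x y
      using symm[of x y] by (simp add: B inner_diff_left inner_diff_right)
    have "(u \<bullet> (B *v (B *v u)))\<^sup>2 \<le> (u \<bullet> (B *v u)) * ((B *v u) \<bullet> (B *v (B *v u)))"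
    proof (rule psd_form_cauchy_schwarz[OF s])
      show "0 \<le> x \<bullet> (B *v x)" for x
        using le[of x] by (simp add: B inner_diff_right)
    qed
    moreover have "u \<bullet> (B *v u) = 0"
      using u(1) by (simp add: B inner_diff_right l_def dot_square_norm)
    ultimately show ?thesis
      using s[of u "B *v u"] by simp
  qed
  then have "A *v u = l *\<^sub>R u"
    by (simp add: B)
  moreover have "u \<noteq> 0"
    using u(1) by auto
  ultimately have "l \<in> eigenvalues A"
    by (auto simp: eigenvalues_def)
  with le show ?thesis
    by (rule that[rotated])
qed

lemma laplacian_symmetric:
  fixes E :: "'m::finite rel"
  assumes "simple_graph E"
  shows "x \<bullet> (laplacian E *v y) = (laplacian E *v x) \<bullet> y"
proof -
  have E: "(j, i) \<in> E \<longleftrightarrow> (i, j) \<in> E" for i j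
    using assms symD[of E i j] symD[of E j i] unfolding simple_graph_def by auto
  have "laplacian E $ j $ i = laplacian E $ i $ j" for i j
    unfolding laplacian_def degree_matrix_def adjacency_matrix_def
    by (cases "i = j") (simp_all add: E[of i j])
  then have "transpose (laplacian E) = laplacian E"
    by (simp add: vec_eq_iff transpose_def)
  then show ?thesis
    using dot_lmul_matrix[of x "laplacian E" y] vector_transpose_matrix[of x "laplacian E"]
    by (simp only:)
qed

text \<open>In an undirected graph every edge is met once from each end, so its end points may be
  exchanged under the double sum. This gives both the semidefiniteness of the Laplacian and the
  vanishing of its column sums.\<close>

lemma sum_edges_swap:
  fixes E :: "'m::finite rel" and a :: "'m \<Rightarrow> 'm \<Rightarrow> 'a::comm_monoid_add"
  assumes "simple_graph E"
  shows "(\<Sum>i\<in>UNIV. \<Sum>j\<in>E `` {i}. a i j) = (\<Sum>i\<in>UNIV. \<Sum>j\<in>E `` {i}. a j i)"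
proof -
  have "(\<Sum>i\<in>UNIV. \<Sum>j\<in>{j\<in>UNIV. (i, j) \<in> E}. a i j) = (\<Sum>j\<in>UNIV. \<Sum>i\<in>{i\<in>UNIV. (i, j) \<in> E}. a i j)"
    by (rule sum.swap_restrict) auto
  moreover have "{i. (i, j) \<in> E} = E `` {j}" for j
    using assms by (auto simp: simple_graph_def dest: symD)
  ultimately show ?thesis
    by (simp add: Image_singleton)
qed

text \<open>Averaging the edge sum over the two orientations shows that the form is half the sum of
  \<open>(x $ i - x $ j)\<^sup>2\<close> over directed edges.\<close>

lemma laplacian_psd:
  fixes E :: "'m::finite rel"
  assumes "simple_graph E"
  shows "x \<bullet> (laplacian E *v x) \<ge> 0"
proof -
  have 1: "x \<bullet> (laplacian E *v x) = (\<Sum>i\<in>UNIV. \<Sum>j\<in>E `` {i}. x $ i * (x $ i - x $ j))"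
    by (simp add: inner_vec_def laplacian_mult_nth sum_distrib_left)
  also have "\<dots> = (\<Sum>i\<in>UNIV. \<Sum>j\<in>E `` {i}. x $ j * (x $ j - x $ i))"
    by (rule sum_edges_swap[OF assms])
  finally have "2 * (x \<bullet> (laplacian E *v x)) = (\<Sum>i\<in>UNIV. \<Sum>j\<in>E `` {i}. x $ i * (x $ i - x $ j))
      + (\<Sum>i\<in>UNIV. \<Sum>j\<in>E `` {i}. x $ j * (x $ j - x $ i))"
    using 1 by simp
  also have "\<dots> = (\<Sum>i\<in>UNIV. \<Sum>j\<in>E `` {i}. (x $ i - x $ j)\<^sup>2)"
    unfolding sum.distrib[symmetric] by (simp add: power2_eq_square algebra_simps)
  finally have "2 * (x \<bullet> (laplacian E *v x)) = (\<Sum>i\<in>UNIV. \<Sum>j\<in>E `` {i}. (x $ i - x $ j)\<^sup>2)" .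
  then show ?thesis
    by (smt (verit) sum_nonneg zero_le_power2)
qed

text \<open>Cauchy-Schwarz for the Laplacian form, applied to \<open>v\<close> and its image w,
  gives |w|^4 \<le> l^2 |v|^2 |w|^2 and so upgrades the bound on the form to one on the norm. The
  maximum of the spectrum only has to dominate the one eigenvalue that comes from maximising the
  form.\<close>

lemma largest_eigenvalue_laplacian:
  fixes E :: "'m::finite rel"
  assumes E: "simple_graph E"
  shows "norm (laplacian E *v v) \<le> largest_eigenvalue (laplacian E) * norm v"
    and "largest_eigenvalue (laplacian E) \<ge> 0"
proof -
  let ?A = "laplacian E" and ?l = "largest_eigenvalue (laplacian E)"
  obtain l where l: "l \<in> eigenvalues ?A" "\<And>v. v \<bullet> (?A *v v) \<le> l * (v \<bullet> v)"
    using psd_form_le_eigenvalue[OF laplacian_symmetric[OF E]] by blast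
  have "l \<le> ?l"
    unfolding largest_eigenvalue_def
    by (intro Max_ge finite_eigenvalues_laplacian E l)
  then have le: "v \<bullet> (?A *v v) \<le> ?l * (v \<bullet> v)" for v
    using l(2)[of v] mult_right_mono[of l ?l "v \<bullet> v"] by simp
  \<comment> \<open>At a unit vector the form lies between 0 and the eigenvalue.\<close>
  from le[of "axis undefined 1"] laplacian_psd[OF E, of "axis undefined 1"] show nonneg: "?l \<ge> 0"
    by (simp add: inner_axis_axis)
  let ?w = "?A *v v"
  have "(?w \<bullet> ?w)\<^sup>2 = (v \<bullet> (?A *v ?w))\<^sup>2"
    using laplacian_symmetric[OF E, of v ?w] by simp
  also have "\<dots> \<le> (v \<bullet> (?A *v v)) * (?w \<bullet> (?A *v ?w))"
    by (intro psd_form_cauchy_schwarz laplacian_symmetric laplacian_psd E)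
  also have "\<dots> \<le> (?l * (v \<bullet> v)) * (?l * (?w \<bullet> ?w))"
    by (intro mult_mono le laplacian_psd E mult_nonneg_nonneg nonneg inner_ge_zero)
  finally have 1: "norm ?w ^ 4 \<le> (?l * norm v)\<^sup>2 * (norm ?w)\<^sup>2"
    by (simp add: dot_square_norm power_mult_distrib power2_eq_square power4_eq_xxxx mult_ac)
  show "norm ?w \<le> ?l * norm v"
  proof (cases "?w = 0")
    case True
    then show ?thesis using nonneg by simp
  next
    case False
    have "(norm ?w)\<^sup>2 \<le> (?l * norm v)\<^sup>2"
      using 1 False by (simp add: power4_eq_xxxx power2_eq_square)
    then show ?thesis
      using nonneg by (simp add: power2_le_iff_abs_le)
  qed
qed

lemma algebraic_connectivity_laplacian:
  fixes E :: "'m::finite rel"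
  assumes E: "simple_graph E" and n: "CARD('m) \<ge> 2"
  shows "v \<bullet> (\<chi> i. 1) = 0 \<Longrightarrow>
      algebraic_connectivity (laplacian E) * (v \<bullet> v) \<le> v \<bullet> (laplacian E *v v)"
    and "algebraic_connectivity (laplacian E) \<ge> 0"
proof -
  obtain u where u: "u \<noteq> 0" "algebraic_connectivity (laplacian E) = rayleigh (laplacian E) u"
    "\<And>w. w \<bullet> (\<chi> i. 1) = 0 \<Longrightarrow> w \<noteq> 0 \<Longrightarrow> rayleigh (laplacian E) u \<le> rayleigh (laplacian E) w"
    by (rule algebraic_connectivity_is_min[OF n, of "laplacian E"]) (rule that)
  then show "algebraic_connectivity (laplacian E) \<ge> 0"
    using laplacian_psd[OF E, of u] by (simp add: rayleigh_def)
  assume "v \<bullet> (\<chi> i. 1) = 0"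
  then show "algebraic_connectivity (laplacian E) * (v \<bullet> v) \<le> v \<bullet> (laplacian E *v v)"
    using u(2) u(3)[of v] by (cases "v = 0") (auto simp: rayleigh_def field_simps)
qed

section \<open>Block vectors: Kronecker products with the identity\<close>

text \<open>The operator \<open>kron_id A\<close> acts as \<open>A\<close> on the vector of all
  \<open>c\<close>-th coordinates, for each \<open>c\<close> separately, and the inner product is
  the sum over \<open>c\<close>. Spectral bounds therefore carry over to block vectors slice by
  slice.\<close>

definition coordinate_slice :: "real^'n^'m \<Rightarrow> 'n \<Rightarrow> real^'m" where
  "coordinate_slice X c = (\<chi> i. X $ i $ c)"

lemma inner_coordinate_slice:
  "X \<bullet> Y = (\<Sum>c\<in>UNIV. coordinate_slice X c \<bullet> coordinate_slice Y c)"
  unfolding inner_vec_def coordinate_slice_def by (subst sum.swap) simp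

lemma coordinate_slice_kron_id:
  "coordinate_slice (kron_id A X) c = A *v coordinate_slice X c"
  by (simp add: coordinate_slice_def kron_id_def matrix_vector_mult_def vec_eq_iff)

text \<open>If the blocks sum to zero, then every slice is orthogonal to the vector of ones, where
  the algebraic connectivity applies.\<close>

lemma kron_id_laplacian_ge:
  fixes X :: "real^'n^'m"
  assumes E: "simple_graph E" and n: "CARD('m) \<ge> 2" and "(\<Sum>i\<in>UNIV. X $ i) = 0"
  shows "algebraic_connectivity (laplacian E) * (X \<bullet> X) \<le> X \<bullet> kron_id (laplacian E) X"
proof -
  have "coordinate_slice X c \<bullet> (\<chi> i. 1) = (\<Sum>i\<in>UNIV. X $ i) $ c" for c
    by (simp add: inner_vec_def coordinate_slice_def)
  then have "coordinate_slice X c \<bullet> (\<chi> i. 1) = 0" for c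
    using assms(3) by simp
  then show ?thesis
    unfolding inner_coordinate_slice coordinate_slice_kron_id sum_distrib_left
    by (intro sum_mono algebraic_connectivity_laplacian(1)[OF E n])
qed

lemma norm_kron_id_laplacian_le:
  fixes X :: "real^'n^'m"
  assumes E: "simple_graph E"
  shows "(norm (kron_id (laplacian E) X))\<^sup>2 \<le> (largest_eigenvalue (laplacian E))\<^sup>2 * (norm X)\<^sup>2"
  unfolding dot_square_norm[symmetric] inner_coordinate_slice coordinate_slice_kron_id sum_distrib_left
proof (intro sum_mono)
  fix c
  show "(laplacian E *v coordinate_slice X c) \<bullet> (laplacian E *v coordinate_slice X c)
    \<le> (largest_eigenvalue (laplacian E))\<^sup>2 * (coordinate_slice X c \<bullet> coordinate_slice X c)"
    using power_mono[OF largest_eigenvalue_laplacian(1)[OF E, of "coordinate_slice X c"] norm_ge_zero, of 2]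
    by (simp add: dot_square_norm power_mult_distrib)
qed

section \<open>Discrete stochastic integrals\<close>

lemma pred_le_const:
  "f \<in> borel_measurable N \<Longrightarrow> Measurable.pred N (\<lambda>x. f x \<le> (c::real))"
  by measurable

locale brownian_filtration = prob_space M
  for M :: "'w measure" +
  fixes Fl :: "real \<Rightarrow> 'w measure" and b :: "real \<Rightarrow> 'w \<Rightarrow> real"
  assumes filtration_Fl: "filtration (space M) Fl"
    and subalgebra_Fl: "subalgebra M (Fl t)"
    and brownian: "brownian_motion M Fl b"
begin

lemma space_Fl [simp]: "space (Fl t) = space M"
  using subalgebra_Fl by (simp add: subalgebra_def)

lemma sets_Fl: "A \<in> sets (Fl t) \<Longrightarrow> A \<in> sets M"
  using subalgebra_Fl by (auto simp: subalgebra_def)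

lemma Fl_measurable: "g \<in> measurable (Fl t) N \<Longrightarrow> g \<in> measurable M N"
  using measurable_from_subalg[OF subalgebra_Fl] .

lemma Fl_measurable_mono: "s \<le> t \<Longrightarrow> g \<in> measurable (Fl s) N \<Longrightarrow> g \<in> measurable (Fl t) N"
  using filtration.sets_F_mono[OF filtration_Fl, of s t]
  by (intro measurable_from_subalg[of "Fl t" "Fl s"]) (auto simp: subalgebra_def)

lemma b_measurable_Fl: "0 \<le> s \<Longrightarrow> s \<le> t \<Longrightarrow> b s \<in> borel_measurable (Fl t)"
  using brownian Fl_measurable_mono[of s t] by (auto simp: brownian_motion_def)

lemma b_measurable: "0 \<le> s \<Longrightarrow> b s \<in> borel_measurable M"
  using b_measurable_Fl[of s s] Fl_measurable by blast

lemma prob_le_add: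
  "A \<subseteq> B \<union> C \<Longrightarrow> B \<in> events \<Longrightarrow> C \<in> events \<Longrightarrow> prob A \<le> prob B + prob C"
  by (meson finite_measure_mono measure_Un_le order_trans sets.Un)

lemma norm_exceeds_events:
  fixes U :: "'i \<Rightarrow> 'w \<Rightarrow> 'a::euclidean_space"
  assumes "finite Q" "\<And>k. k \<in> Q \<Longrightarrow> U k \<in> borel_measurable M"
  shows "{\<omega> \<in> space M. \<exists>k\<in>Q. norm (U k \<omega>) > a} \<in> events"
proof (rule sets.sets_Collect_finite_Ex[OF _ assms(1)])
  fix k assume "k \<in> Q"
  then have [measurable]: "U k \<in> borel_measurable M"
    by (rule assms(2))
  show "{\<omega> \<in> space M. norm (U k \<omega>) > a} \<in> events"
    by measurable
qed

text \<open>Independence of the increment from \<open>Fl s\<close> passes to a function of the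
  increment and any \<open>Fl s\<close>-measurable variable. With a \<open>G\<close> that carries
  the indicator of an event of \<open>Fl s\<close>, this does the work of conditional
  expectations.\<close>

lemma increment_independent:
  assumes st: "0 \<le> s" "s < t" and G: "G \<in> borel_measurable (Fl s)" "integrable M G"
    and p: "p \<in> borel_measurable borel" "integrable M (\<lambda>\<omega>. p (b t \<omega> - b s \<omega>))"
  shows "integrable M (\<lambda>\<omega>. G \<omega> * p (b t \<omega> - b s \<omega>) :: real)"
    and "expectation (\<lambda>\<omega>. G \<omega> * p (b t \<omega> - b s \<omega>))
      = expectation G * expectation (\<lambda>\<omega>. p (b t \<omega> - b s \<omega>))"
proof -
  let ?D = "\<lambda>\<omega>. b t \<omega> - b s \<omega>"
  have D: "?D \<in> borel_measurable M"
    using st by (intro borel_measurable_diff b_measurable) auto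
  have "indep_set (sets (Fl s)) (sets (vimage_algebra (space M) ?D borel))"
    using brownian st by (simp add: brownian_motion_def)
  moreover have "sigma_sets (space M) {G -` A \<inter> space M |A. A \<in> sets borel} \<subseteq> sets (Fl s)"
  proof -
    have "{G -` A \<inter> space M |A. A \<in> sets borel} \<subseteq> sets (Fl s)"
      using measurable_sets[OF G(1)] by auto
    from sets.sigma_sets_subset[OF this] show ?thesis
      by simp
  qed
  moreover have "sigma_sets (space M) {?D -` A \<inter> space M |A. A \<in> sets borel}
      \<subseteq> sets (vimage_algebra (space M) ?D borel)"
    by (simp add: sets_vimage_algebra)
  ultimately have "indep_set (sigma_sets (space M) {G -` A \<inter> space M |A. A \<in> sets borel})
      (sigma_sets (space M) {?D -` A \<inter> space M |A. A \<in> sets borel})"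
    unfolding indep_set_def by (elim indep_sets_mono_sets) (auto split: bool.split)
  then have "indep_var borel G borel ?D"
    using Fl_measurable[OF G(1)] D by (simp add: indep_var_eq)
  from indep_var_compose[OF this, of id borel p borel]
  have "indep_var borel G borel (\<lambda>\<omega>. p (?D \<omega>))"
    using p(1) by (simp add: comp_def id_def)
  from indep_var_lebesgue_integral[OF this G(2) p(2)] indep_var_integrable[OF this G(2) p(2)]
  show "integrable M (\<lambda>\<omega>. G \<omega> * p (?D \<omega>))"
    "expectation (\<lambda>\<omega>. G \<omega> * p (?D \<omega>)) = expectation G * expectation (\<lambda>\<omega>. p (?D \<omega>))"
    by simp_all
qed

text \<open>The first moment removes the martingale terms, the second yields the quadratic
  variation, and the orders 2, 4 and 6 are those that occur in \<open>step_error\<close>.\<close>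

lemma increment_moments:
  assumes st: "0 \<le> s" "s < t"
  shows "integrable M (\<lambda>\<omega>. (b t \<omega> - b s \<omega>) ^ k)"
    and "expectation (\<lambda>\<omega>. b t \<omega> - b s \<omega>) = 0"
    and "expectation (\<lambda>\<omega>. (b t \<omega> - b s \<omega>)\<^sup>2) = t - s"
    and "expectation (\<lambda>\<omega>. (b t \<omega> - b s \<omega>) ^ 4) = 3 * (t - s)\<^sup>2"
    and "expectation (\<lambda>\<omega>. (b t \<omega> - b s \<omega>) ^ 6) = 15 * (t - s) ^ 3"
proof -
  let ?D = "\<lambda>\<omega>. b t \<omega> - b s \<omega>" and ?\<sigma> = "sqrt (t - s)"
  have D: "distributed M lborel ?D (normal_density 0 ?\<sigma>)"
    using brownian st by (simp add: brownian_motion_def)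
  have pos: "0 < ?\<sigma>"
    using st by simp
  have int: "expectation (\<lambda>\<omega>. ?D \<omega> ^ k) = (\<integral>x. normal_density 0 ?\<sigma> x * x ^ k \<partial>lborel)" for k
    by (rule distributed_integral[OF D, symmetric]) auto
  show "integrable M (\<lambda>\<omega>. ?D \<omega> ^ k)"
    using distributed_integrable[OF D, of "\<lambda>x. x ^ k"] integrable_normal_moment[OF pos, of 0 k]
    by simp
  show "expectation ?D = 0"
    using int[of 1] integral_normal_moment_odd[OF pos, of 0 0] by simp
  have even: "expectation (\<lambda>\<omega>. ?D \<omega> ^ (2 * k))
      = fact (2 * k) / ((2 / (t - s)) ^ k * fact k)" for k
    using int[of "2 * k"] integral_normal_moment_even[OF pos, of 0 k] st by simp
  show "expectation (\<lambda>\<omega>. (?D \<omega>)\<^sup>2) = t - s"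
    using even[of 1] by simp
  show "expectation (\<lambda>\<omega>. ?D \<omega> ^ 4) = 3 * (t - s)\<^sup>2"
    using even[of 2] by (simp add: fact_numeral power_divide)
  show "expectation (\<lambda>\<omega>. ?D \<omega> ^ 6) = 15 * (t - s) ^ 3"
    using even[of 3] by (simp add: fact_numeral power_divide)
qed

text \<open>The sum is stopped once it has left the ball of radius \<open>a\<close> and before its quadratic variation
  exceeds \<open>c\<close>; this keeps its second moment below \<open>c\<close>.\<close>

lemma discrete_maximal_inequality:
  fixes \<eta> :: "nat \<Rightarrow> 'w \<Rightarrow> 'a::euclidean_space"
  assumes d: "0 \<le> d 0" "\<And>i. i < N \<Longrightarrow> d i < d (Suc i)"
    and \<eta>: "\<And>i. i < N \<Longrightarrow> \<eta> i \<in> borel_measurable (Fl (d i))"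
      "\<And>i \<omega>. i < N \<Longrightarrow> \<omega> \<in> space M \<Longrightarrow> norm (\<eta> i \<omega>) \<le> C"
    and a: "a > 0" "c > 0"
  defines "I \<equiv> \<lambda>k \<omega>. \<Sum>i<k. (b (d (Suc i)) \<omega> - b (d i) \<omega>) *\<^sub>R \<eta> i \<omega>"
    and "Q \<equiv> \<lambda>k \<omega>. \<Sum>i<k. (d (Suc i) - d i) * (norm (\<eta> i \<omega>))\<^sup>2"
  shows "prob {\<omega> \<in> space M. \<exists>k\<le>N. norm (I k \<omega>) > a}
    \<le> c / a\<^sup>2 + prob {\<omega> \<in> space M. Q N \<omega> > c}"
proof -
  have d_mono: "d i \<le> d j" if "i \<le> j" "j \<le> N" for i j
    using that
  proof (induction j rule: dec_induct)
    case (step n)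
    then show ?case using d(2)[of n] by simp
  qed simp
  have d_ge: "0 \<le> d i" if "i \<le> N" for i
    using d_mono[of 0 i] d(1) that by simp
  have \<eta>_at: "\<eta> i \<in> borel_measurable (Fl (d k))" if "i < N" "i \<le> k" "k \<le> N" for i k
    using Fl_measurable_mono[OF d_mono \<eta>(1)] that by auto
  have norm_\<eta>_at: "(\<lambda>\<omega>. norm (\<eta> i \<omega>)) \<in> borel_measurable (Fl (d k))" if "i < N" "i \<le> k" "k \<le> N" for i k
    using measurable_compose[OF \<eta>_at[OF that] borel_measurable_norm] .
  have b_at: "b (d i) \<in> borel_measurable (Fl (d k))" if "i \<le> k" "k \<le> N" for i k
    using b_measurable_Fl[OF d_ge d_mono] that by auto
  have I_meas: "I k \<in> borel_measurable (Fl (d k))" if "k \<le> N" for k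
    unfolding I_def using that
    by (intro borel_measurable_sum borel_measurable_scaleR borel_measurable_diff b_at \<eta>_at) auto
  have Q_meas: "Q (Suc k) \<in> borel_measurable (Fl (d k))" if "k < N" for k
    unfolding Q_def using that
    by (intro borel_measurable_sum borel_measurable_times borel_measurable_power
        borel_measurable_const norm_\<eta>_at) auto
  have Q_mono: "Q i \<omega> \<le> Q j \<omega>" if "i \<le> j" "j \<le> N" for i j \<omega>
    unfolding Q_def using that d(2) less_imp_le[OF d(2)] by (intro sum_mono2) auto
  \<comment> \<open>Whether the summand \<open>k\<close> is kept is decided at time
    \<open>d k\<close>. The argument \<open>Suc k\<close> of \<open>Q\<close> includes the variance
    of that very summand, which is known at \<open>d k\<close> because \<open>\<eta> k\<close>
    is.\<close>
  define A where "A = (\<lambda>k \<omega>. (\<forall>i\<in>{..k}. norm (I i \<omega>) \<le> a) \<and> Q (Suc k) \<omega> \<le> c)"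
  have A_anti: "A i \<omega>" if "A j \<omega>" "i \<le> j" "j < N" for i j \<omega>
    using that Q_mono[of "Suc i" "Suc j" \<omega>] by (auto simp: A_def)
  have A_meas: "{\<omega> \<in> space M. A k \<omega>} \<in> sets (Fl (d k))" if "k < N" for k
  proof -
    have "{\<omega> \<in> space (Fl (d k)). (\<forall>i\<in>{..k}. norm (I i \<omega>) \<le> a) \<and> Q (Suc k) \<omega> \<le> c} \<in> sets (Fl (d k))"
    proof (intro sets.sets_Collect_conj sets.sets_Collect_finite_All')
      show "{\<omega> \<in> space (Fl (d k)). Q (Suc k) \<omega> \<le> c} \<in> sets (Fl (d k))"
        using Q_meas[OF that] by measurable
      fix i assume "i \<in> {..k}"
      then have "I i \<in> borel_measurable (Fl (d k))"
        using that by (intro Fl_measurable_mono[OF d_mono I_meas]) auto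
      then show "{\<omega> \<in> space (Fl (d k)). norm (I i \<omega>) \<le> a} \<in> sets (Fl (d k))"
        by measurable
    qed auto
    then show ?thesis
      by (simp add: A_def)
  qed
  define \<zeta> where "\<zeta> = (\<lambda>i \<omega>. of_bool (A i \<omega>) *\<^sub>R \<eta> i \<omega>)"
  define J where "J = (\<lambda>k \<omega>. \<Sum>i<k. (b (d (Suc i)) \<omega> - b (d i) \<omega>) *\<^sub>R \<zeta> i \<omega>)"
  have \<zeta>_meas: "\<zeta> i \<in> borel_measurable (Fl (d i))" if "i < N" for i
  proof -
    have "(\<lambda>\<omega>. indicator {\<omega> \<in> space M. A i \<omega>} \<omega> *\<^sub>R \<eta> i \<omega>) \<in> borel_measurable (Fl (d i))"
      using that by (intro borel_measurable_scaleR borel_measurable_indicator A_meas \<eta>(1))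
    then show ?thesis
      by (rule measurable_cong[THEN iffD1, rotated]) (simp add: \<zeta>_def indicator_def)
  qed
  have C: "0 \<le> C" if "0 < N"
    using \<eta>(2)[of 0] not_empty that norm_ge_zero order_trans by blast
  have \<zeta>_bound: "norm (\<zeta> i \<omega>) \<le> C" if "i < N" "\<omega> \<in> space M" for i \<omega>
    using \<eta>(2)[OF that] C that by (auto simp: \<zeta>_def)
  have J_meas: "J k \<in> borel_measurable (Fl (d k))" if "k \<le> N" for k
    unfolding J_def using that
    by (intro borel_measurable_sum borel_measurable_scaleR borel_measurable_diff b_at
        Fl_measurable_mono[OF d_mono \<zeta>_meas]) auto
  \<comment> \<open>Ito isometry by induction: the cross term has mean zero, as \<open>J k\<close>
    and \<open>\<zeta> k\<close> are measurable at time \<open>d k\<close>.\<close>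
  have J: "integrable M (\<lambda>\<omega>. (norm (J k \<omega>))\<^sup>2)
      \<and> expectation (\<lambda>\<omega>. (norm (J k \<omega>))\<^sup>2)
        = expectation (\<lambda>\<omega>. \<Sum>i<k. (d (Suc i) - d i) * (norm (\<zeta> i \<omega>))\<^sup>2)" if "k \<le> N" for k
    using that
  proof (induction k)
    case 0
    then show ?case by (simp add: J_def)
  next
    case (Suc k)
    let ?D = "\<lambda>\<omega>. b (d (Suc k)) \<omega> - b (d k) \<omega>"
    have k: "k < N" "0 \<le> d k" "d k < d (Suc k)"
      using Suc.prems d_ge d(2) by auto
    have JM: "J k \<in> borel_measurable M" and \<zeta>M: "\<zeta> i \<in> borel_measurable M" if "i \<le> k" for i
      using Fl_measurable[OF J_meas] Fl_measurable[OF \<zeta>_meas] k that by auto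
    have int\<zeta>: "integrable M (\<lambda>\<omega>. (norm (\<zeta> i \<omega>))\<^sup>2)" if "i \<le> k" for i
      using \<zeta>_bound that k \<zeta>M
      by (intro integrable_const_bound[where B = "C\<^sup>2"] borel_measurable_power borel_measurable_norm)
        (auto intro!: AE_I2 power_mono)
    have intJ\<zeta>: "integrable M (\<lambda>\<omega>. J k \<omega> \<bullet> \<zeta> k \<omega>)"
    proof (rule Bochner_Integration.integrable_bound)
      show "integrable M (\<lambda>\<omega>. (norm (J k \<omega>))\<^sup>2 + (norm (\<zeta> k \<omega>))\<^sup>2)"
        using Suc int\<zeta> by auto
      show "(\<lambda>\<omega>. J k \<omega> \<bullet> \<zeta> k \<omega>) \<in> borel_measurable M"
        using JM \<zeta>M by (intro borel_measurable_inner) auto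
      have "\<bar>x \<bullet> y\<bar> \<le> (norm x)\<^sup>2 + (norm y)\<^sup>2" for x y :: 'a
        using Cauchy_Schwarz_ineq2[of x y] sum_squares_bound[of "norm x" "norm y"]
          mult_nonneg_nonneg[of "norm x" "norm y"] by simp
      then show "AE \<omega> in M. norm (J k \<omega> \<bullet> \<zeta> k \<omega>) \<le> norm ((norm (J k \<omega>))\<^sup>2 + (norm (\<zeta> k \<omega>))\<^sup>2)"
        by auto
    qed
    have F1: "(\<lambda>\<omega>. 2 * (J k \<omega> \<bullet> \<zeta> k \<omega>)) \<in> borel_measurable (Fl (d k))"
      and F2: "(\<lambda>\<omega>. (norm (\<zeta> k \<omega>))\<^sup>2) \<in> borel_measurable (Fl (d k))"
      using J_meas \<zeta>_meas k
      by (auto intro!: borel_measurable_times borel_measurable_inner borel_measurable_power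
          borel_measurable_norm)
    have i1: "integrable M (\<lambda>\<omega>. 2 * (J k \<omega> \<bullet> \<zeta> k \<omega>) * ?D \<omega>)"
      and e1: "expectation (\<lambda>\<omega>. 2 * (J k \<omega> \<bullet> \<zeta> k \<omega>) * ?D \<omega>) = 0"
      using increment_independent[OF k(2,3) F1, of "\<lambda>x. x"] intJ\<zeta> increment_moments(1)[OF k(2,3), of 1]
        increment_moments(2)[OF k(2,3)] by auto
    have i2: "integrable M (\<lambda>\<omega>. (norm (\<zeta> k \<omega>))\<^sup>2 * (?D \<omega>)\<^sup>2)"
      and e2: "expectation (\<lambda>\<omega>. (norm (\<zeta> k \<omega>))\<^sup>2 * (?D \<omega>)\<^sup>2)
        = expectation (\<lambda>\<omega>. (norm (\<zeta> k \<omega>))\<^sup>2) * (d (Suc k) - d k)"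
      using increment_independent[OF k(2,3) F2, of "\<lambda>x. x\<^sup>2"] int\<zeta>[of k]
        increment_moments(1)[OF k(2,3), of 2] increment_moments(3)[OF k(2,3)] by auto
    have eq: "(norm (J (Suc k) \<omega>))\<^sup>2 = (norm (J k \<omega>))\<^sup>2 + 2 * (J k \<omega> \<bullet> \<zeta> k \<omega>) * ?D \<omega>
        + (norm (\<zeta> k \<omega>))\<^sup>2 * (?D \<omega>)\<^sup>2" for \<omega>
    proof -
      have "(norm (x + r *\<^sub>R y))\<^sup>2 = (norm x)\<^sup>2 + 2 * (x \<bullet> y) * r + (norm y)\<^sup>2 * r\<^sup>2" for x y :: 'a and r
        unfolding power2_norm_eq_inner inner_add_left inner_add_right inner_scaleR_left inner_scaleR_right
        by (simp add: inner_commute power2_eq_square algebra_simps)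
      then show ?thesis
        unfolding J_def by simp
    qed
    have iJ: "integrable M (\<lambda>\<omega>. (norm (J k \<omega>))\<^sup>2)" and eJ: "expectation (\<lambda>\<omega>. (norm (J k \<omega>))\<^sup>2)
        = expectation (\<lambda>\<omega>. \<Sum>i<k. (d (Suc i) - d i) * (norm (\<zeta> i \<omega>))\<^sup>2)"
      using Suc by auto
    have iS: "integrable M (\<lambda>\<omega>. \<Sum>i<k. (d (Suc i) - d i) * (norm (\<zeta> i \<omega>))\<^sup>2)"
      using int\<zeta> by (intro Bochner_Integration.integrable_sum integrable_mult_right) auto
    show ?case
      unfolding eq using iJ i1 i2 eJ e1 e2 iS int\<zeta>[of k] by simp
  qed
  \<comment> \<open>\<open>J\<close> is \<open>I\<close> frozen at the first index \<open>l\<close>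
    where \<open>A\<close> fails, and its quadratic variation is \<open>Q l\<close>.\<close>
  have J_stop: "\<exists>l\<le>k. J k \<omega> = I l \<omega> \<and> (\<forall>i<l. A i \<omega>) \<and> (l < k \<longrightarrow> \<not> A l \<omega>) \<and>
      (\<Sum>i<k. (d (Suc i) - d i) * (norm (\<zeta> i \<omega>))\<^sup>2) = Q l \<omega>" if "k \<le> N" for k \<omega>
    using that
  proof (induction k)
    case 0
    then show ?case by (simp add: J_def I_def Q_def)
  next
    case (Suc k)
    then obtain l where l: "l \<le> k" "J k \<omega> = I l \<omega>" "\<forall>i<l. A i \<omega>" "l < k \<longrightarrow> \<not> A l \<omega>"
      "(\<Sum>i<k. (d (Suc i) - d i) * (norm (\<zeta> i \<omega>))\<^sup>2) = Q l \<omega>"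
      by auto
    show ?case
    proof (cases "A k \<omega>")
      case True
      then have "l = k"
        using l A_anti[of k \<omega> l] Suc.prems by (cases "l < k") auto
      with True l show ?thesis
        by (intro exI[of _ "Suc k"]) (auto simp: J_def I_def Q_def \<zeta>_def less_Suc_eq)
    next
      case False
      with l show ?thesis
        by (intro exI[of _ l]) (auto simp: J_def \<zeta>_def le_less)
    qed
  qed
  have J_le: "expectation (\<lambda>\<omega>. (norm (J N \<omega>))\<^sup>2) \<le> c"
  proof -
    have le: "(\<Sum>i<N. (d (Suc i) - d i) * (norm (\<zeta> i \<omega>))\<^sup>2) \<le> c" for \<omega>
    proof -
      obtain l where l: "l \<le> N" "\<forall>i<l. A i \<omega>" "(\<Sum>i<N. (d (Suc i) - d i) * (norm (\<zeta> i \<omega>))\<^sup>2) = Q l \<omega>"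
        using J_stop[of N \<omega>] by auto
      show ?thesis
      proof (cases l)
        case 0
        then show ?thesis using l a by (simp add: Q_def)
      next
        case (Suc m)
        then have "A m \<omega>" using l by auto
        then show ?thesis using l Suc by (simp add: A_def)
      qed
    qed
    have "integrable M (\<lambda>\<omega>. \<Sum>i<N. (d (Suc i) - d i) * (norm (\<zeta> i \<omega>))\<^sup>2)"
      using \<zeta>_bound Fl_measurable[OF \<zeta>_meas]
      by (intro Bochner_Integration.integrable_sum integrable_mult_right integrable_const_bound[where B = "C\<^sup>2"]
          borel_measurable_power borel_measurable_norm) (auto intro!: AE_I2 power_mono)
    from integral_mono[OF this integrable_const[of c] le] J[of N] show ?thesis
      by (simp add: prob_space)
  qed
  have J_set: "{\<omega> \<in> space M. norm (J N \<omega>) > a} \<in> events"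
    using Fl_measurable[OF J_meas, of N] by measurable
  have Q_set: "{\<omega> \<in> space M. Q N \<omega> > c} \<in> events"
  proof -
    have "Q N \<in> borel_measurable M"
      unfolding Q_def using Fl_measurable[OF \<eta>(1)] by (intro borel_measurable_sum borel_measurable_times) auto
    then show ?thesis by measurable
  qed
  \<comment> \<open>As long as \<open>Q N\<close> does not exceed \<open>c\<close>, the sum is
    frozen at the first index whose norm exceeds \<open>a\<close>, so \<open>J N\<close> keeps that
    excess.\<close>
  have "prob {\<omega> \<in> space M. \<exists>k\<le>N. norm (I k \<omega>) > a}
    \<le> prob {\<omega> \<in> space M. norm (J N \<omega>) > a} + prob {\<omega> \<in> space M. Q N \<omega> > c}"
  proof (intro prob_le_add J_set Q_set subsetI)
    fix \<omega> assume "\<omega> \<in> {\<omega> \<in> space M. \<exists>k\<le>N. norm (I k \<omega>) > a}"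
    then obtain k where k: "\<omega> \<in> space M" "k \<le> N" "norm (I k \<omega>) > a" by auto
    obtain l where l: "l \<le> N" "J N \<omega> = I l \<omega>" "\<forall>i<l. A i \<omega>" "l < N \<longrightarrow> \<not> A l \<omega>"
      using J_stop[of N \<omega>] by auto
    have less: "norm (I i \<omega>) \<le> a" if "i < l" for i
      using l(3) that by (auto simp: A_def)
    show "\<omega> \<in> {\<omega> \<in> space M. norm (J N \<omega>) > a} \<union> {\<omega> \<in> space M. Q N \<omega> > c}"
    proof (cases "norm (I l \<omega>) > a \<or> Q N \<omega> > c")
      case True
      then show ?thesis using l k by auto
    next
      case False
      then have "l < k"
        using less k by (metis linorder_neqE_nat not_less)
      then have "\<not> A l \<omega>" using l k by auto
      moreover have "Q (Suc l) \<omega> \<le> c"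
        using False Q_mono[of "Suc l" N \<omega>] \<open>l < k\<close> k by auto
      moreover have "norm (I i \<omega>) \<le> a" if "i \<le> l" for i
        using less[of i] False that by (cases "i = l") auto
      ultimately show ?thesis
        by (auto simp: A_def)
    qed
  qed
  also have "prob {\<omega> \<in> space M. norm (J N \<omega>) > a} \<le> c / a\<^sup>2"
  proof -
    have "prob {\<omega> \<in> space M. norm (J N \<omega>) > a} \<le> prob {\<omega> \<in> space M. (norm (J N \<omega>))\<^sup>2 \<ge> a\<^sup>2}"
      using a Fl_measurable[OF J_meas, of N]
      by (intro finite_measure_mono) (auto intro: power_mono)
    also have "\<dots> \<le> expectation (\<lambda>\<omega>. (norm (J N \<omega>))\<^sup>2) / a\<^sup>2"
      using J[of N] a by (intro integral_Markov_inequality_measure[where A = "space M" and u = "\<lambda>\<omega>. (norm (J N \<omega>))\<^sup>2"]) auto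
    also have "\<dots> \<le> c / a\<^sup>2"
      using J_le a by (intro divide_right_mono) auto
    finally show ?thesis .
  qed
  finally show ?thesis by simp
qed

end

section \<open>Refining simple processes\<close>

text \<open>No cell contains \<open>u\<close> or \<open>v\<close> in its interior, so the cells
  counted are those inside \<open>{u<..v}\<close>; their increments telescope, cut off at
  \<open>d k\<close>.\<close>

lemma sum_indicator_increments:
  fixes B :: "real \<Rightarrow> real"
  assumes "d 0 \<le> u" "u \<le> v" "\<And>i. i < k \<Longrightarrow> d i < d (Suc i)"
    and "\<And>i. i < k \<Longrightarrow> u \<le> d i \<or> d (Suc i) \<le> u" "\<And>i. i < k \<Longrightarrow> v \<le> d i \<or> d (Suc i) \<le> v"
  shows "(\<Sum>i<k. indicator {u<..v} (d (Suc i)) * (B (d (Suc i)) - B (d i)))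
    = B (min (d k) v) - B (min (d k) u)"
  using assms(3-5)
proof (induction k)
  case 0
  then show ?case using assms(1,2) by (simp add: min_def)
next
  case (Suc k)
  have IH: "(\<Sum>i<k. indicator {u<..v} (d (Suc i)) * (B (d (Suc i)) - B (d i)))
    = B (min (d k) v) - B (min (d k) u)"
    using Suc by simp
  have "d k < d (Suc k)" "u \<le> d k \<or> d (Suc k) \<le> u" "v \<le> d k \<or> d (Suc k) \<le> v"
    using Suc.prems by auto
  then show ?case
    unfolding sum.lessThan_Suc IH using assms(2) by (auto simp: min_def indicator_def)
qed

lemma simple_data_nonneg_mono:
  assumes "simple_data M Fl n \<tau> \<xi>" "i \<le> j" "j \<le> n"
  shows "0 \<le> \<tau> i" "\<tau> i \<le> \<tau> j"
proof -
  have mono: "\<tau> i \<le> \<tau> j" if "i \<le> j" "j \<le> n" for i j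
    using that
  proof (induction j rule: dec_induct)
    case (step m)
    then have "\<tau> m < \<tau> (Suc m)"
      using assms(1) by (auto simp: simple_data_def)
    with step show ?case by simp
  qed simp
  have "0 \<le> \<tau> 0"
    using assms(1) by (auto simp: simple_data_def)
  with mono[of 0 i] mono[of i j] assms(2,3) show "0 \<le> \<tau> i" "\<tau> i \<le> \<tau> j"
    by auto
qed

definition refines :: "nat \<Rightarrow> (nat \<Rightarrow> real) \<Rightarrow> nat \<Rightarrow> (nat \<Rightarrow> real) \<Rightarrow> bool" where
  "refines N d n \<tau> \<longleftrightarrow> (\<forall>j\<le>n. \<forall>i<N. \<tau> j \<le> d i \<or> d (Suc i) \<le> \<tau> j)"

context
  fixes M Fl n \<tau> and \<xi> :: "nat \<Rightarrow> 'w \<Rightarrow> 'a::euclidean_space" and N d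
  assumes sd: "simple_data M Fl n \<tau> \<xi>"
    and d: "d 0 = 0" "\<And>i. i < N \<Longrightarrow> d i < d (Suc i)"
    and ref: "refines N d n \<tau>"
begin

text \<open>The cells and the pieces of a simple process are all open on the left and closed on the
  right; hence the right end point represents its cell.\<close>

lemma simple_process_refined:
  assumes "i < N" "t \<in> {d i<..d (Suc i)}"
  shows "simple_process n \<tau> \<xi> t \<omega> = simple_process n \<tau> \<xi> (d (Suc i)) \<omega>"
  unfolding simple_process_def
proof (rule sum.cong)
  fix j assume j: "j \<in> {..<n}"
  have "\<tau> j \<le> d i \<or> d (Suc i) \<le> \<tau> j" "\<tau> (Suc j) \<le> d i \<or> d (Suc i) \<le> \<tau> (Suc j)"
    using ref j assms(1) by (auto simp: refines_def)
  then have "indicator {\<tau> j<..\<tau> (Suc j)} t = (indicator {\<tau> j<..\<tau> (Suc j)} (d (Suc i)) :: real)"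
    using assms by (auto simp: indicator_def)
  then show "indicator {\<tau> j<..\<tau> (Suc j)} t *\<^sub>R \<xi> j \<omega>
    = indicator {\<tau> j<..\<tau> (Suc j)} (d (Suc i)) *\<^sub>R \<xi> j \<omega>"
    by simp
qed simp

lemma simple_integral_refined:
  assumes "k \<le> N"
  shows "simple_integral b n \<tau> \<xi> (d k) \<omega>
    = (\<Sum>i<k. (b (d (Suc i)) \<omega> - b (d i) \<omega>) *\<^sub>R simple_process n \<tau> \<xi> (d (Suc i)) \<omega>)"
proof -
  have "(b (min (d k) (\<tau> (Suc j))) \<omega> - b (min (d k) (\<tau> j)) \<omega>) *\<^sub>R \<xi> j \<omega>
    = (\<Sum>i<k. (b (d (Suc i)) \<omega> - b (d i) \<omega>) *\<^sub>R indicator {\<tau> j<..\<tau> (Suc j)} (d (Suc i)) *\<^sub>R \<xi> j \<omega>)"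
    if "j < n" for j
  proof -
    have "(\<Sum>i<k. indicator {\<tau> j<..\<tau> (Suc j)} (d (Suc i)) * (b (d (Suc i)) \<omega> - b (d i) \<omega>))
      = b (min (d k) (\<tau> (Suc j))) \<omega> - b (min (d k) (\<tau> j)) \<omega>"
      using simple_data_nonneg_mono[OF sd, of j "Suc j"] d ref that assms
      by (intro sum_indicator_increments[where B = "\<lambda>t. b t \<omega>"]) (auto simp: refines_def)
    then show ?thesis
      by (simp add: scaleR_sum_left[symmetric] mult.commute)
  qed
  then have "simple_integral b n \<tau> \<xi> (d k) \<omega>
    = (\<Sum>j<n. \<Sum>i<k. (b (d (Suc i)) \<omega> - b (d i) \<omega>) *\<^sub>R indicator {\<tau> j<..\<tau> (Suc j)} (d (Suc i)) *\<^sub>R \<xi> j \<omega>)"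
    by (simp add: simple_integral_def)
  also have "\<dots> = (\<Sum>i<k. \<Sum>j<n. (b (d (Suc i)) \<omega> - b (d i) \<omega>) *\<^sub>R indicator {\<tau> j<..\<tau> (Suc j)} (d (Suc i)) *\<^sub>R \<xi> j \<omega>)"
    by (rule sum.swap)
  finally show ?thesis
    by (simp only: simple_process_def scaleR_sum_right)
qed

text \<open>The value on the cell, although read off at its right end, is known at its left end: a
  jump time \<open>\<tau> j\<close> before \<open>d (Suc i)\<close> is at most \<open>d i\<close>.
  This is the predictability required by \<open>discrete_maximal_inequality\<close>.\<close>

lemma simple_process_refined_measurable:
  assumes "i < N" and mono: "\<And>s t. s \<le> t \<Longrightarrow> borel_measurable (Fl s) \<subseteq> (borel_measurable (Fl t) :: ('w \<Rightarrow> 'a) set)"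
  shows "simple_process n \<tau> \<xi> (d (Suc i)) \<in> borel_measurable (Fl (d i))"
  unfolding simple_process_def
proof (rule borel_measurable_sum)
  fix j assume j: "j \<in> {..<n}"
  show "(\<lambda>\<omega>. indicator {\<tau> j<..\<tau> (Suc j)} (d (Suc i)) *\<^sub>R \<xi> j \<omega>) \<in> borel_measurable (Fl (d i))"
  proof (cases "\<tau> j < d (Suc i)")
    case True
    then have "\<tau> j \<le> d i"
      using ref[unfolded refines_def, rule_format, of j i] j assms(1) by auto
    then have "\<xi> j \<in> borel_measurable (Fl (d i))"
      using mono[of "\<tau> j" "d i"] sd j by (auto simp: simple_data_def)
    then show ?thesis
      by (intro borel_measurable_scaleR borel_measurable_const)
  qed (simp add: indicator_def)
qed

end

lemma norm_simple_process_bounded: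
  fixes \<xi> :: "nat \<Rightarrow> 'w \<Rightarrow> 'a::euclidean_space"
  assumes "simple_data M Fl n \<tau> \<xi>"
  obtains C where "\<And>t \<omega>. \<omega> \<in> space M \<Longrightarrow> norm (simple_process n \<tau> \<xi> t \<omega>) \<le> C"
proof -
  have "\<forall>i\<in>{..<n}. \<exists>C. \<forall>\<omega>\<in>space M. norm (\<xi> i \<omega>) \<le> C"
    using assms by (auto simp: simple_data_def)
  from bchoice[OF this] obtain C where C: "\<And>i \<omega>. i < n \<Longrightarrow> \<omega> \<in> space M \<Longrightarrow> norm (\<xi> i \<omega>) \<le> C i"
    by auto
  have "norm (simple_process n \<tau> \<xi> t \<omega>) \<le> (\<Sum>i<n. C i)" if "\<omega> \<in> space M" for t \<omega>
    unfolding simple_process_def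
  proof (rule sum_norm_le)
    fix i assume i: "i \<in> {..<n}"
    then have "norm (\<xi> i \<omega>) \<le> C i"
      using C that by auto
    then show "norm (indicator {\<tau> i<..\<tau> (Suc i)} t *\<^sub>R \<xi> i \<omega>) \<le> C i"
      using order_trans[OF norm_ge_zero] by (auto simp: indicator_def)
  qed
  then show ?thesis by (rule that)
qed

text \<open>The last property is the one that \<open>refines\<close> asks for: no element of
  \<open>P\<close> lies strictly between two consecutive ones.\<close>

lemma finite_set_enumeration:
  fixes P :: "real set"
  assumes "finite P" "P \<noteq> {}"
  obtains d N where "\<And>i. i < N \<Longrightarrow> d i < d (Suc i)" "d ` {..N} = P" "d 0 = Min P" "d N = Max P"
    "\<And>p i. p \<in> P \<Longrightarrow> i < N \<Longrightarrow> p \<le> d i \<or> d (Suc i) \<le> p"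
proof -
  let ?xs = "sorted_list_of_set P"
  define d where "d i = ?xs ! i" for i
  define N where "N = card P - 1"
  have len: "length ?xs = Suc N"
    using assms by (simp add: N_def card_gt_0_iff)
  have d: "d i < d j" if "i < j" "j \<le> N" for i j
    unfolding d_def using that len by (intro sorted_wrt_nth_less[OF strict_sorted_list_of_set]) auto
  have im: "d ` {..N} = P"
  proof -
    have "P = set ?xs" using assms by simp
    also have "\<dots> = d ` {..<length ?xs}"
      by (auto simp: set_conv_nth d_def)
    also have "{..<length ?xs} = {..N}"
      using len by auto
    finally show ?thesis by simp
  qed
  have le: "d i \<le> d j" if "i \<le> j" "j \<le> N" for i j
    using d[of i j] that by (cases "i = j") auto
  show ?thesis
  proof (rule that[of N d])
    show "d 0 = Min P"
      using im le assms by (intro Min_eqI[symmetric]) auto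
    show "d N = Max P"
      using im le assms by (intro Max_eqI[symmetric]) auto
    fix p i assume "p \<in> P" "i < N"
    then obtain j where "p = d j" "j \<le> N" using im by auto
    then show "p \<le> d i \<or> d (Suc i) \<le> p"
      using le[of j i] le[of "Suc i" j] \<open>i < N\<close> by (cases "j \<le> i") auto
  qed (use d im in auto)
qed

lemma sum_indicator_pieces:
  fixes d :: "nat \<Rightarrow> real"
  assumes "\<And>i. i < N \<Longrightarrow> d i < d (Suc i)"
  shows "(\<Sum>i<N. indicator {d i<..d (Suc i)} s) = (indicator {d 0<..d N} s :: ennreal)"
  using assms
proof (induction N)
  case (Suc N)
  then have "d N < d (Suc N)" by simp
  moreover have "d 0 \<le> d N"
    using Suc.prems by (intro dec_induct[of 0 N "\<lambda>k. d 0 \<le> d k"]) (auto intro: order_trans[OF _ less_imp_le])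
  moreover have "(\<Sum>i<N. indicator {d i<..d (Suc i)} s) = (indicator {d 0<..d N} s :: ennreal)"
    using Suc by simp
  ultimately show ?case
    unfolding sum.lessThan_Suc by (auto simp: indicator_def)
qed simp

text \<open>Passes from the quadratic variation on a grid to the integral over time in which the
  approximation of an Ito integrand is measured.\<close>

lemma sum_le_nn_integral_pieces:
  fixes d :: "nat \<Rightarrow> real" and \<phi> :: "real \<Rightarrow> ennreal"
  assumes d: "\<And>i. i < N \<Longrightarrow> d i < d (Suc i)"
    and \<phi>: "\<And>i s. i < N \<Longrightarrow> s \<in> {d i<..d (Suc i)} \<Longrightarrow> \<phi> s = \<phi> (d (Suc i))"
  shows "(\<Sum>i<N. ennreal (d (Suc i) - d i) * \<phi> (d (Suc i))) \<le> (\<integral>\<^sup>+s\<in>{d 0..d N}. \<phi> s \<partial>lborel)"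
proof -
  have "(\<Sum>i<N. ennreal (d (Suc i) - d i) * \<phi> (d (Suc i)))
    = (\<Sum>i<N. \<integral>\<^sup>+s. \<phi> (d (Suc i)) * indicator {d i<..d (Suc i)} s \<partial>lborel)"
    using d by (intro sum.cong refl, subst nn_integral_cmult_indicator) (auto simp: mult.commute less_imp_le)
  also have "\<dots> = (\<integral>\<^sup>+s. (\<Sum>i<N. \<phi> (d (Suc i)) * indicator {d i<..d (Suc i)} s) \<partial>lborel)"
    by (rule nn_integral_sum[symmetric]) simp
  also have "\<dots> \<le> (\<integral>\<^sup>+s\<in>{d 0..d N}. \<phi> s \<partial>lborel)"
  proof (rule nn_integral_mono)
    fix s
    have "(\<Sum>i<N. \<phi> (d (Suc i)) * indicator {d i<..d (Suc i)} s)
      = (\<Sum>i<N. \<phi> s * indicator {d i<..d (Suc i)} s)"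
      by (intro sum.cong refl) (use \<phi>[of _ s] in \<open>auto simp: indicator_def\<close>)
    also have "\<dots> = \<phi> s * indicator {d 0<..d N} s"
      using sum_indicator_pieces[of N d s] d by (simp add: sum_distrib_left[symmetric])
    also have "\<dots> \<le> \<phi> s * indicator {d 0..d N} s"
      by (auto simp: indicator_def)
    finally show "(\<Sum>i<N. \<phi> (d (Suc i)) * indicator {d i<..d (Suc i)} s) \<le> \<phi> s * indicator {d 0..d N} s" .
  qed
  finally show ?thesis .
qed

section \<open>Integrals of simple processes in continuous time\<close>

context brownian_filtration
begin

lemma square_integral_measurable:
  assumes "(\<lambda>(t, \<omega>). H t \<omega>) \<in> borel_measurable (restrict_space borel {0..T} \<Otimes>\<^sub>M M)"
  shows "(\<lambda>\<omega>. \<integral>\<^sup>+s\<in>{0..T::real}. ennreal ((norm (H s \<omega> :: 'a::euclidean_space))\<^sup>2) \<partial>lborel) \<in> borel_measurable M"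
proof -
  let ?L = "restrict_space lborel {0..T}"
  have "sets (M \<Otimes>\<^sub>M ?L) = sets (M \<Otimes>\<^sub>M restrict_space borel {0..T})"
    by (intro sets_pair_measure_cong sets_restrict_space_cong) auto
  moreover have "(\<lambda>(\<omega>, t). H t \<omega>) \<in> borel_measurable (M \<Otimes>\<^sub>M restrict_space borel {0..T})"
    using measurable_pair_swap[OF assms] by (simp add: case_prod_beta')
  ultimately have "(\<lambda>(\<omega>, t). H t \<omega>) \<in> borel_measurable (M \<Otimes>\<^sub>M ?L)"
    using measurable_cong_sets by blast
  then have "(\<lambda>(\<omega>, t). ennreal ((norm (H t \<omega>))\<^sup>2)) \<in> borel_measurable (M \<Otimes>\<^sub>M ?L)"
    unfolding case_prod_beta' by measurable
  moreover have "sigma_finite_measure ?L"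
    by (intro sigma_finite_measure_restrict_space) (auto intro: lborel.sigma_finite_measure_axioms)
  ultimately have "(\<lambda>\<omega>. \<integral>\<^sup>+s. ennreal ((norm (H s \<omega>))\<^sup>2) \<partial>?L) \<in> borel_measurable M"
    by (rule sigma_finite_measure.borel_measurable_nn_integral[rotated])
  then show ?thesis
    by (simp add: nn_integral_restrict_space)
qed

lemma progressive_measurable:
  assumes "progressive Fl H" "T \<ge> 0"
  shows "(\<lambda>(t, \<omega>). H t \<omega>) \<in> borel_measurable (restrict_space borel {0..T} \<Otimes>\<^sub>M M)"
proof -
  have "(\<lambda>(t, \<omega>). H t \<omega>) \<in> borel_measurable (restrict_space borel {0..T} \<Otimes>\<^sub>M Fl T)"
    using assms by (auto simp: progressive_def)
  moreover have "(\<lambda>x. (fst x, snd x)) \<in> measurable (restrict_space borel {0..T} \<Otimes>\<^sub>M M) (restrict_space borel {0..T} \<Otimes>\<^sub>M Fl T)"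
    by (intro measurable_Pair measurable_fst measurable_compose[OF measurable_snd] Fl_measurable[of _ T]) simp
  ultimately show ?thesis
    using measurable_compose by fastforce
qed

lemma simple_process_measurable:
  assumes "simple_data M Fl n \<tau> \<xi>"
  shows "(\<lambda>(t, \<omega>). simple_process n \<tau> \<xi> t \<omega>) \<in> borel_measurable (restrict_space borel {0..T} \<Otimes>\<^sub>M M)"
proof -
  have [measurable]: "\<xi> i \<in> borel_measurable M" if "i \<in> {..<n}" for i
    using assms Fl_measurable that by (auto simp: simple_data_def)
  have [measurable]: "(\<lambda>x. x) \<in> measurable (restrict_space borel {0..T}) borel"
    by (rule measurable_restrict_space1) simp
  have [measurable]: "(\<lambda>x. indicator {\<tau> i<..\<tau> (Suc i)} (fst x) :: real) \<in> borel_measurable (restrict_space borel {0..T} \<Otimes>\<^sub>M M)" for i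
    by (rule measurable_compose[OF measurable_fst]) measurable
  show ?thesis
    unfolding simple_process_def case_prod_beta'
  proof (intro borel_measurable_sum borel_measurable_scaleR)
    fix i assume "i \<in> {..<n}"
    then show "(\<lambda>x. \<xi> i (snd x)) \<in> borel_measurable (restrict_space borel {0..T} \<Otimes>\<^sub>M M)"
      by measurable
  qed measurable
qed

lemma simple_integral_measurable:
  assumes "simple_data M Fl n \<tau> \<xi>" "0 \<le> t"
  shows "simple_integral b n \<tau> \<xi> t \<in> borel_measurable (Fl t)"
  unfolding simple_integral_def
proof (rule borel_measurable_sum)
  fix i assume i: "i \<in> {..<n}"
  have \<tau>: "0 \<le> \<tau> i" "\<tau> i \<le> \<tau> (Suc i)"
    using simple_data_nonneg_mono[OF assms(1), of i "Suc i"] i by auto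
  show "(\<lambda>\<omega>. (b (min t (\<tau> (Suc i))) \<omega> - b (min t (\<tau> i)) \<omega>) *\<^sub>R \<xi> i \<omega>) \<in> borel_measurable (Fl t)"
  proof (cases "\<tau> i \<le> t")
    case True
    then have "\<xi> i \<in> borel_measurable (Fl t)"
      using Fl_measurable_mono[OF True, of "\<xi> i" borel] assms(1) i by (auto simp: simple_data_def)
    then show ?thesis
      using \<tau> assms(2) by (intro borel_measurable_scaleR borel_measurable_diff b_measurable_Fl) auto
  next
    case False
    then have "min t (\<tau> (Suc i)) = t" "min t (\<tau> i) = t" using \<tau> by auto
    then show ?thesis by simp
  qed
qed

text \<open>On a common refinement of both partitions that also contains \<open>Q\<close>, the
  difference is a single discrete integral. The bound does not involve \<open>Q\<close>, which later
  allows arbitrarily fine sets of times.\<close>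

lemma simple_maximal_inequality:
  fixes \<xi>1 \<xi>2 :: "nat \<Rightarrow> 'w \<Rightarrow> 'a::euclidean_space"
  assumes S1: "simple_data M Fl n1 \<tau>1 \<xi>1" and S2: "simple_data M Fl n2 \<tau>2 \<xi>2"
    and Q: "finite Q" "Q \<subseteq> {0..T}" and T: "T \<ge> 0" and ac: "a > 0" "c > 0"
  shows "prob {\<omega> \<in> space M. \<exists>t\<in>Q. norm (simple_integral b n1 \<tau>1 \<xi>1 t \<omega> - simple_integral b n2 \<tau>2 \<xi>2 t \<omega>) > a}
    \<le> c / a\<^sup>2 + prob {\<omega> \<in> space M. (\<integral>\<^sup>+s\<in>{0..T}.
        ennreal ((norm (simple_process n1 \<tau>1 \<xi>1 s \<omega> - simple_process n2 \<tau>2 \<xi>2 s \<omega>))\<^sup>2) \<partial>lborel) > ennreal c}"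
proof -
  let ?S = "\<lambda>t \<omega>. simple_process n1 \<tau>1 \<xi>1 t \<omega> - simple_process n2 \<tau>2 \<xi>2 t \<omega>"
  let ?I = "\<lambda>t \<omega>. simple_integral b n1 \<tau>1 \<xi>1 t \<omega> - simple_integral b n2 \<tau>2 \<xi>2 t \<omega>"
  \<comment> \<open>Jump times after \<open>T\<close> are dropped, as \<open>refines\<close>
    permits; \<open>0\<close> and \<open>T\<close> are added so that the grid starts and ends
    there.\<close>
  define P where "P = {0, T} \<union> Q \<union> (\<tau>1 ` {..n1} \<union> \<tau>2 ` {..n2}) \<inter> {0..T}"
  have P: "finite P" "P \<noteq> {}" "P \<subseteq> {0..T}" "0 \<in> P" "T \<in> P"
    using Q T by (auto simp: P_def)
  obtain d N where d: "\<And>i. i < N \<Longrightarrow> d i < d (Suc i)" "d ` {..N} = P" "d 0 = Min P" "d N = Max P"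
    "\<And>p i. p \<in> P \<Longrightarrow> i < N \<Longrightarrow> p \<le> d i \<or> d (Suc i) \<le> p"
    using finite_set_enumeration[OF P(1,2)] by metis
  have d0: "d 0 = 0"
    unfolding d(3) using P by (intro Min_eqI) auto
  have dN: "d N = T"
    unfolding d(4) using P by (intro Max_eqI) auto
  have dT: "0 \<le> d i" "d i \<le> T" if "i \<le> N" for i
    using d(2) P(3) that by auto
  have r1: "refines N d n1 \<tau>1"
    unfolding refines_def
  proof (intro allI impI)
    fix j i assume "j \<le> n1" "i < N"
    then show "\<tau>1 j \<le> d i \<or> d (Suc i) \<le> \<tau>1 j"
      using d(5)[of "\<tau>1 j" i] simple_data_nonneg_mono[OF S1, of j j] dT[of "Suc i"]
      by (cases "\<tau>1 j \<le> T") (auto simp: P_def)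
  qed
  have r2: "refines N d n2 \<tau>2"
    unfolding refines_def
  proof (intro allI impI)
    fix j i assume "j \<le> n2" "i < N"
    then show "\<tau>2 j \<le> d i \<or> d (Suc i) \<le> \<tau>2 j"
      using d(5)[of "\<tau>2 j" i] simple_data_nonneg_mono[OF S2, of j j] dT[of "Suc i"]
      by (cases "\<tau>2 j \<le> T") (auto simp: P_def)
  qed
  obtain C1 C2 where C: "\<And>t \<omega>. \<omega> \<in> space M \<Longrightarrow> norm (simple_process n1 \<tau>1 \<xi>1 t \<omega>) \<le> C1"
    "\<And>t \<omega>. \<omega> \<in> space M \<Longrightarrow> norm (simple_process n2 \<tau>2 \<xi>2 t \<omega>) \<le> C2"
    using norm_simple_process_bounded[OF S1] norm_simple_process_bounded[OF S2] by metis
  have mono: "borel_measurable (Fl s) \<subseteq> (borel_measurable (Fl t) :: ('w \<Rightarrow> 'a) set)" if "s \<le> t" for s t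
    using Fl_measurable_mono[OF that] by auto
  have "prob {\<omega> \<in> space M. \<exists>t\<in>Q. norm (?I t \<omega>) > a}
    \<le> prob {\<omega> \<in> space M. \<exists>k\<le>N. norm (\<Sum>i<k. (b (d (Suc i)) \<omega> - b (d i) \<omega>) *\<^sub>R ?S (d (Suc i)) \<omega>) > a}"
  proof (rule finite_measure_mono)
    show "{\<omega> \<in> space M. \<exists>t\<in>Q. norm (?I t \<omega>) > a}
      \<subseteq> {\<omega> \<in> space M. \<exists>k\<le>N. norm (\<Sum>i<k. (b (d (Suc i)) \<omega> - b (d i) \<omega>) *\<^sub>R ?S (d (Suc i)) \<omega>) > a}"
    proof safe
      fix \<omega> t assume t: "t \<in> Q" "norm (?I t \<omega>) > a"
      then have "t \<in> d ` {..N}"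
        unfolding d(2) P_def by simp
      then obtain k where k: "k \<le> N" "t = d k"
        by blast
      have "?I t \<omega> = (\<Sum>i<k. (b (d (Suc i)) \<omega> - b (d i) \<omega>) *\<^sub>R ?S (d (Suc i)) \<omega>)"
        using simple_integral_refined[OF S1 d0 _ r1 k(1), of b \<omega>] simple_integral_refined[OF S2 d0 _ r2 k(1), of b \<omega>] d(1)
        by (simp add: k(2) scaleR_diff_right sum_subtractf)
      with t k show "\<exists>k\<le>N. norm (\<Sum>i<k. (b (d (Suc i)) \<omega> - b (d i) \<omega>) *\<^sub>R ?S (d (Suc i)) \<omega>) > a"
        by auto
    qed
    have S_meas: "(\<lambda>\<omega>. ?S (d (Suc i)) \<omega>) \<in> borel_measurable M" if "i < N" for i
      using that
      by (intro borel_measurable_diff Fl_measurable[OF simple_process_refined_measurable[OF S1 d0 d(1) r1 _ mono]]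
          Fl_measurable[OF simple_process_refined_measurable[OF S2 d0 d(1) r2 _ mono]])
    have "{\<omega> \<in> space M. \<exists>k\<in>{..N}. norm (\<Sum>i<k. (b (d (Suc i)) \<omega> - b (d i) \<omega>) *\<^sub>R ?S (d (Suc i)) \<omega>) > a} \<in> events"
      using dT by (intro norm_exceeds_events borel_measurable_sum borel_measurable_scaleR S_meas
          borel_measurable_diff b_measurable) auto
    then show "{\<omega> \<in> space M. \<exists>k\<le>N. norm (\<Sum>i<k. (b (d (Suc i)) \<omega> - b (d i) \<omega>) *\<^sub>R ?S (d (Suc i)) \<omega>) > a} \<in> events"
      unfolding Bex_def atMost_iff .
  qed
  also have "\<dots> \<le> c / a\<^sup>2 + prob {\<omega> \<in> space M. (\<Sum>i<N. (d (Suc i) - d i) * (norm (?S (d (Suc i)) \<omega>))\<^sup>2) > c}"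
  proof (rule discrete_maximal_inequality)
    show "(\<lambda>\<omega>. ?S (d (Suc i)) \<omega>) \<in> borel_measurable (Fl (d i))" if "i < N" for i
      using that
      by (intro borel_measurable_diff simple_process_refined_measurable[OF S1 d0 d(1) r1 _ mono]
          simple_process_refined_measurable[OF S2 d0 d(1) r2 _ mono])
    show "norm (?S (d (Suc i)) \<omega>) \<le> C1 + C2" if "\<omega> \<in> space M" for i \<omega>
      using norm_triangle_ineq4[of "simple_process n1 \<tau>1 \<xi>1 (d (Suc i)) \<omega>" "simple_process n2 \<tau>2 \<xi>2 (d (Suc i)) \<omega>"]
        C[OF that, of "d (Suc i)"] by linarith
  qed (use d0 d(1) ac in auto)
  also have "prob {\<omega> \<in> space M. (\<Sum>i<N. (d (Suc i) - d i) * (norm (?S (d (Suc i)) \<omega>))\<^sup>2) > c}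
    \<le> prob {\<omega> \<in> space M. (\<integral>\<^sup>+s\<in>{0..T}. ennreal ((norm (?S s \<omega>))\<^sup>2) \<partial>lborel) > ennreal c}"
  proof (rule finite_measure_mono)
    show "{\<omega> \<in> space M. (\<Sum>i<N. (d (Suc i) - d i) * (norm (?S (d (Suc i)) \<omega>))\<^sup>2) > c}
      \<subseteq> {\<omega> \<in> space M. (\<integral>\<^sup>+s\<in>{0..T}. ennreal ((norm (?S s \<omega>))\<^sup>2) \<partial>lborel) > ennreal c}"
    proof safe
      fix \<omega> assume c: "(\<Sum>i<N. (d (Suc i) - d i) * (norm (?S (d (Suc i)) \<omega>))\<^sup>2) > c"
      then have "ennreal c < ennreal (\<Sum>i<N. (d (Suc i) - d i) * (norm (?S (d (Suc i)) \<omega>))\<^sup>2)"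
        using ac by (simp add: ennreal_less_iff)
      also have "\<dots> = (\<Sum>i<N. ennreal (d (Suc i) - d i) * ennreal ((norm (?S (d (Suc i)) \<omega>))\<^sup>2))"
        using d(1) by (subst sum_ennreal[symmetric]) (auto simp: ennreal_mult less_imp_le intro!: sum.cong)
      also have "\<dots> \<le> (\<integral>\<^sup>+s\<in>{d 0..d N}. ennreal ((norm (?S s \<omega>))\<^sup>2) \<partial>lborel)"
      proof (rule sum_le_nn_integral_pieces)
        show "d i < d (Suc i)" if "i < N" for i
          using d(1) that .
        fix i s assume si: "i < N" "s \<in> {d i<..d (Suc i)}"
        have "simple_process n1 \<tau>1 \<xi>1 s \<omega> = simple_process n1 \<tau>1 \<xi>1 (d (Suc i)) \<omega>"
          by (rule simple_process_refined[OF S1 d0 _ r1 si]) (rule d(1))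
        moreover have "simple_process n2 \<tau>2 \<xi>2 s \<omega> = simple_process n2 \<tau>2 \<xi>2 (d (Suc i)) \<omega>"
          by (rule simple_process_refined[OF S2 d0 _ r2 si]) (rule d(1))
        ultimately show "ennreal ((norm (?S s \<omega>))\<^sup>2) = ennreal ((norm (?S (d (Suc i)) \<omega>))\<^sup>2)"
          by (simp only:)
      qed
      finally show "(\<integral>\<^sup>+s\<in>{0..T}. ennreal ((norm (?S s \<omega>))\<^sup>2) \<partial>lborel) > ennreal c"
        by (simp add: d0 dN)
    qed
    have "(\<lambda>\<omega>. \<integral>\<^sup>+s\<in>{0..T}. ennreal ((norm (?S s \<omega>))\<^sup>2) \<partial>lborel) \<in> borel_measurable M"
      using simple_process_measurable[OF S1] simple_process_measurable[OF S2]
      by (intro square_integral_measurable) (auto simp: case_prod_beta')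
    then show "{\<omega> \<in> space M. (\<integral>\<^sup>+s\<in>{0..T}. ennreal ((norm (?S s \<omega>))\<^sup>2) \<partial>lborel) > ennreal c} \<in> events"
      by measurable
  qed
  finally show ?thesis by simp
qed

end

section \<open>Approximation of the Ito integral\<close>

text \<open>The form in which the maximal inequalities are used: their deterministic term becomes
  \<open>e\<close>, their remaining probabilities form \<open>r\<close>.\<close>

lemma tendsto_zero_if_le_add:
  fixes f :: "nat \<Rightarrow> real"
  assumes "\<And>k. 0 \<le> f k"
    and "\<And>e. e > 0 \<Longrightarrow> \<exists>r. r \<longlonglongrightarrow> 0 \<and> (\<forall>k. f k \<le> e + r k)"
  shows "f \<longlonglongrightarrow> 0"
proof (rule LIMSEQ_I)
  fix e :: real assume "e > 0"
  then obtain r where r: "r \<longlonglongrightarrow> 0" "\<forall>k. f k \<le> e / 2 + r k"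
    using assms(2)[of "e / 2"] by auto
  from r(1) \<open>e > 0\<close> have "\<forall>\<^sub>F k in sequentially. r k < e / 2"
    by (intro order_tendstoD) auto
  then have "\<forall>\<^sub>F k in sequentially. norm (f k - 0) < e"
  proof eventually_elim
    case (elim k)
    then show ?case using assms(1)[of k] r(2)[rule_format, of k] by simp
  qed
  then show "\<exists>no. \<forall>n\<ge>no. norm (f n - 0) < e"
    by (simp add: eventually_sequentially)
qed

context brownian_filtration
begin

text \<open>From (x + y)^2 \<le> 2 x^2 + 2 y^2: if both squared distances to \<open>G\<close> are at
  most c / 4, then the one between \<open>F\<close> and \<open>K\<close> is at most c.\<close>

lemma prob_square_integral_triangle:
  fixes F G K :: "real \<Rightarrow> 'w \<Rightarrow> 'a::euclidean_space"
  assumes F: "(\<lambda>(t, \<omega>). F t \<omega>) \<in> borel_measurable (restrict_space borel {0..T} \<Otimes>\<^sub>M M)"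
    and G: "(\<lambda>(t, \<omega>). G t \<omega>) \<in> borel_measurable (restrict_space borel {0..T} \<Otimes>\<^sub>M M)"
    and K: "(\<lambda>(t, \<omega>). K t \<omega>) \<in> borel_measurable (restrict_space borel {0..T} \<Otimes>\<^sub>M M)"
    and c: "c > 0"
  shows "prob {\<omega> \<in> space M. (\<integral>\<^sup>+s\<in>{0..T}. ennreal ((norm (F s \<omega> - K s \<omega>))\<^sup>2) \<partial>lborel) > ennreal c}
    \<le> prob {\<omega> \<in> space M. (\<integral>\<^sup>+s\<in>{0..T}. ennreal ((norm (F s \<omega> - G s \<omega>))\<^sup>2) \<partial>lborel) > ennreal (c / 4)}
     + prob {\<omega> \<in> space M. (\<integral>\<^sup>+s\<in>{0..T}. ennreal ((norm (K s \<omega> - G s \<omega>))\<^sup>2) \<partial>lborel) > ennreal (c / 4)}"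
proof -
  let ?L = "restrict_space lborel {0..T}"
  let ?N = "\<lambda>A B \<omega>. \<integral>\<^sup>+s\<in>{0..T}. ennreal ((norm (A s \<omega> - B s \<omega>))\<^sup>2) \<partial>lborel"
  have diff: "(\<lambda>(t, \<omega>). A t \<omega> - B t \<omega>) \<in> borel_measurable (restrict_space borel {0..T} \<Otimes>\<^sub>M M)"
    if "(\<lambda>(t, \<omega>). A t \<omega>) \<in> borel_measurable (restrict_space borel {0..T} \<Otimes>\<^sub>M M)"
      "(\<lambda>(t, \<omega>). B t \<omega>) \<in> borel_measurable (restrict_space borel {0..T} \<Otimes>\<^sub>M M)" for A B :: "real \<Rightarrow> 'w \<Rightarrow> 'a"
    using borel_measurable_diff[OF that] by (simp add: case_prod_beta')
  have sect: "(\<lambda>s. ennreal ((norm (A s \<omega> - B s \<omega>))\<^sup>2)) \<in> borel_measurable ?L" if "\<omega> \<in> space M"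
    "(\<lambda>(t, \<omega>). A t \<omega>) \<in> borel_measurable (restrict_space borel {0..T} \<Otimes>\<^sub>M M)"
    "(\<lambda>(t, \<omega>). B t \<omega>) \<in> borel_measurable (restrict_space borel {0..T} \<Otimes>\<^sub>M M)" for A B :: "real \<Rightarrow> 'w \<Rightarrow> 'a" and \<omega>
  proof -
    have "(\<lambda>t. A t \<omega> - B t \<omega>) \<in> borel_measurable (restrict_space borel {0..T})"
      using measurable_Pair1[OF diff[OF that(2,3)] that(1)] by simp
    moreover have "sets ?L = sets (restrict_space borel {0..T})"
      by (intro sets_restrict_space_cong) simp
    ultimately have [measurable]: "(\<lambda>t. A t \<omega> - B t \<omega>) \<in> borel_measurable ?L"
      using measurable_cong_sets by blast
    show ?thesis by measurable
  qed
  have meas: "{\<omega> \<in> space M. ?N A B \<omega> > ennreal c} \<in> events"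
    if "(\<lambda>(t, \<omega>). A t \<omega>) \<in> borel_measurable (restrict_space borel {0..T} \<Otimes>\<^sub>M M)"
      "(\<lambda>(t, \<omega>). B t \<omega>) \<in> borel_measurable (restrict_space borel {0..T} \<Otimes>\<^sub>M M)" for A B :: "real \<Rightarrow> 'w \<Rightarrow> 'a" and c
  proof -
    have [measurable]: "?N A B \<in> borel_measurable M"
      by (rule square_integral_measurable[OF diff[OF that]])
    show ?thesis by measurable
  qed
  have sub: "?N F K \<omega> \<le> 2 * ?N F G \<omega> + 2 * ?N K G \<omega>" if "\<omega> \<in> space M" for \<omega>
  proof -
    have "?N F K \<omega> = (\<integral>\<^sup>+s. ennreal ((norm (F s \<omega> - K s \<omega>))\<^sup>2) \<partial>?L)"
      by (simp add: nn_integral_restrict_space)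
    also have "\<dots> \<le> (\<integral>\<^sup>+s. 2 * ennreal ((norm (F s \<omega> - G s \<omega>))\<^sup>2) + 2 * ennreal ((norm (K s \<omega> - G s \<omega>))\<^sup>2) \<partial>?L)"
    proof (rule nn_integral_mono)
      fix s
      have "norm (F s \<omega> - K s \<omega>) \<le> norm (F s \<omega> - G s \<omega>) + norm (K s \<omega> - G s \<omega>)"
        using norm_triangle_ineq4[of "F s \<omega> - G s \<omega>" "K s \<omega> - G s \<omega>"] by simp
      then have "(norm (F s \<omega> - K s \<omega>))\<^sup>2 \<le> (norm (F s \<omega> - G s \<omega>) + norm (K s \<omega> - G s \<omega>))\<^sup>2"
        by (intro power_mono) auto
      also have "\<dots> \<le> 2 * (norm (F s \<omega> - G s \<omega>))\<^sup>2 + 2 * (norm (K s \<omega> - G s \<omega>))\<^sup>2"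
        using sum_squares_bound[of "norm (F s \<omega> - G s \<omega>)" "norm (K s \<omega> - G s \<omega>)"]
        by (simp add: power2_sum)
      finally have "ennreal ((norm (F s \<omega> - K s \<omega>))\<^sup>2)
          \<le> ennreal (2 * (norm (F s \<omega> - G s \<omega>))\<^sup>2 + 2 * (norm (K s \<omega> - G s \<omega>))\<^sup>2)"
        by (rule ennreal_leI)
      then show "ennreal ((norm (F s \<omega> - K s \<omega>))\<^sup>2)
          \<le> 2 * ennreal ((norm (F s \<omega> - G s \<omega>))\<^sup>2) + 2 * ennreal ((norm (K s \<omega> - G s \<omega>))\<^sup>2)"
        by (simp add: ennreal_mult)
    qed
    also have "\<dots> = 2 * (\<integral>\<^sup>+s. ennreal ((norm (F s \<omega> - G s \<omega>))\<^sup>2) \<partial>?L) + 2 * (\<integral>\<^sup>+s. ennreal ((norm (K s \<omega> - G s \<omega>))\<^sup>2) \<partial>?L)"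
      using sect[OF that F G] sect[OF that K G] by (simp add: nn_integral_add nn_integral_cmult)
    finally show ?thesis
      by (simp add: nn_integral_restrict_space)
  qed
  show ?thesis
  proof (intro prob_le_add meas F G K subsetI)
    fix \<omega> assume "\<omega> \<in> {\<omega> \<in> space M. ?N F K \<omega> > ennreal c}"
    then have \<omega>: "\<omega> \<in> space M" "?N F K \<omega> > ennreal c" by auto
    show "\<omega> \<in> {\<omega> \<in> space M. ?N F G \<omega> > ennreal (c / 4)} \<union> {\<omega> \<in> space M. ?N K G \<omega> > ennreal (c / 4)}"
    proof (rule ccontr)
      assume "\<not> ?thesis"
      then have "?N F G \<omega> \<le> ennreal (c / 4)" "?N K G \<omega> \<le> ennreal (c / 4)"
        using \<omega> by auto
      then have "?N F K \<omega> \<le> 2 * ennreal (c / 4) + 2 * ennreal (c / 4)"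
        using sub[OF \<omega>(1)] by (meson add_mono mult_left_mono order_trans zero_le)
      also have "\<dots> = ennreal (2 * (c / 4) + 2 * (c / 4))"
        using c ennreal_mult'[of 2 "c / 4"] ennreal_plus[of "c / 2" "c / 2"] by simp
      also have "2 * (c / 4) + 2 * (c / 4) = c"
        by simp
      finally show False using \<omega>(2) by simp
    qed
  qed
qed

lemma prob_norm_triangle:
  fixes U V W :: "'w \<Rightarrow> 'a::euclidean_space"
  assumes [measurable]: "U \<in> borel_measurable M" "V \<in> borel_measurable M" "W \<in> borel_measurable M"
  shows "prob {\<omega> \<in> space M. norm (U \<omega> - W \<omega>) > a}
    \<le> prob {\<omega> \<in> space M. norm (U \<omega> - V \<omega>) > a / 2} + prob {\<omega> \<in> space M. norm (V \<omega> - W \<omega>) > a / 2}"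
proof -
  have "norm (U \<omega> - V \<omega>) > a / 2 \<or> norm (V \<omega> - W \<omega>) > a / 2" if "norm (U \<omega> - W \<omega>) > a" for \<omega>
  proof -
    have "norm (U \<omega> - W \<omega>) \<le> norm (U \<omega> - V \<omega>) + norm (V \<omega> - W \<omega>)"
      using norm_triangle_ineq[of "U \<omega> - V \<omega>" "V \<omega> - W \<omega>"] by simp
    with that show ?thesis by linarith
  qed
  then have "{\<omega> \<in> space M. norm (U \<omega> - W \<omega>) > a}
    \<subseteq> {\<omega> \<in> space M. norm (U \<omega> - V \<omega>) > a / 2} \<union> {\<omega> \<in> space M. norm (V \<omega> - W \<omega>) > a / 2}"
    by blast
  then show ?thesis
    by (rule prob_le_add) measurable
qed

lemma prob_square_integral_mono:
  fixes F G :: "real \<Rightarrow> 'w \<Rightarrow> 'a::euclidean_space"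
  assumes F: "(\<lambda>(t, \<omega>). F t \<omega>) \<in> borel_measurable (restrict_space borel {0..T} \<Otimes>\<^sub>M M)"
    and G: "(\<lambda>(t, \<omega>). G t \<omega>) \<in> borel_measurable (restrict_space borel {0..T} \<Otimes>\<^sub>M M)"
    and t: "t \<le> T"
  shows "prob {\<omega> \<in> space M. (\<integral>\<^sup>+s\<in>{0..t}. ennreal ((norm (F s \<omega> - G s \<omega>))\<^sup>2) \<partial>lborel) > c}
    \<le> prob {\<omega> \<in> space M. (\<integral>\<^sup>+s\<in>{0..T}. ennreal ((norm (F s \<omega> - G s \<omega>))\<^sup>2) \<partial>lborel) > c}"
proof (rule finite_measure_mono)
  have "(\<integral>\<^sup>+s\<in>{0..t}. ennreal ((norm (F s \<omega> - G s \<omega>))\<^sup>2) \<partial>lborel) \<le> (\<integral>\<^sup>+s\<in>{0..T}. ennreal ((norm (F s \<omega> - G s \<omega>))\<^sup>2) \<partial>lborel)" for \<omega>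
    using t by (intro nn_integral_mono) (auto simp: indicator_def)
  then show "{\<omega> \<in> space M. (\<integral>\<^sup>+s\<in>{0..t}. ennreal ((norm (F s \<omega> - G s \<omega>))\<^sup>2) \<partial>lborel) > c}
    \<subseteq> {\<omega> \<in> space M. (\<integral>\<^sup>+s\<in>{0..T}. ennreal ((norm (F s \<omega> - G s \<omega>))\<^sup>2) \<partial>lborel) > c}"
    by (auto intro: order.strict_trans2)
  have [measurable]: "(\<lambda>\<omega>. \<integral>\<^sup>+s\<in>{0..T}. ennreal ((norm (F s \<omega> - G s \<omega>))\<^sup>2) \<partial>lborel) \<in> borel_measurable M"
    using borel_measurable_diff[OF F G] by (intro square_integral_measurable) (simp add: case_prod_beta')
  show "{\<omega> \<in> space M. (\<integral>\<^sup>+s\<in>{0..T}. ennreal ((norm (F s \<omega> - G s \<omega>))\<^sup>2) \<partial>lborel) > c} \<in> events"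
    by measurable
qed

lemma ito_integral_measurable:
  assumes "ito_integral M Fl b H I" "T \<ge> 0"
  shows "(\<lambda>(t, \<omega>). H t \<omega>) \<in> borel_measurable (restrict_space borel {0..T} \<Otimes>\<^sub>M M)"
    and "I T \<in> borel_measurable M"
proof -
  show "(\<lambda>(t, \<omega>). H t \<omega>) \<in> borel_measurable (restrict_space borel {0..T} \<Otimes>\<^sub>M M)"
    using assms by (intro progressive_measurable) (auto simp: ito_integral_def)
  have "I T \<in> borel_measurable (Fl T)"
    using assms by (simp add: ito_integral_def)
  then show "I T \<in> borel_measurable M"
    by (rule Fl_measurable)
qed

text \<open>The approximating simple processes in \<^const>\<open>ito_integral\<close> may depend on the time; this shows
  that those for \<open>T\<close> serve all earlier times as well.\<close>

lemma simple_integral_tendsto_ito_integral: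
  fixes H :: "real \<Rightarrow> 'w \<Rightarrow> 'a::euclidean_space"
  assumes ito: "ito_integral M Fl b H I" and t: "0 \<le> t" "t \<le> T"
    and sd: "\<And>k. simple_data M Fl (n k) (\<tau> k) (\<xi> k)"
    and lim: "null_in_prob M (\<lambda>k \<omega>. \<integral>\<^sup>+s\<in>{0..T}.
          ennreal ((norm (simple_process (n k) (\<tau> k) (\<xi> k) s \<omega> - H s \<omega>))\<^sup>2) \<partial>lborel)"
    and a: "a > 0"
  shows "(\<lambda>k. prob {\<omega> \<in> space M. norm (simple_integral b (n k) (\<tau> k) (\<xi> k) t \<omega> - I t \<omega>) > a}) \<longlonglongrightarrow> 0"
proof (rule tendsto_zero_if_le_add)
  let ?S = "\<lambda>k. simple_process (n k) (\<tau> k) (\<xi> k)" and ?J = "\<lambda>k. simple_integral b (n k) (\<tau> k) (\<xi> k)"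
  obtain n' \<tau>' \<xi>' where sd': "\<And>k. simple_data M Fl (n' k) (\<tau>' k) (\<xi>' k)"
    and lim': "null_in_prob M (\<lambda>k \<omega>. \<integral>\<^sup>+s\<in>{0..t}.
          ennreal ((norm (simple_process (n' k) (\<tau>' k) (\<xi>' k) s \<omega> - H s \<omega>))\<^sup>2) \<partial>lborel)"
    and lim_J': "null_in_prob M (\<lambda>k \<omega>.
          ennreal (norm (simple_integral b (n' k) (\<tau>' k) (\<xi>' k) t \<omega> - I t \<omega>)))"
    using ito t unfolding ito_integral_def by meson
  let ?S' = "\<lambda>k. simple_process (n' k) (\<tau>' k) (\<xi>' k)" and ?J' = "\<lambda>k. simple_integral b (n' k) (\<tau>' k) (\<xi>' k)"
  fix e :: real assume "e > 0"
  \<comment> \<open>Chosen so that the term \<open>c / (a / 2)\<^sup>2\<close> of the maximal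
    inequality at level \<open>a / 2\<close> equals \<open>e\<close>.\<close>
  define c where "c = e * (a / 2)\<^sup>2"
  have c: "c > 0" using \<open>e > 0\<close> a by (simp add: c_def)
  let ?N = "\<lambda>T A \<omega>. \<integral>\<^sup>+s\<in>{0..T}. ennreal ((norm (A s \<omega> - H s \<omega>))\<^sup>2) \<partial>lborel"
  define r where "r = (\<lambda>k. prob {\<omega> \<in> space M. ?N T (?S k) \<omega> > ennreal (c / 4)}
    + prob {\<omega> \<in> space M. ?N t (?S' k) \<omega> > ennreal (c / 4)}
    + prob {\<omega> \<in> space M. ennreal (norm (?J' k t \<omega> - I t \<omega>)) > ennreal (a / 2)})"
  have "r \<longlonglongrightarrow> 0 + 0 + 0"
    unfolding r_def using lim lim' lim_J' c a
    by (intro tendsto_add) (auto simp: null_in_prob_def simp del: ennreal_less_iff)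
  moreover have "prob {\<omega> \<in> space M. norm (?J k t \<omega> - I t \<omega>) > a} \<le> e + r k" for k
  proof -
    have "prob {\<omega> \<in> space M. norm (?J k t \<omega> - I t \<omega>) > a}
      \<le> prob {\<omega> \<in> space M. norm (?J k t \<omega> - ?J' k t \<omega>) > a / 2} + prob {\<omega> \<in> space M. norm (?J' k t \<omega> - I t \<omega>) > a / 2}"
      by (intro prob_norm_triangle Fl_measurable[OF simple_integral_measurable[OF sd t(1)]]
          Fl_measurable[OF simple_integral_measurable[OF sd' t(1)]] ito_integral_measurable(2)[OF ito t(1)])
    also have "prob {\<omega> \<in> space M. norm (?J k t \<omega> - ?J' k t \<omega>) > a / 2}
      \<le> c / (a / 2)\<^sup>2 + prob {\<omega> \<in> space M. (\<integral>\<^sup>+s\<in>{0..t}. ennreal ((norm (?S k s \<omega> - ?S' k s \<omega>))\<^sup>2) \<partial>lborel) > ennreal c}"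
      using simple_maximal_inequality[OF sd[of k] sd'[of k], of "{t}" t "a / 2" c] t a c by simp
    also have "prob {\<omega> \<in> space M. (\<integral>\<^sup>+s\<in>{0..t}. ennreal ((norm (?S k s \<omega> - ?S' k s \<omega>))\<^sup>2) \<partial>lborel) > ennreal c}
      \<le> prob {\<omega> \<in> space M. ?N t (?S k) \<omega> > ennreal (c / 4)} + prob {\<omega> \<in> space M. ?N t (?S' k) \<omega> > ennreal (c / 4)}"
      by (intro prob_square_integral_triangle c simple_process_measurable[OF sd] simple_process_measurable[OF sd']
          ito_integral_measurable(1)[OF ito t(1)])
    also have "prob {\<omega> \<in> space M. ?N t (?S k) \<omega> > ennreal (c / 4)} \<le> prob {\<omega> \<in> space M. ?N T (?S k) \<omega> > ennreal (c / 4)}"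
      using t by (intro prob_square_integral_mono simple_process_measurable[OF sd] ito_integral_measurable(1)[OF ito]) auto
    finally show ?thesis
      using a by (simp add: r_def c_def ennreal_less_iff)
  qed
  ultimately show "\<exists>r. r \<longlonglongrightarrow> 0 \<and> (\<forall>k. prob {\<omega> \<in> space M. norm (?J k t \<omega> - I t \<omega>) > a} \<le> e + r k)"
    by auto
qed simp

text \<open>The inequality for simple processes, in the limit along simple processes that
  approximate \<open>H\<close> on \<open>{0..T}\<close>. As \<open>Q\<close> is finite, convergence
  in probability at each of its times suffices. The triangle inequalities for the norm and for the
  square integral produce the factor 4 and the level \<open>c / 4\<close>.\<close>

lemma ito_integral_maximal_inequality:
  fixes H :: "real \<Rightarrow> 'w \<Rightarrow> 'a::euclidean_space"
  assumes ito: "ito_integral M Fl b H I" and S: "simple_data M Fl m \<rho> \<zeta>"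
    and Q: "finite Q" "Q \<subseteq> {0..T}" and T: "T \<ge> 0" and a: "a > 0" and c: "c > 0"
  shows "prob {\<omega> \<in> space M. \<exists>t\<in>Q. norm (simple_integral b m \<rho> \<zeta> t \<omega> - I t \<omega>) > a}
    \<le> 4 * c / a\<^sup>2 + prob {\<omega> \<in> space M. (\<integral>\<^sup>+s\<in>{0..T}.
        ennreal ((norm (simple_process m \<rho> \<zeta> s \<omega> - H s \<omega>))\<^sup>2) \<partial>lborel) > ennreal (c / 4)}"
    (is "?p \<le> ?q")
proof -
  obtain n \<tau> \<xi> where sd: "\<And>k. simple_data M Fl (n k) (\<tau> k) (\<xi> k)"
    and lim: "null_in_prob M (\<lambda>k \<omega>. \<integral>\<^sup>+s\<in>{0..T}.
          ennreal ((norm (simple_process (n k) (\<tau> k) (\<xi> k) s \<omega> - H s \<omega>))\<^sup>2) \<partial>lborel)"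
    using ito T unfolding ito_integral_def by meson
  let ?S = "\<lambda>k. simple_process (n k) (\<tau> k) (\<xi> k)" and ?J = "\<lambda>k. simple_integral b (n k) (\<tau> k) (\<xi> k)"
  let ?Z = "simple_process m \<rho> \<zeta>" and ?K = "simple_integral b m \<rho> \<zeta>"
  let ?N = "\<lambda>A \<omega>. \<integral>\<^sup>+s\<in>{0..T}. ennreal ((norm (A s \<omega> - H s \<omega>))\<^sup>2) \<partial>lborel"
  define r where "r k = prob {\<omega> \<in> space M. ?N (?S k) \<omega> > ennreal (c / 4)}
      + (\<Sum>t\<in>Q. prob {\<omega> \<in> space M. norm (?J k t \<omega> - I t \<omega>) > a / 2})" for k
  have "r \<longlonglongrightarrow> 0 + (\<Sum>t\<in>Q. 0)"
    unfolding r_def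
  proof (intro tendsto_add tendsto_sum)
    show "(\<lambda>k. prob {\<omega> \<in> space M. ?N (?S k) \<omega> > ennreal (c / 4)}) \<longlonglongrightarrow> 0"
      using lim c by (auto simp: null_in_prob_def)
    fix t assume "t \<in> Q"
    then show "(\<lambda>k. prob {\<omega> \<in> space M. norm (?J k t \<omega> - I t \<omega>) > a / 2}) \<longlonglongrightarrow> 0"
      using Q a by (intro simple_integral_tendsto_ito_integral[OF ito _ _ sd lim]) auto
  qed
  then have lim_q: "(\<lambda>k. ?q + r k) \<longlonglongrightarrow> ?q"
    using tendsto_add[OF tendsto_const[of ?q], of r 0] by simp
  have "?p \<le> ?q + r k" for k
  proof -
    have Jm: "?J k t \<in> borel_measurable M" and Km: "?K t \<in> borel_measurable M" and Im: "I t \<in> borel_measurable M"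
      if "t \<in> Q" for t
      using that Q Fl_measurable[OF simple_integral_measurable[OF sd]] Fl_measurable[OF simple_integral_measurable[OF S]]
        ito_integral_measurable(2)[OF ito] by auto
    have meas: "{\<omega> \<in> space M. \<exists>t\<in>Q. norm (?K t \<omega> - ?J k t \<omega>) > a / 2} \<in> events"
      "{\<omega> \<in> space M. \<exists>t\<in>Q. norm (?J k t \<omega> - I t \<omega>) > a / 2} \<in> events"
      by (intro norm_exceeds_events Q borel_measurable_diff Jm Km Im; assumption)+
    have tri: "norm (?K t \<omega> - I t \<omega>) \<le> norm (?K t \<omega> - ?J k t \<omega>) + norm (?J k t \<omega> - I t \<omega>)" for t \<omega>
      using norm_triangle_ineq[of "?K t \<omega> - ?J k t \<omega>" "?J k t \<omega> - I t \<omega>"] by simp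
    have "?p \<le> prob {\<omega> \<in> space M. \<exists>t\<in>Q. norm (?K t \<omega> - ?J k t \<omega>) > a / 2}
        + prob {\<omega> \<in> space M. \<exists>t\<in>Q. norm (?J k t \<omega> - I t \<omega>) > a / 2}"
    proof (intro prob_le_add meas subsetI)
      fix \<omega> assume "\<omega> \<in> {\<omega> \<in> space M. \<exists>t\<in>Q. norm (?K t \<omega> - I t \<omega>) > a}"
      then obtain t where t: "\<omega> \<in> space M" "t \<in> Q" "norm (?K t \<omega> - I t \<omega>) > a"
        by auto
      then have "norm (?K t \<omega> - ?J k t \<omega>) > a / 2 \<or> norm (?J k t \<omega> - I t \<omega>) > a / 2"
        using tri[of t \<omega>] by linarith
      with t show "\<omega> \<in> {\<omega> \<in> space M. \<exists>t\<in>Q. norm (?K t \<omega> - ?J k t \<omega>) > a / 2}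
        \<union> {\<omega> \<in> space M. \<exists>t\<in>Q. norm (?J k t \<omega> - I t \<omega>) > a / 2}"
        by blast
    qed
    also have "prob {\<omega> \<in> space M. \<exists>t\<in>Q. norm (?K t \<omega> - ?J k t \<omega>) > a / 2}
      \<le> c / (a / 2)\<^sup>2 + prob {\<omega> \<in> space M. (\<integral>\<^sup>+s\<in>{0..T}. ennreal ((norm (?Z s \<omega> - ?S k s \<omega>))\<^sup>2) \<partial>lborel) > ennreal c}"
      using a c by (intro simple_maximal_inequality[OF S sd Q T]) auto
    also have "prob {\<omega> \<in> space M. (\<integral>\<^sup>+s\<in>{0..T}. ennreal ((norm (?Z s \<omega> - ?S k s \<omega>))\<^sup>2) \<partial>lborel) > ennreal c}
      \<le> prob {\<omega> \<in> space M. ?N ?Z \<omega> > ennreal (c / 4)} + prob {\<omega> \<in> space M. ?N (?S k) \<omega> > ennreal (c / 4)}"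
      by (intro prob_square_integral_triangle c simple_process_measurable[OF sd] simple_process_measurable[OF S]
          ito_integral_measurable(1)[OF ito T])
    also have "prob {\<omega> \<in> space M. \<exists>t\<in>Q. norm (?J k t \<omega> - I t \<omega>) > a / 2}
      \<le> (\<Sum>t\<in>Q. prob {\<omega> \<in> space M. norm (?J k t \<omega> - I t \<omega>) > a / 2})"
    proof -
      have "{\<omega> \<in> space M. \<exists>t\<in>Q. norm (?J k t \<omega> - I t \<omega>) > a / 2}
        = (\<Union>t\<in>Q. {\<omega> \<in> space M. norm (?J k t \<omega> - I t \<omega>) > a / 2})"
        by auto
      moreover have "{\<omega> \<in> space M. norm (?J k t \<omega> - I t \<omega>) > a / 2} \<in> events" if "t \<in> Q" for t
      proof -
        note [measurable] = Jm[OF that] Im[OF that]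
        show ?thesis by measurable
      qed
      ultimately show ?thesis
        using Q(1) by (auto intro!: measure_UNION_le)
    qed
    also have "c / (a / 2)\<^sup>2 = 4 * c / a\<^sup>2"
      by (simp add: power_divide)
    finally show ?thesis
      unfolding r_def by (simp only: add_ac)
  qed
  then show ?thesis
    by (intro LIMSEQ_le_const[OF lim_q]) blast
qed

text \<open>Dominated convergence for the indicators. It turns statements about single continuous
  paths into statements about probabilities.\<close>

lemma prob_tendsto_zero_if_AE_eventually:
  assumes "\<And>n. E n \<in> events" "AE \<omega> in M. \<forall>\<^sub>F n in sequentially. \<omega> \<notin> E n"
  shows "(\<lambda>n. prob (E n)) \<longlonglongrightarrow> 0"
proof -
  have "(\<lambda>n. \<integral>\<omega>. indicator (E n) \<omega> \<partial>M) \<longlonglongrightarrow> (\<integral>\<omega>. (0::real) \<partial>M)"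
  proof (rule integral_dominated_convergence[where w = "\<lambda>_. 1"])
    show "AE \<omega> in M. (\<lambda>n. indicator (E n) \<omega> :: real) \<longlonglongrightarrow> 0"
      using assms(2)
    proof eventually_elim
      case (elim \<omega>)
      then have "\<forall>\<^sub>F n in sequentially. (indicator (E n) \<omega> :: real) = 0"
        by eventually_elim simp
      then show ?case by (rule tendsto_eventually)
    qed
  qed (use assms(1) in \<open>auto simp: indicator_def\<close>)
  moreover have "(\<integral>\<omega>. indicator (E n) \<omega> \<partial>M) = prob (E n)" for n
    by (simp add: Int_absorb2[OF sets.sets_into_space[OF assms(1)]])
  ultimately show ?thesis by simp
qed

end

section \<open>Dyadic approximation of stochastic differential equations\<close>

definition dyadic :: "nat \<Rightarrow> nat \<Rightarrow> real" where
  "dyadic n k = real k / 2 ^ n"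

lemma dyadic_nonneg [simp]: "0 \<le> dyadic n k"
  by (simp add: dyadic_def)

lemma dyadic_0 [simp]: "dyadic n 0 = 0"
  by (simp add: dyadic_def)

lemma dyadic_Suc: "dyadic n (Suc k) = dyadic n k + 1 / 2 ^ n"
  by (simp add: dyadic_def add_divide_distrib)

lemma dyadic_le_iff [simp]: "dyadic n j \<le> dyadic n k \<longleftrightarrow> j \<le> k"
  by (simp add: dyadic_def divide_le_cancel)

lemma dyadic_less_iff [simp]: "dyadic n j < dyadic n k \<longleftrightarrow> j < k"
  by (simp add: dyadic_def divide_less_cancel)

lemma dyadic_le_of_nat: "k \<le> T * 2 ^ n \<Longrightarrow> dyadic n k \<le> real T"
  by (simp add: dyadic_def divide_le_eq flip: of_nat_power of_nat_mult)
    (metis of_nat_le_iff of_nat_mult of_nat_numeral of_nat_power)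

lemma dyadic_refine: "dyadic n k = dyadic (n + m) (k * 2 ^ m)"
  by (simp add: dyadic_def power_add)

lemma dyadic_cell:
  assumes "0 < s" "s \<le> real T"
  obtains k where "k < T * 2 ^ n" "dyadic n k < s" "s \<le> dyadic n (Suc k)"
proof -
  \<comment> \<open>The ceiling minus one, not the floor, because the cells are open on the
    left.\<close>
  define k where "k = nat (\<lceil>s * 2 ^ n\<rceil> - 1)"
  have pos: "0 < s * 2 ^ n"
    using assms by simp
  have k: "real k < s * 2 ^ n" "s * 2 ^ n \<le> real (Suc k)"
    using pos ceiling_correct[of "s * 2 ^ n"] by (auto simp: k_def of_nat_nat)
  have "s * 2 ^ n \<le> real T * 2 ^ n"
    using assms by simp
  with k(1) have "real k < real T * 2 ^ n"
    by (rule order.strict_trans2)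
  then have "real k < real (T * 2 ^ n)"
    by simp
  then have "k < T * 2 ^ n"
    by (simp only: of_nat_less_iff)
  with k show ?thesis
    by (intro that[of k]) (auto simp: dyadic_def divide_less_eq pos_le_divide_eq)
qed

lemma sum_indicator_dyadic:
  fixes v :: "nat \<Rightarrow> 'a::real_vector"
  assumes "k < N" "dyadic n k < s" "s \<le> dyadic n (Suc k)"
  shows "(\<Sum>i<N. indicator {dyadic n i<..dyadic n (Suc i)} s *\<^sub>R v i) = v k"
proof -
  have "indicator {dyadic n i<..dyadic n (Suc i)} s = (of_bool (i = k) :: real)" for i
  proof (cases "i = k")
    case False
    then consider "Suc i \<le> k" | "Suc k \<le> i" by linarith
    then show ?thesis
    proof cases
      case 1
      then have "dyadic n (Suc i) \<le> dyadic n k" by simp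
      with assms(2) have "\<not> s \<le> dyadic n (Suc i)" by linarith
      with False show ?thesis by (simp add: indicator_def)
    next
      case 2
      then have "dyadic n (Suc k) \<le> dyadic n i" by simp
      with assms(3) have "\<not> dyadic n i < s" by linarith
      with False show ?thesis by (simp add: indicator_def)
    qed
  qed (use assms in \<open>simp add: indicator_def\<close>)
  then have "(\<Sum>i<N. indicator {dyadic n i<..dyadic n (Suc i)} s *\<^sub>R v i) = (\<Sum>i<N. if i = k then v i else 0)"
    by (intro sum.cong) auto
  then show ?thesis
    using assms(1) by simp
qed

lemma simple_integral_dyadic:
  assumes "k \<le> N"
  shows "simple_integral b N (dyadic n) \<xi> (dyadic n k) \<omega>
    = (\<Sum>i<k. (b (dyadic n (Suc i)) \<omega> - b (dyadic n i) \<omega>) *\<^sub>R \<xi> i \<omega>)"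
proof -
  have "simple_integral b N (dyadic n) \<xi> (dyadic n k) \<omega>
    = (\<Sum>i<N. if i < k then (b (dyadic n (Suc i)) \<omega> - b (dyadic n i) \<omega>) *\<^sub>R \<xi> i \<omega> else 0)"
    unfolding simple_integral_def
  proof (intro sum.cong refl)
    fix i
    show "(b (min (dyadic n k) (dyadic n (Suc i))) \<omega> - b (min (dyadic n k) (dyadic n i)) \<omega>) *\<^sub>R \<xi> i \<omega>
      = (if i < k then (b (dyadic n (Suc i)) \<omega> - b (dyadic n i) \<omega>) *\<^sub>R \<xi> i \<omega> else 0)"
    proof (cases "i < k")
      case True
      then have "min (dyadic n k) (dyadic n (Suc i)) = dyadic n (Suc i)" "min (dyadic n k) (dyadic n i) = dyadic n i"
        by (simp_all add: min_absorb2)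
      with True show ?thesis by simp
    next
      case False
      then have "min (dyadic n k) (dyadic n (Suc i)) = dyadic n k" "min (dyadic n k) (dyadic n i) = dyadic n k"
        by (simp_all add: min_absorb1)
      with False show ?thesis by simp
    qed
  qed
  also have "\<dots> = (\<Sum>i<k. (b (dyadic n (Suc i)) \<omega> - b (dyadic n i) \<omega>) *\<^sub>R \<xi> i \<omega>)"
    using assms by (intro sum.mono_neutral_cong_right) auto
  finally show ?thesis .
qed

text \<open>Uniform continuity on \<open>{0..T}\<close>. In the applications \<open>\<phi>\<close>
  is a coefficient along one path, so the level from which the bound holds depends on the
  path.\<close>

lemma eventually_dyadic_oscillation:
  fixes \<phi> :: "real \<Rightarrow> 'a::real_normed_vector"
  assumes "continuous_on {0..} \<phi>" "\<rho> > 0"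
  shows "\<forall>\<^sub>F n in sequentially. \<forall>k<T * 2 ^ n. \<forall>s\<in>{dyadic n k..dyadic n (Suc k)}.
    norm (\<phi> s - \<phi> (dyadic n k)) \<le> \<rho>"
proof -
  have "uniformly_continuous_on {0..real T} \<phi>"
    by (rule compact_uniformly_continuous[OF continuous_on_subset[OF assms(1)]]) auto
  from this[unfolded uniformly_continuous_on_def, rule_format, OF assms(2)]
  obtain \<delta> where \<delta>: "\<delta> > 0"
    "\<And>s t. s \<in> {0..real T} \<Longrightarrow> t \<in> {0..real T} \<Longrightarrow> dist s t < \<delta> \<Longrightarrow> dist (\<phi> s) (\<phi> t) < \<rho>"
    by (auto simp: Ball_def)
  have "(\<lambda>n. (1 / 2) ^ n :: real) \<longlonglongrightarrow> 0"
    by (rule LIMSEQ_power_zero) simp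
  then have "\<forall>\<^sub>F n in sequentially. (1 / 2) ^ n < \<delta>"
    using \<delta>(1) by (rule order_tendstoD)
  then show ?thesis
  proof eventually_elim
    case (elim n)
    show ?case
    proof (intro allI impI ballI)
      fix k s assume k: "k < T * 2 ^ n" and s: "s \<in> {dyadic n k..dyadic n (Suc k)}"
      have "dyadic n (Suc k) \<le> real T" "dyadic n k \<le> real T"
        using k by (auto intro!: dyadic_le_of_nat)
      moreover have "dist s (dyadic n k) < \<delta>"
        using s elim by (auto simp: dist_real_def dyadic_Suc power_one_over)
      moreover have "0 \<le> s"
        using s dyadic_nonneg[of n k] by (meson atLeastAtMost_iff order_trans)
      ultimately have "dist (\<phi> s) (\<phi> (dyadic n k)) < \<rho>"
        using s by (intro \<delta>(2)) auto
      then show "norm (\<phi> s - \<phi> (dyadic n k)) \<le> \<rho>"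
        by (simp add: dist_norm)
    qed
  qed
qed

lemma norm_riemann_sum_diff_le:
  fixes \<phi> :: "real \<Rightarrow> 'a::euclidean_space"
  assumes cont: "continuous_on {0..} \<phi>"
    and osc: "\<And>k s. k < N \<Longrightarrow> s \<in> {dyadic n k..dyadic n (Suc k)} \<Longrightarrow> norm (\<phi> s - \<phi> (dyadic n k)) \<le> \<rho>"
    and k: "k \<le> N"
  shows "norm ((\<Sum>j<k. (1 / 2 ^ n) *\<^sub>R \<phi> (dyadic n j)) - integral {0..dyadic n k} \<phi>) \<le> \<rho> * dyadic n k"
  using k
proof (induction k)
  case (Suc k)
  let ?a = "dyadic n k" and ?b = "dyadic n (Suc k)"
  have ab: "?a \<le> ?b" "?b - ?a = 1 / 2 ^ n"
    by (simp_all add: dyadic_Suc)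
  have cont_on: "continuous_on {x..y} \<phi>" if "0 \<le> x" for x y
    by (rule continuous_on_subset[OF cont]) (use that in auto)
  have int: "\<phi> integrable_on {x..y}" if "0 \<le> x" for x y
    using cont_on[OF that] by (rule integrable_continuous_interval)
  have "integral {0..?a} \<phi> + integral {?a..?b} \<phi> = integral {0..?b} \<phi>"
    using ab int by (intro Henstock_Kurzweil_Integration.integral_combine) auto
  moreover have "norm (integral {?a..?b} (\<lambda>s. \<phi> s - \<phi> ?a)) \<le> \<rho> * (?b - ?a)"
    using osc[of k] Suc.prems by (intro integral_bound ab continuous_on_diff cont_on) auto
  moreover have "integral {?a..?b} (\<lambda>s. \<phi> s - \<phi> ?a) = integral {?a..?b} \<phi> - (1 / 2 ^ n) *\<^sub>R \<phi> ?a"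
    using ab int by (subst Henstock_Kurzweil_Integration.integral_diff) auto
  moreover have "norm ((\<Sum>j<k. (1 / 2 ^ n) *\<^sub>R \<phi> (dyadic n j)) - integral {0..?a} \<phi>) \<le> \<rho> * ?a"
    using Suc by simp
  moreover have "\<rho> * ?a + \<rho> * (?b - ?a) = \<rho> * ?b"
    by (simp add: algebra_simps)
  ultimately have bounds: "norm ((\<Sum>j<k. (1 / 2 ^ n) *\<^sub>R \<phi> (dyadic n j)) - integral {0..?a} \<phi>) +
      norm (integral {?a..?b} \<phi> - (1 / 2 ^ n) *\<^sub>R \<phi> ?a) \<le> \<rho> * ?b"
    and eq: "integral {0..?b} \<phi> = integral {0..?a} \<phi> + integral {?a..?b} \<phi>"
    by simp_all
  have split: "(\<Sum>j<Suc k. (1 / 2 ^ n) *\<^sub>R \<phi> (dyadic n j)) - integral {0..?b} \<phi>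
    = ((\<Sum>j<k. (1 / 2 ^ n) *\<^sub>R \<phi> (dyadic n j)) - integral {0..?a} \<phi>)
      - (integral {?a..?b} \<phi> - (1 / 2 ^ n) *\<^sub>R \<phi> ?a)"
    unfolding eq by simp
  show ?case
    unfolding split by (rule order_trans[OF norm_triangle_ineq4 bounds])
qed simp

section \<open>A discretisation along the solution of a stochastic differential equation\<close>

text \<open>The noise term \<open>I\<close> is a fixed process. The integral equation holds almost
  surely at each time separately, with an exceptional set that may depend on the time; therefore it
  is used at the countably many dyadic times, and continuity does the rest.\<close>

locale ito_sde = brownian_filtration M Fl b
  for M :: "'w measure" and Fl b +
  fixes \<mu> g :: "real \<Rightarrow> 'a::euclidean_space \<Rightarrow> 'a" and X I :: "real \<Rightarrow> 'w \<Rightarrow> 'a"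
  assumes cont_\<mu>: "continuous_on ({0..} \<times> UNIV) (\<lambda>(t, x). \<mu> t x)"
    and cont_g: "continuous_on ({0..} \<times> UNIV) (\<lambda>(t, x). g t x)"
    and X_adapted: "\<And>t. t \<ge> 0 \<Longrightarrow> X t \<in> borel_measurable (Fl t)"
    and X_continuous: "\<And>\<omega>. \<omega> \<in> space M \<Longrightarrow> continuous_on {0..} (\<lambda>t. X t \<omega>)"
    and ito: "ito_integral M Fl b (\<lambda>t \<omega>. g t (X t \<omega>)) I"
    and X_eq: "\<And>t. t \<ge> 0 \<Longrightarrow> AE \<omega> in M. X t \<omega> = X 0 \<omega> + integral {0..t} (\<lambda>s. \<mu> s (X s \<omega>)) + I t \<omega>"
begin

lemma X_measurable: "t \<ge> 0 \<Longrightarrow> X t \<in> borel_measurable M"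
  using X_adapted Fl_measurable by blast

lemma coefficient_continuous:
  assumes "continuous_on ({0..} \<times> UNIV) (\<lambda>(t, x). h t x :: 'c::topological_space)"
  shows "\<omega> \<in> space M \<Longrightarrow> continuous_on {0..} (\<lambda>t. h t (X t \<omega>))" "t \<ge> 0 \<Longrightarrow> continuous_on UNIV (h t)"
proof -
  show "continuous_on {0..} (\<lambda>t. h t (X t \<omega>))" if "\<omega> \<in> space M"
  proof -
    have "continuous_on {0..} (\<lambda>t. case (t, X t \<omega>) of (t, x) \<Rightarrow> h t x)"
      by (rule continuous_on_compose2[OF assms])
        (auto intro!: continuous_on_Pair continuous_on_id X_continuous that)
    then show ?thesis by simp
  qed
  show "continuous_on UNIV (h t)" if "t \<ge> 0"
  proof -
    have "continuous_on UNIV (\<lambda>x. case (t, x) of (t, x) \<Rightarrow> h t x)"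
      by (rule continuous_on_compose2[OF assms])
        (auto intro!: continuous_on_Pair continuous_on_id continuous_on_const that)
    then show ?thesis by simp
  qed
qed

lemma coefficient_adapted:
  assumes "continuous_on ({0..} \<times> UNIV) (\<lambda>(t, x). h t x :: 'a)" "t \<ge> 0"
  shows "(\<lambda>\<omega>. h t (X t \<omega>)) \<in> borel_measurable (Fl t)"
  using measurable_compose[OF X_adapted[OF assms(2)] borel_measurable_continuous_onI[OF coefficient_continuous(2)[OF assms]]] .

lemma path_bounded:
  assumes "\<omega> \<in> space M"
  obtains R :: nat where "\<And>t. t \<in> {0..real T} \<Longrightarrow> norm (X t \<omega>) \<le> real R"
proof -
  have "compact ((\<lambda>t. X t \<omega>) ` {0..real T})"
    by (intro compact_continuous_image continuous_on_subset[OF X_continuous[OF assms]]) auto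
  then have "bounded ((\<lambda>t. X t \<omega>) ` {0..real T})"
    by (rule compact_imp_bounded)
  then obtain r where "\<forall>x\<in>(\<lambda>t. X t \<omega>) ` {0..real T}. norm x \<le> r"
    unfolding bounded_iff by blast
  then have "\<And>t. t \<in> {0..real T} \<Longrightarrow> norm (X t \<omega>) \<le> r"
    by auto
  moreover obtain R :: nat where "r \<le> real R"
    using real_arch_simple by blast
  ultimately show ?thesis
    using that order_trans by meson
qed

text \<open>Simple data have to be bounded, hence the cut at radius \<open>n\<close>. The radius
  grows with the level, so along each path the cut becomes inactive on every bounded time
  interval.\<close>

definition truncated_noise :: "nat \<Rightarrow> nat \<Rightarrow> 'w \<Rightarrow> 'a" where
  "truncated_noise n k \<omega> = of_bool (norm (X (dyadic n k) \<omega>) \<le> real n) *\<^sub>R g (dyadic n k) (X (dyadic n k) \<omega>)"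

lemma truncated_noise_adapted: "truncated_noise n k \<in> borel_measurable (Fl (dyadic n k))"
proof -
  note [measurable] = X_adapted[OF dyadic_nonneg[of n k]] coefficient_adapted[OF cont_g dyadic_nonneg[of n k]]
  have "(\<lambda>\<omega>. indicator {\<omega> \<in> space (Fl (dyadic n k)). norm (X (dyadic n k) \<omega>) \<le> real n} \<omega> *\<^sub>R g (dyadic n k) (X (dyadic n k) \<omega>))
    \<in> borel_measurable (Fl (dyadic n k))"
    by measurable
  then show ?thesis
    by (rule measurable_cong[THEN iffD1, rotated]) (simp add: truncated_noise_def indicator_def)
qed

lemma simple_data_truncated_noise: "simple_data M Fl N (dyadic n) (truncated_noise n)"
  unfolding simple_data_def
proof (intro conjI allI impI)
  fix i
  have "compact (g (dyadic n i) ` cball 0 (real n))"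
    by (intro compact_continuous_image continuous_on_subset[OF coefficient_continuous(2)[OF cont_g]]) auto
  then have "bounded (g (dyadic n i) ` cball 0 (real n))"
    by (rule compact_imp_bounded)
  then obtain C where "\<forall>y\<in>g (dyadic n i) ` cball 0 (real n). norm y \<le> C"
    unfolding bounded_iff by blast
  then have C: "\<And>x. norm x \<le> real n \<Longrightarrow> norm (g (dyadic n i) x) \<le> C"
    by auto
  have "norm (truncated_noise n i \<omega>) \<le> C" for \<omega>
    using C[of "X (dyadic n i) \<omega>"] order_trans[OF norm_ge_zero C[of 0]]
    by (auto simp: truncated_noise_def)
  then show "\<exists>C. \<forall>\<omega>\<in>space M. norm (truncated_noise n i \<omega>) \<le> C"
    by blast
qed (auto simp: truncated_noise_adapted)

definition noise_sum :: "nat \<Rightarrow> nat \<Rightarrow> 'w \<Rightarrow> 'a" where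
  "noise_sum n k \<omega> = (\<Sum>i<k. (b (dyadic n (Suc i)) \<omega> - b (dyadic n i) \<omega>) *\<^sub>R truncated_noise n i \<omega>)"

lemma noise_sum_adapted: "noise_sum n k \<in> borel_measurable (Fl (dyadic n k))"
proof -
  have "noise_sum n k = simple_integral b k (dyadic n) (truncated_noise n) (dyadic n k)"
    by (simp add: fun_eq_iff noise_sum_def simple_integral_dyadic)
  then show ?thesis
    using simple_integral_measurable[OF simple_data_truncated_noise] by simp
qed

lemma noise_sum_tendsto:
  assumes a: "a > 0"
  shows "(\<lambda>n. prob {\<omega> \<in> space M. \<exists>k\<in>{..T * 2 ^ n}. norm (noise_sum n k \<omega> - I (dyadic n k) \<omega>) > a}) \<longlonglongrightarrow> 0"
proof (rule tendsto_zero_if_le_add)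
  fix e :: real assume e: "e > 0"
  \<comment> \<open>Makes the deterministic term \<open>4 * c / a\<^sup>2\<close> of the maximal
    inequality equal to \<open>e\<close>.\<close>
  define c where "c = e * a\<^sup>2 / 4"
  have c: "c > 0" using e a by (simp add: c_def)
  let ?S = "\<lambda>n. simple_process (T * 2 ^ n) (dyadic n) (truncated_noise n)"
  define E where "E n = {\<omega> \<in> space M. (\<integral>\<^sup>+s\<in>{0..real T}.
    ennreal ((norm (?S n s \<omega> - g s (X s \<omega>)))\<^sup>2) \<partial>lborel) > ennreal (c / 4)}" for n
  have "(\<lambda>n. prob (E n)) \<longlonglongrightarrow> 0"
  proof (rule prob_tendsto_zero_if_AE_eventually)
    fix n
    have "(\<lambda>(t, \<omega>). ?S n t \<omega> - g t (X t \<omega>)) \<in> borel_measurable (restrict_space borel {0..real T} \<Otimes>\<^sub>M M)"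
      using borel_measurable_diff[OF simple_process_measurable[OF simple_data_truncated_noise]
          ito_integral_measurable(1)[OF ito]] by (simp add: case_prod_beta')
    note [measurable] = square_integral_measurable[OF this]
    show "E n \<in> events"
      unfolding E_def by measurable
  next
    have "\<forall>\<^sub>F n in sequentially. \<omega> \<notin> E n" if \<omega>: "\<omega> \<in> space M" for \<omega>
    proof -
      \<comment> \<open>A distance whose square integrates over \<open>{0..T}\<close> to at most c /
        4; adding 1 avoids the division by \<open>T = 0\<close>.\<close>
      define \<rho> where "\<rho> = sqrt (c / (4 * (real T + 1)))"
      have \<rho>: "\<rho> > 0" "\<rho>\<^sup>2 * real T \<le> c / 4"
        using c by (auto simp: \<rho>_def field_simps)
      obtain R :: nat where R: "\<And>t. t \<in> {0..real T} \<Longrightarrow> norm (X t \<omega>) \<le> real R"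
        using path_bounded[OF \<omega>] by blast
      have "\<forall>\<^sub>F n in sequentially. R \<le> n"
        by (rule eventually_ge_at_top)
      with eventually_dyadic_oscillation[OF coefficient_continuous(1)[OF cont_g \<omega>] \<rho>(1), of T]
      show ?thesis
      proof eventually_elim
        case (elim n)
        have le: "norm (?S n s \<omega> - g s (X s \<omega>)) \<le> \<rho>" if s: "0 < s" "s \<le> real T" for s
        proof -
          obtain k where k: "k < T * 2 ^ n" "dyadic n k < s" "s \<le> dyadic n (Suc k)"
            using dyadic_cell[OF s] by blast
          have "dyadic n k \<in> {0..real T}"
            using k by (simp add: dyadic_le_of_nat)
          then have "norm (X (dyadic n k) \<omega>) \<le> real n"
            using R elim(2) by (meson of_nat_mono order_trans)
          then have "?S n s \<omega> = g (dyadic n k) (X (dyadic n k) \<omega>)"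
            unfolding simple_process_def sum_indicator_dyadic[OF k] by (simp add: truncated_noise_def)
          then show ?thesis
            using elim(1) k by (simp add: norm_minus_commute)
        qed
        have "(\<integral>\<^sup>+s\<in>{0..real T}. ennreal ((norm (?S n s \<omega> - g s (X s \<omega>)))\<^sup>2) \<partial>lborel)
          \<le> (\<integral>\<^sup>+s. ennreal (\<rho>\<^sup>2) * indicator {0..real T} s \<partial>lborel)"
        \<comment> \<open>The time 0 lies in no cell and is removed as a null set.\<close>
        proof (rule nn_integral_mono_AE)
          show "AE s in lborel. ennreal ((norm (?S n s \<omega> - g s (X s \<omega>)))\<^sup>2) * indicator {0..real T} s
            \<le> ennreal (\<rho>\<^sup>2) * indicator {0..real T} s"
            using AE_lborel_singleton[of 0]
            by eventually_elim (use le in \<open>auto simp: indicator_def intro!: ennreal_leI power_mono\<close>)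
        qed
        also have "\<dots> = ennreal (\<rho>\<^sup>2 * real T)"
          by (simp add: nn_integral_cmult ennreal_mult)
        also have "\<dots> \<le> ennreal (c / 4)"
          using \<rho> by (intro ennreal_leI)
        finally show ?case
          by (simp add: E_def leD)
      qed
    qed
    then show "AE \<omega> in M. \<forall>\<^sub>F n in sequentially. \<omega> \<notin> E n"
      by (intro AE_I2)
  qed
  moreover have "prob {\<omega> \<in> space M. \<exists>k\<in>{..T * 2 ^ n}. norm (noise_sum n k \<omega> - I (dyadic n k) \<omega>) > a}
    \<le> e + prob (E n)" for n
  proof -
    let ?J = "simple_integral b (T * 2 ^ n) (dyadic n) (truncated_noise n)"
    have "{\<omega> \<in> space M. \<exists>k\<in>{..T * 2 ^ n}. norm (noise_sum n k \<omega> - I (dyadic n k) \<omega>) > a}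
      = {\<omega> \<in> space M. \<exists>t\<in>dyadic n ` {..T * 2 ^ n}. norm (?J t \<omega> - I t \<omega>) > a}"
      by (auto simp: noise_sum_def simple_integral_dyadic)
    also have "prob \<dots> \<le> 4 * c / a\<^sup>2 + prob (E n)"
      unfolding E_def by (intro ito_integral_maximal_inequality[OF ito simple_data_truncated_noise])
        (use a c in \<open>auto intro: dyadic_le_of_nat\<close>)
    finally show ?thesis
      using a by (simp add: c_def)
  qed
  ultimately show "\<exists>r. r \<longlonglongrightarrow> 0 \<and> (\<forall>n. prob {\<omega> \<in> space M. \<exists>k\<in>{..T * 2 ^ n}. norm (noise_sum n k \<omega> - I (dyadic n k) \<omega>) > a} \<le> e + r n)"
    by auto
qed simp

definition scheme :: "nat \<Rightarrow> nat \<Rightarrow> 'w \<Rightarrow> 'a" where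
  "scheme n k \<omega> = X 0 \<omega> + (\<Sum>j<k. (1 / 2 ^ n) *\<^sub>R \<mu> (dyadic n j) (X (dyadic n j) \<omega>)) + noise_sum n k \<omega>"

lemma scheme_0: "scheme n 0 \<omega> = X 0 \<omega>"
  by (simp add: scheme_def noise_sum_def)

lemma scheme_Suc: "scheme n (Suc k) \<omega> = scheme n k \<omega> + (1 / 2 ^ n) *\<^sub>R \<mu> (dyadic n k) (X (dyadic n k) \<omega>)
    + (b (dyadic n (Suc k)) \<omega> - b (dyadic n k) \<omega>) *\<^sub>R truncated_noise n k \<omega>"
  by (simp add: scheme_def noise_sum_def)

lemma scheme_adapted: "scheme n k \<in> borel_measurable (Fl (dyadic n k))"
  unfolding scheme_def
proof (intro borel_measurable_add borel_measurable_sum borel_measurable_scaleR borel_measurable_const noise_sum_adapted)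
  show "X 0 \<in> borel_measurable (Fl (dyadic n k))"
    by (rule Fl_measurable_mono[OF _ X_adapted]) auto
  fix j assume "j \<in> {..<k}"
  then show "(\<lambda>\<omega>. \<mu> (dyadic n j) (X (dyadic n j) \<omega>)) \<in> borel_measurable (Fl (dyadic n k))"
    by (intro Fl_measurable_mono[OF _ coefficient_adapted[OF cont_\<mu> dyadic_nonneg]]) simp
qed

text \<open>The drift contributes the error of a left Riemann sum along a continuous path, the noise
  the error treated in \<open>noise_sum_tendsto\<close>.\<close>

lemma scheme_tendsto:
  assumes a: "a > 0"
  shows "(\<lambda>n. prob {\<omega> \<in> space M. \<exists>k\<in>{..T * 2 ^ n}. norm (scheme n k \<omega> - X (dyadic n k) \<omega>) > a}) \<longlonglongrightarrow> 0"
proof -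
  \<comment> \<open>Almost surely this is the Riemann sum error of the drift. Expressing the
    integral through \<open>X\<close> and \<open>I\<close> makes measurability immediate.\<close>
  define D where "D n k \<omega> = (\<Sum>j<k. (1 / 2 ^ n) *\<^sub>R \<mu> (dyadic n j) (X (dyadic n j) \<omega>))
    - (X (dyadic n k) \<omega> - X 0 \<omega> - I (dyadic n k) \<omega>)" for n k \<omega>
  define E where "E n = {\<omega> \<in> space M. \<exists>k\<in>{..T * 2 ^ n}. norm (D n k \<omega>) > a / 2}" for n
  define F where "F n = {\<omega> \<in> space M. \<exists>k\<in>{..T * 2 ^ n}. norm (noise_sum n k \<omega> - I (dyadic n k) \<omega>) > a / 2}" for n
  have I_meas: "I (dyadic n k) \<in> borel_measurable M" for n k
    using ito_integral_measurable(2)[OF ito] by simp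
  have D_meas: "D n k \<in> borel_measurable M" for n k
    unfolding D_def
    by (intro borel_measurable_diff borel_measurable_sum borel_measurable_scaleR borel_measurable_const I_meas
        Fl_measurable[OF coefficient_adapted[OF cont_\<mu> dyadic_nonneg]] X_measurable dyadic_nonneg order_refl)
  have E_events: "E n \<in> events" for n
    unfolding E_def by (intro norm_exceeds_events D_meas) simp
  have F_events: "F n \<in> events" for n
    unfolding F_def
    by (intro norm_exceeds_events borel_measurable_diff I_meas Fl_measurable[OF noise_sum_adapted]) simp
  have "(\<lambda>n. prob (E n)) \<longlonglongrightarrow> 0"
  proof (rule prob_tendsto_zero_if_AE_eventually[OF E_events])
    have "AE \<omega> in M. \<forall>n k. X (dyadic n k) \<omega> = X 0 \<omega> + integral {0..dyadic n k} (\<lambda>s. \<mu> s (X s \<omega>)) + I (dyadic n k) \<omega>"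
      using X_eq[OF dyadic_nonneg] by (simp add: AE_all_countable)
    then show "AE \<omega> in M. \<forall>\<^sub>F n in sequentially. \<omega> \<notin> E n"
      using AE_space
    proof eventually_elim
      case (elim \<omega>)
      define \<rho> where "\<rho> = a / (2 * (real T + 1))"
      have \<rho>: "\<rho> > 0" "\<rho> * real T \<le> a / 2"
        using a by (auto simp: \<rho>_def field_simps)
      note cont = coefficient_continuous(1)[OF cont_\<mu> elim(2)]
      from eventually_dyadic_oscillation[OF cont \<rho>(1), of T] show ?case
      proof eventually_elim
        case osc: (elim n)
        have "norm (D n k \<omega>) \<le> a / 2" if k: "k \<le> T * 2 ^ n" for k
        proof -
          have "D n k \<omega> = (\<Sum>j<k. (1 / 2 ^ n) *\<^sub>R \<mu> (dyadic n j) (X (dyadic n j) \<omega>)) - integral {0..dyadic n k} (\<lambda>s. \<mu> s (X s \<omega>))"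
            using elim(1)[rule_format, of n k] by (simp add: D_def)
          then have "norm (D n k \<omega>) \<le> \<rho> * dyadic n k"
            using norm_riemann_sum_diff_le[OF cont, of "T * 2 ^ n" n \<rho> k] osc k by simp
          also have "\<dots> \<le> \<rho> * real T"
            using \<rho> k by (intro mult_left_mono dyadic_le_of_nat) auto
          finally show ?thesis using \<rho> by simp
        qed
        then show ?case
          by (auto simp: E_def not_less)
      qed
    qed
  qed
  moreover have "(\<lambda>n. prob (F n)) \<longlonglongrightarrow> 0"
    unfolding F_def using a by (intro noise_sum_tendsto) simp
  ultimately have lim: "(\<lambda>n. prob (E n) + prob (F n)) \<longlonglongrightarrow> 0"
    using tendsto_add by fastforce
  show ?thesis
  proof (rule tendsto_sandwich[OF _ _ tendsto_const lim])
    show "\<forall>\<^sub>F n in sequentially. prob {\<omega> \<in> space M. \<exists>k\<in>{..T * 2 ^ n}. norm (scheme n k \<omega> - X (dyadic n k) \<omega>) > a}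
      \<le> prob (E n) + prob (F n)"
    proof (rule always_eventually, rule allI)
      fix n
      show "prob {\<omega> \<in> space M. \<exists>k\<in>{..T * 2 ^ n}. norm (scheme n k \<omega> - X (dyadic n k) \<omega>) > a}
        \<le> prob (E n) + prob (F n)"
      proof (intro prob_le_add E_events F_events subsetI)
        fix \<omega> assume "\<omega> \<in> {\<omega> \<in> space M. \<exists>k\<in>{..T * 2 ^ n}. norm (scheme n k \<omega> - X (dyadic n k) \<omega>) > a}"
        then obtain k where k: "\<omega> \<in> space M" "k \<in> {..T * 2 ^ n}" "norm (scheme n k \<omega> - X (dyadic n k) \<omega>) > a"
          by auto
        have "scheme n k \<omega> - X (dyadic n k) \<omega> = D n k \<omega> + (noise_sum n k \<omega> - I (dyadic n k) \<omega>)"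
          by (simp add: scheme_def D_def)
        then have "norm (scheme n k \<omega> - X (dyadic n k) \<omega>) \<le> norm (D n k \<omega>) + norm (noise_sum n k \<omega> - I (dyadic n k) \<omega>)"
          by (simp only: norm_triangle_ineq)
        then have "norm (D n k \<omega>) > a / 2 \<or> norm (noise_sum n k \<omega> - I (dyadic n k) \<omega>) > a / 2"
          using k(3) by linarith
        with k show "\<omega> \<in> E n \<union> F n"
          unfolding E_def F_def by blast
      qed
    qed
  qed simp
qed

text \<open>A linear functional that annihilates the noise coefficient kills every discretised noise sum,
  hence the Ito integral in the limit.\<close>

lemma ito_integral_linear_zero:
  fixes P :: "'a \<Rightarrow> 'c::euclidean_space"
  assumes P: "bounded_linear P" "\<And>t x. t \<ge> 0 \<Longrightarrow> P (g t x) = 0"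
  shows "AE \<omega> in M. P (I (dyadic m l) \<omega>) = 0"
proof -
  interpret P: bounded_linear P by (rule P)
  obtain K where K: "K > 0" "\<And>x. norm (P x) \<le> norm x * K"
    using P.pos_bounded by blast
  note [measurable] = ito_integral_measurable(2)[OF ito dyadic_nonneg[of m l]]
    borel_measurable_continuous_onI[OF linear_continuous_on[OF P(1)]]
  have P_noise: "P (noise_sum n k \<omega>) = 0" for n k \<omega>
    by (simp add: noise_sum_def truncated_noise_def P.sum P.scaleR P(2))
  have zero: "prob {\<omega> \<in> space M. norm (P (I (dyadic m l) \<omega>)) > e} = 0" if e: "e > 0" for e
  proof -
    \<comment> \<open>The time \<open>dyadic m l\<close> is also the grid point
      \<open>l * 2 ^ n\<close> of level \<open>m + n\<close>, and it does not exceed the horizon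
      \<open>l\<close>.\<close>
    have "prob {\<omega> \<in> space M. norm (P (I (dyadic m l) \<omega>)) > e}
      \<le> prob {\<omega> \<in> space M. \<exists>k\<in>{..l * 2 ^ (m + n)}. norm (noise_sum (m + n) k \<omega> - I (dyadic (m + n) k) \<omega>) > e / K}" for n
    proof (rule finite_measure_mono)
      show "{\<omega> \<in> space M. norm (P (I (dyadic m l) \<omega>)) > e}
        \<subseteq> {\<omega> \<in> space M. \<exists>k\<in>{..l * 2 ^ (m + n)}. norm (noise_sum (m + n) k \<omega> - I (dyadic (m + n) k) \<omega>) > e / K}"
      proof safe
        fix \<omega> assume e': "norm (P (I (dyadic m l) \<omega>)) > e"
        have "norm (P (I (dyadic m l) \<omega>)) = norm (P (noise_sum (m + n) (l * 2 ^ n) \<omega> - I (dyadic m l) \<omega>))"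
          by (simp add: P.diff P_noise)
        also have "\<dots> \<le> norm (noise_sum (m + n) (l * 2 ^ n) \<omega> - I (dyadic m l) \<omega>) * K"
          by (rule K)
        finally have "norm (noise_sum (m + n) (l * 2 ^ n) \<omega> - I (dyadic (m + n) (l * 2 ^ n)) \<omega>) > e / K"
          using e' K(1) by (simp add: dyadic_refine[of m l n] field_simps)
        moreover have "l * 2 ^ n \<in> {..l * 2 ^ (m + n)}"
          by (simp add: power_increasing)
        ultimately show "\<exists>k\<in>{..l * 2 ^ (m + n)}. norm (noise_sum (m + n) k \<omega> - I (dyadic (m + n) k) \<omega>) > e / K"
          by blast
      qed
      show "{\<omega> \<in> space M. \<exists>k\<in>{..l * 2 ^ (m + n)}. norm (noise_sum (m + n) k \<omega> - I (dyadic (m + n) k) \<omega>) > e / K} \<in> events"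
        by (intro norm_exceeds_events borel_measurable_diff Fl_measurable[OF noise_sum_adapted]
            ito_integral_measurable(2)[OF ito]) simp_all
    qed
    moreover have "(\<lambda>n. prob {\<omega> \<in> space M. \<exists>k\<in>{..l * 2 ^ (m + n)}. norm (noise_sum (m + n) k \<omega> - I (dyadic (m + n) k) \<omega>) > e / K}) \<longlonglongrightarrow> 0"
      using LIMSEQ_ignore_initial_segment[OF noise_sum_tendsto[of "e / K" l], of m] e K(1) by (simp add: add.commute)
    ultimately have "prob {\<omega> \<in> space M. norm (P (I (dyadic m l) \<omega>)) > e} \<le> 0"
      by (intro LIMSEQ_le_const) auto
    then show ?thesis
      by (simp add: measure_le_0_iff)
  qed
  have "AE \<omega> in M. norm (P (I (dyadic m l) \<omega>)) \<le> 1 / real (Suc j)" for j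
  proof -
    have "AE \<omega> in M. \<omega> \<notin> {\<omega> \<in> space M. norm (P (I (dyadic m l) \<omega>)) > 1 / real (Suc j)}"
      using zero[of "1 / real (Suc j)"] by (intro prob_eq_0[THEN iffD1]) auto
    then show ?thesis
      using AE_space by eventually_elim auto
  qed
  then have "AE \<omega> in M. \<forall>j. norm (P (I (dyadic m l) \<omega>)) \<le> 1 / real (Suc j)"
    by (simp add: AE_all_countable)
  then show ?thesis
  proof eventually_elim
    case (elim \<omega>)
    have "norm (P (I (dyadic m l) \<omega>)) \<le> 0"
      using LIMSEQ_inverse_real_of_nat elim by (intro LIMSEQ_le_const[OF LIMSEQ_inverse_real_of_nat]) (auto simp: inverse_eq_divide)
    then show ?case by simp
  qed
qed

end

section \<open>One step of the Lyapunov function\<close>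

text \<open>Second order Taylor expansion with Lagrange remainder. The third derivative is
  nonnegative and, as the intermediate point stays above \<epsilon>, at most
  \<open>2 * \<epsilon> powr (q - 3)\<close>.\<close>

lemma powr_third_order_bound:
  fixes q \<epsilon> u w :: real
  assumes q: "0 < q" "q \<le> 1" and \<epsilon>: "0 < \<epsilon>" "\<epsilon> \<le> u" "\<epsilon> \<le> u + w"
  shows "(u + w) powr q \<le> u powr q + q * u powr (q - 1) * w - q * (1 - q) * u powr (q - 2) / 2 * w\<^sup>2
    + \<epsilon> powr (q - 3) * \<bar>w\<bar> ^ 3"
proof (cases "w = 0")
  case False
  define diff :: "nat \<Rightarrow> real \<Rightarrow> real" where
    "diff m t = (if m = 0 then t powr q else if m = 1 then q * t powr (q - 1)
      else if m = 2 then q * (q - 1) * t powr (q - 2) else q * (q - 1) * (q - 2) * t powr (q - 3))" for m t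
  have diff: "diff 0 = (\<lambda>t. t powr q)" "diff 1 = (\<lambda>t. q * t powr (q - 1))"
    "diff 2 = (\<lambda>t. q * (q - 1) * t powr (q - 2))" "diff 3 = (\<lambda>t. q * (q - 1) * (q - 2) * t powr (q - 3))"
    by (simp_all add: fun_eq_iff diff_def)
  have D: "DERIV (diff m) t :> diff (Suc m) t" if "m < 3" "\<epsilon> \<le> t" for m t
  proof -
    have t: "t > 0" using that \<epsilon> by simp
    consider "m = 0" | "m = 1" | "m = 2" using \<open>m < 3\<close> by linarith
    then show ?thesis
    proof cases
      case 1
      have "((\<lambda>t. t powr q) has_real_derivative q * t powr (q - 1)) (at t)"
        using t by (auto intro!: derivative_eq_intros)
      then show ?thesis using diff(1,2) 1 by simp
    next
      case 2
      have "((\<lambda>t. q * t powr (q - 1)) has_real_derivative q * ((q - 1) * t powr (q - 1 - 1))) (at t)"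
        using t by (auto intro!: derivative_eq_intros)
      then show ?thesis using diff(2,3) 2 by (simp add: numeral_2_eq_2 algebra_simps)
    next
      case 3
      have "((\<lambda>t. q * (q - 1) * t powr (q - 2)) has_real_derivative q * (q - 1) * ((q - 2) * t powr (q - 2 - 1))) (at t)"
        using t by (auto intro!: derivative_eq_intros)
      then show ?thesis using diff(3,4) 3 by (simp add: numeral_3_eq_3 numeral_2_eq_2 algebra_simps)
    qed
  qed
  have "\<exists>t. (if u + w < u then u + w < t \<and> t < u else u < t \<and> t < u + w) \<and>
    (u + w) powr q = (\<Sum>m<3. diff m u / fact m * (u + w - u) ^ m) + diff 3 t / fact 3 * (u + w - u) ^ 3"
    using False \<epsilon> D by (intro Taylor[where a = "min u (u + w)" and b = "max u (u + w)"]) (auto simp: diff(1))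
  then obtain t where t': "if u + w < u then u + w < t \<and> t < u else u < t \<and> t < u + w"
    and eq': "(u + w) powr q = (\<Sum>m<3. diff m u / fact m * (u + w - u) ^ m) + diff 3 t / fact 3 * (u + w - u) ^ 3"
    by blast
  have t: "\<epsilon> < t"
    using t' \<epsilon> by (auto split: if_splits)
  have eq: "(u + w) powr q = (\<Sum>m<3. diff m u / fact m * w ^ m) + diff 3 t / 6 * w ^ 3"
    using eq' by (simp add: fact_numeral)
  have "(\<Sum>m<3. diff m u / fact m * w ^ m) = u powr q + q * u powr (q - 1) * w - q * (1 - q) * u powr (q - 2) / 2 * w\<^sup>2"
    by (simp add: diff_def numeral_3_eq_3 power2_eq_square field_simps)
  moreover have "diff 3 t / 6 * w ^ 3 \<le> \<epsilon> powr (q - 3) * \<bar>w\<bar> ^ 3"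
  proof -
    have "q * (1 - q) * (2 - q) \<le> 1 * 1 * 2"
      using q by (intro mult_mono) auto
    moreover have "t powr (q - 3) \<le> \<epsilon> powr (q - 3)"
      using q \<epsilon> t by (intro powr_mono2') auto
    ultimately have "q * (1 - q) * (2 - q) * t powr (q - 3) \<le> 2 * \<epsilon> powr (q - 3)"
      using q by (intro mult_mono) auto
    moreover have "diff 3 t = q * (1 - q) * (2 - q) * t powr (q - 3)"
      by (simp add: diff_def algebra_simps)
    moreover have "0 \<le> q * (1 - q) * (2 - q) * t powr (q - 3)"
      using q by simp
    ultimately have d: "0 \<le> diff 3 t" "diff 3 t / 6 \<le> \<epsilon> powr (q - 3)"
      using powr_ge_zero[of \<epsilon> "q - 3"] by linarith+
    have "diff 3 t / 6 * w ^ 3 \<le> diff 3 t / 6 * \<bar>w\<bar> ^ 3"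
      using d(1) by (intro mult_left_mono) (auto simp: power_abs[symmetric])
    also have "\<dots> \<le> \<epsilon> powr (q - 3) * \<bar>w\<bar> ^ 3"
      using d(2) by (intro mult_right_mono) auto
    finally show ?thesis .
  qed
  ultimately show ?thesis
    using eq by linarith
qed simp

text \<open>The increments \<open>\<xi>\<close> are of order \<open>r = \<surd>h\<close>, and so the error is of order \<open>r ^ 3\<close>.\<close>

definition step_error :: "real \<Rightarrow> real \<Rightarrow> real" where
  "step_error r \<xi> = r ^ 3 + r * \<xi>\<^sup>2 + \<xi> ^ 4 / r + \<xi> ^ 6"

text \<open>Odd powers of |\<xi>| are traded for even ones by 2 |\<xi>| r \<le> r^2 + \<xi>^2,
  multiplied by r or by \<xi>^2 / r; this explains the weights in \<open>step_error\<close>. The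
  last bound compares the sum with three times its largest summand, hence 27.\<close>

lemma step_error_bounds:
  assumes r: "0 < r" "r \<le> 1"
  shows "0 \<le> step_error r \<xi>" "r ^ 4 \<le> step_error r \<xi>" "r\<^sup>2 * \<bar>\<xi>\<bar> + \<bar>\<xi>\<bar> ^ 3 \<le> step_error r \<xi>"
    "(\<bar>\<xi>\<bar> + r\<^sup>2 + \<xi>\<^sup>2) ^ 3 \<le> 27 * step_error r \<xi>"
proof -
  let ?x = "\<bar>\<xi>\<bar>"
  have e: "step_error r \<xi> = r ^ 3 + r * ?x\<^sup>2 + ?x ^ 4 / r + ?x ^ 6"
    by (simp add: step_error_def power_even_abs)
  have n: "0 \<le> r ^ 3" "0 \<le> r * ?x\<^sup>2" "0 \<le> ?x ^ 4 / r" "0 \<le> ?x ^ 6"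
    using r by auto
  show "0 \<le> step_error r \<xi>"
    unfolding e using n by linarith
  have "r ^ 4 \<le> r ^ 3" "r ^ 6 \<le> r ^ 3"
    using r by (auto intro: power_decreasing)
  then show "r ^ 4 \<le> step_error r \<xi>"
    unfolding e using n by linarith
  have am: "2 * ?x * r \<le> r\<^sup>2 + ?x\<^sup>2"
    using sum_squares_bound[of ?x r] by (simp add: add.commute)
  have "2 * (r\<^sup>2 * ?x) = r * (2 * ?x * r)"
    by (simp add: power2_eq_square)
  also have "\<dots> \<le> r * (r\<^sup>2 + ?x\<^sup>2)"
    using am r by (intro mult_left_mono) auto
  finally have 1: "2 * (r\<^sup>2 * ?x) \<le> r ^ 3 + r * ?x\<^sup>2"
    by (simp add: power3_eq_cube power2_eq_square algebra_simps)
  have "2 * ?x ^ 3 = ?x\<^sup>2 / r * (2 * ?x * r)"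
    using r by (simp add: power3_eq_cube power2_eq_square)
  also have "\<dots> \<le> ?x\<^sup>2 / r * (r\<^sup>2 + ?x\<^sup>2)"
    using am r by (intro mult_left_mono) auto
  also have "\<dots> = r * ?x\<^sup>2 + ?x ^ 4 / r"
    using r by (simp add: field_simps power2_eq_square power4_eq_xxxx)
  finally have 2: "2 * ?x ^ 3 \<le> r * ?x\<^sup>2 + ?x ^ 4 / r" .
  show 3: "r\<^sup>2 * ?x + ?x ^ 3 \<le> step_error r \<xi>"
    unfolding e using 1 2 n by linarith
  define m where "m = max ?x (max (r\<^sup>2) (\<xi>\<^sup>2))"
  have "m ^ 3 \<le> step_error r \<xi>"
  proof -
    consider "m = ?x" | "m = r\<^sup>2" | "m = \<xi>\<^sup>2" unfolding m_def by linarith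
    then show ?thesis
    proof cases
      case 1
      have "0 \<le> r\<^sup>2 * ?x" by simp
      with 3 show ?thesis unfolding 1 by linarith
    next
      case 2
      then have "m ^ 3 = r ^ 6" by (simp add: power_mult[symmetric])
      then show ?thesis unfolding e using n \<open>r ^ 6 \<le> r ^ 3\<close> by linarith
    next
      case 3
      then have "m ^ 3 = ?x ^ 6" by (simp add: power_mult[symmetric] power_even_abs)
      then show ?thesis unfolding e using n by linarith
    qed
  qed
  moreover have "?x + r\<^sup>2 + \<xi>\<^sup>2 \<le> 3 * m"
    by (simp add: m_def)
  then have "(?x + r\<^sup>2 + \<xi>\<^sup>2) ^ 3 \<le> (3 * m) ^ 3"
    by (intro power_mono) auto
  ultimately show "(?x + r\<^sup>2 + \<xi>\<^sup>2) ^ 3 \<le> 27 * step_error r \<xi>"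
    by (simp add: power_mult_distrib)
qed

text \<open>Here \<open>w\<close> is the change of the squared norm when a vector p moves by r^2 m +
  \<xi> h. The parameters stand for \<open>\<alpha> = p \<bullet> m\<close>,
  \<open>\<beta> = p \<bullet> h\<close>, \<open>\<nu> = m \<bullet> h\<close>, \<kappa> = |h|^2 and
  \<kappa>' = |m|^2. What goes into \<open>step_error\<close> is of order r^3 or smaller; the
  constant 1800 covers 1728 = 64 * 27 from the cubic remainder, 8 from the quadratic term and 1 from
  the linear one.\<close>

lemma powr_step_bound:
  fixes q \<epsilon> u w r \<xi> C :: real
  assumes q: "0 < q" "q \<le> 1" and \<epsilon>: "0 < \<epsilon>" "\<epsilon> \<le> 1" "\<epsilon> \<le> u" "\<epsilon> \<le> u + w"
    and r: "0 < r" "r \<le> 1" and C: "1 \<le> C"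
    and w: "w = 2 * r\<^sup>2 * \<alpha> + 2 * \<xi> * \<beta> + r ^ 4 * \<kappa>' + 2 * r\<^sup>2 * \<xi> * \<nu> + \<xi>\<^sup>2 * \<kappa>"
    and bounds: "\<bar>\<alpha>\<bar> \<le> C" "\<bar>\<beta>\<bar> \<le> C" "\<bar>\<nu>\<bar> \<le> C" "0 \<le> \<kappa>" "\<kappa> \<le> C" "0 \<le> \<kappa>'" "\<kappa>' \<le> C"
  defines "\<theta>1 \<equiv> q * u powr (q - 1)" and "\<theta>2 \<equiv> q * (1 - q) * u powr (q - 2)"
  shows "(u + w) powr q \<le> (u powr q + \<theta>1 * (2 * r\<^sup>2 * \<alpha>)) + (\<theta>1 * (2 * \<beta> + 2 * r\<^sup>2 * \<nu>)) * \<xi>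
    + (\<theta>1 * \<kappa> - 2 * \<theta>2 * \<beta>\<^sup>2) * \<xi>\<^sup>2 + 1800 * \<epsilon> powr (q - 3) * C ^ 3 * step_error r \<xi>"
proof -
  let ?B = "\<epsilon> powr (q - 3)" and ?S = "step_error r \<xi>"
  note S = step_error_bounds[OF r, of \<xi>]
  \<comment> \<open>As \<epsilon> \<le> \<open>u\<close> and \<epsilon> \<le> 1, all negative powers
    of \<open>u\<close> in the expansion are dominated by the worst power of \<epsilon>.\<close>
  have pow: "u powr (q - j) \<le> ?B" if "1 \<le> j" "j \<le> 3" for j
  proof -
    have "u powr (q - j) \<le> \<epsilon> powr (q - j)"
      using q \<epsilon> that by (intro powr_mono2') auto
    also have "\<dots> \<le> ?B"
      using \<epsilon> that by (intro powr_mono') auto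
    finally show ?thesis .
  qed
  have B: "0 \<le> ?B" by simp
  have "q * u powr (q - 1) \<le> 1 * ?B"
    using q pow[of 1] by (intro mult_mono) auto
  then have \<theta>1: "0 \<le> \<theta>1" "\<theta>1 \<le> ?B"
    using q by (auto simp: \<theta>1_def)
  have "q * (1 - q) \<le> 1 * 1"
    using q by (intro mult_mono) auto
  then have "q * (1 - q) * u powr (q - 2) \<le> 1 * ?B"
    using q pow[of 2] by (intro mult_mono) auto
  then have \<theta>2: "0 \<le> \<theta>2" "\<theta>2 \<le> ?B"
    using q by (auto simp: \<theta>2_def)
  have C3: "C \<le> C ^ 3" "C\<^sup>2 \<le> C ^ 3"
    using C power_increasing[of 1 3 C] power_increasing[of 2 3 C] by auto
  \<comment> \<open>Everything in \<open>w\<close> of order r^2 or smaller; only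
    \<open>2 * \<xi> * \<beta>\<close> is of order r.\<close>
  define z where "z = 2 * r\<^sup>2 * \<alpha> + r ^ 4 * \<kappa>' + 2 * r\<^sup>2 * \<xi> * \<nu> + \<xi>\<^sup>2 * \<kappa>"
  have wz: "w = 2 * \<xi> * \<beta> + z"
    by (simp add: w z_def)
  have z: "\<bar>z\<bar> \<le> 4 * C * (r\<^sup>2 + \<xi>\<^sup>2)"
  proof -
    have r4: "r ^ 4 \<le> r\<^sup>2"
      using r by (auto intro: power_decreasing)
    have 1: "\<bar>2 * r\<^sup>2 * \<alpha>\<bar> \<le> 2 * (r\<^sup>2 * C)"
      using bounds by (simp add: abs_mult mult_left_mono)
    have 2: "\<bar>r ^ 4 * \<kappa>'\<bar> \<le> r\<^sup>2 * C"
      using bounds r4 by (simp add: abs_mult mult_mono)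
    have "2 * \<bar>\<xi>\<bar> * r \<le> r\<^sup>2 + \<xi>\<^sup>2"
      using sum_squares_bound[of "\<bar>\<xi>\<bar>" r] by (simp add: add.commute)
    moreover have "r\<^sup>2 * \<bar>\<xi>\<bar> \<le> \<bar>\<xi>\<bar> * r"
      using r by (simp add: power2_eq_square mult_left_le_one_le mult.commute[of "\<bar>\<xi>\<bar>"] mult_left_mono mult_right_mono)
    ultimately have "2 * (r\<^sup>2 * \<bar>\<xi>\<bar>) \<le> r\<^sup>2 + \<xi>\<^sup>2"
      by linarith
    then have "2 * (r\<^sup>2 * \<bar>\<xi>\<bar>) * \<bar>\<nu>\<bar> \<le> (r\<^sup>2 + \<xi>\<^sup>2) * C"
      using bounds by (intro mult_mono) auto
    then have 3: "\<bar>2 * r\<^sup>2 * \<xi> * \<nu>\<bar> \<le> (r\<^sup>2 + \<xi>\<^sup>2) * C"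
      by (simp add: abs_mult)
    have 4: "\<bar>\<xi>\<^sup>2 * \<kappa>\<bar> \<le> \<xi>\<^sup>2 * C"
      using bounds by (simp add: abs_mult mult_left_mono)
    have "\<bar>z\<bar> \<le> \<bar>2 * r\<^sup>2 * \<alpha>\<bar> + \<bar>r ^ 4 * \<kappa>'\<bar> + \<bar>2 * r\<^sup>2 * \<xi> * \<nu>\<bar> + \<bar>\<xi>\<^sup>2 * \<kappa>\<bar>"
      unfolding z_def by linarith
    also have "\<dots> \<le> 2 * (r\<^sup>2 * C) + r\<^sup>2 * C + (r\<^sup>2 + \<xi>\<^sup>2) * C + \<xi>\<^sup>2 * C"
      using 1 2 3 4 by linarith
    also have "\<dots> \<le> 4 * C * (r\<^sup>2 + \<xi>\<^sup>2)"
      using C by (simp add: algebra_simps)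
    finally show ?thesis .
  qed
  have cube: "?B * \<bar>w\<bar> ^ 3 \<le> 1728 * ?B * C ^ 3 * ?S"
  proof -
    have "\<bar>\<xi> * \<beta>\<bar> \<le> \<bar>\<xi>\<bar> * C"
      using bounds by (simp add: abs_mult mult_left_mono)
    then have "\<bar>w\<bar> \<le> 2 * (\<bar>\<xi>\<bar> * C) + 4 * C * (r\<^sup>2 + \<xi>\<^sup>2)"
      using z unfolding wz by linarith
    also have "\<dots> \<le> 4 * C * (\<bar>\<xi>\<bar> + r\<^sup>2 + \<xi>\<^sup>2)"
      using C by (simp add: algebra_simps)
    finally have "\<bar>w\<bar> ^ 3 \<le> (4 * C * (\<bar>\<xi>\<bar> + r\<^sup>2 + \<xi>\<^sup>2)) ^ 3"
      by (intro power_mono) auto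
    also have "\<dots> = 64 * C ^ 3 * (\<bar>\<xi>\<bar> + r\<^sup>2 + \<xi>\<^sup>2) ^ 3"
      by (simp add: power_mult_distrib)
    also have "\<dots> \<le> 64 * C ^ 3 * (27 * ?S)"
      using S C by (intro mult_left_mono) auto
    finally have "?B * \<bar>w\<bar> ^ 3 \<le> ?B * (64 * C ^ 3 * (27 * ?S))"
      using B by (intro mult_left_mono)
    then show ?thesis by (simp add: algebra_simps)
  qed
  have square: "- (\<theta>2 / 2 * w\<^sup>2) \<le> - (2 * \<theta>2 * \<beta>\<^sup>2 * \<xi>\<^sup>2) + 8 * ?B * C ^ 3 * ?S"
  proof -
    have "\<bar>\<xi> * \<beta> * z\<bar> \<le> \<bar>\<xi>\<bar> * C * (4 * C * (r\<^sup>2 + \<xi>\<^sup>2))"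
      unfolding abs_mult using bounds z C by (intro mult_mono) auto
    also have "\<dots> = 4 * C\<^sup>2 * (r\<^sup>2 * \<bar>\<xi>\<bar> + \<bar>\<xi>\<bar> ^ 3)"
    proof -
      have "\<xi>\<^sup>2 = \<bar>\<xi>\<bar>\<^sup>2" by simp
      then show ?thesis
        by (simp only: power2_eq_square power3_eq_cube) (simp add: algebra_simps)
    qed
    also have "\<dots> \<le> 4 * C ^ 3 * ?S"
      using S C3 C by (intro mult_mono) auto
    finally have a: "\<bar>\<xi> * \<beta> * z\<bar> \<le> 4 * C ^ 3 * ?S" .
    have "w\<^sup>2 = 4 * \<xi>\<^sup>2 * \<beta>\<^sup>2 + 4 * (\<xi> * \<beta> * z) + z\<^sup>2"
      unfolding wz by (simp add: power2_eq_square algebra_simps)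
    then have "- (\<theta>2 / 2 * w\<^sup>2) = - (2 * \<theta>2 * \<beta>\<^sup>2 * \<xi>\<^sup>2) - 2 * \<theta>2 * (\<xi> * \<beta> * z) - \<theta>2 / 2 * z\<^sup>2"
      by (simp add: algebra_simps)
    moreover have "- (2 * \<theta>2 * (\<xi> * \<beta> * z)) \<le> 2 * (?B * (4 * C ^ 3 * ?S))"
    proof -
      have "- (\<theta>2 * (\<xi> * \<beta> * z)) \<le> \<theta>2 * \<bar>\<xi> * \<beta> * z\<bar>"
        using \<theta>2(1) mult_left_mono[of "- (\<xi> * \<beta> * z)" "\<bar>\<xi> * \<beta> * z\<bar>" \<theta>2] by simp
      also have "\<dots> \<le> ?B * (4 * C ^ 3 * ?S)"
        using \<theta>2 a by (intro mult_mono) auto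
      finally show ?thesis by (simp only: mult.assoc mult_minus_right[symmetric])
    qed
    \<comment> \<open>This square enters with a favourable sign and is dropped.\<close>
    moreover have "0 \<le> \<theta>2 / 2 * z\<^sup>2"
      using \<theta>2 by simp
    ultimately show ?thesis
      by (simp add: algebra_simps)
  qed
  have lin: "\<theta>1 * w \<le> \<theta>1 * (2 * r\<^sup>2 * \<alpha>) + \<theta>1 * (2 * \<beta> + 2 * r\<^sup>2 * \<nu>) * \<xi> + \<theta>1 * \<kappa> * \<xi>\<^sup>2 + ?B * C ^ 3 * ?S"
  proof -
    have "\<theta>1 * (r ^ 4 * \<kappa>') \<le> ?B * (?S * C ^ 3)"
      using \<theta>1 S bounds C3 r by (intro mult_mono) auto
    moreover have "\<theta>1 * w = \<theta>1 * (2 * r\<^sup>2 * \<alpha>) + \<theta>1 * (2 * \<beta> + 2 * r\<^sup>2 * \<nu>) * \<xi> + \<theta>1 * \<kappa> * \<xi>\<^sup>2 + \<theta>1 * (r ^ 4 * \<kappa>')"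
      unfolding w by (simp add: algebra_simps)
    ultimately show ?thesis by (simp add: algebra_simps)
  qed
  have "0 \<le> ?B * C ^ 3 * ?S"
    using B C S by simp
  moreover have "(u + w) powr q \<le> u powr q + \<theta>1 * w - \<theta>2 / 2 * w\<^sup>2 + ?B * \<bar>w\<bar> ^ 3"
    unfolding \<theta>1_def \<theta>2_def using powr_third_order_bound[OF q \<epsilon>(1,3,4)] by simp
  moreover have "(\<theta>1 * \<kappa> - 2 * \<theta>2 * \<beta>\<^sup>2) * \<xi>\<^sup>2 = \<theta>1 * \<kappa> * \<xi>\<^sup>2 - 2 * \<theta>2 * \<beta>\<^sup>2 * \<xi>\<^sup>2"
    by (simp add: algebra_simps)
  ultimately show ?thesis
    using cube square lin by linarith
qed

text \<open>The generator applied to \<open>(\<epsilon> + \<bar>x\<bar>\<^sup>2) powr q\<close>. The term \<open>- \<gamma> * u powr q\<close> yields the exponential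
  decay; the other two vanish when first \<open>\<epsilon>\<close> and then the distance \<open>\<delta>\<close> between the scheme \<open>p\<close>
  and the solution \<open>e\<close> tend to zero.\<close>

lemma generator_bound:
  fixes e p m g :: "'a::real_inner"
  assumes q: "0 < q" "q \<le> 1" and D: "0 \<le> D" and A: "A - 2 * (1 - q) * D \<le> - c" and c: "0 \<le> c"
    and \<epsilon>: "0 < \<epsilon>" "\<epsilon> \<le> 1" and R: "0 \<le> R" "norm e \<le> R" and C: "0 \<le> C" "norm m \<le> C" "norm g \<le> C"
    and \<delta>: "norm (p - e) \<le> \<delta>" "\<delta> \<le> 1"
    and diss: "2 * (e \<bullet> m) + (norm g)\<^sup>2 \<le> A * (norm e)\<^sup>2" and noise: "D * (norm e) ^ 4 \<le> (e \<bullet> g)\<^sup>2"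
  defines "u \<equiv> \<epsilon> + (norm p)\<^sup>2"
  shows "q * u powr (q - 1) * (2 * (p \<bullet> m)) + (q * u powr (q - 1) * (norm g)\<^sup>2
      - 2 * (q * (1 - q) * u powr (q - 2)) * (p \<bullet> g)\<^sup>2)
    \<le> - (c * q) * u powr q + (\<bar>A\<bar> + 4 * D) * \<epsilon> powr q
      + ((\<bar>A\<bar> * (2 * R + 1) + 2 * C) * (1 + (R + 1)\<^sup>2)
        + 2 * ((2 * R + 1) * C\<^sup>2 + D * ((2 * R + 1) * (R\<^sup>2 + (R + 1)\<^sup>2)))) * \<delta> * \<epsilon> powr (q - 2)"
proof -
  let ?V = "(norm p)\<^sup>2" and ?c1 = "\<bar>A\<bar> * (2 * R + 1) + 2 * C"
    and ?c2 = "2 * ((2 * R + 1) * C\<^sup>2 + D * ((2 * R + 1) * (R\<^sup>2 + (R + 1)\<^sup>2)))"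
  have \<delta>0: "0 \<le> \<delta>"
    using \<delta>(1) norm_ge_zero order_trans by blast
  have p: "norm p \<le> R + 1"
    using norm_triangle_sub[of p e] R \<delta> by simp
  have np: "\<bar>norm p - norm e\<bar> \<le> \<delta>"
    using norm_triangle_ineq3[of p e] \<delta> by simp
  have u: "\<epsilon> \<le> u" "0 < u" "u \<le> 1 + (R + 1)\<^sup>2" "?V = u - \<epsilon>"
    using \<epsilon> power_mono[OF p norm_ge_zero, of 2] by (auto simp: u_def add_pos_nonneg)
  \<comment> \<open>Replacing the true vector \<open>e\<close> by its approximation \<open>p\<close>
    costs multiples of \<delta>; the factors are collected in \<open>?c1\<close> for the first order
    terms and in \<open>?c2\<close> for the noise term.\<close>
  have V: "\<bar>(norm e)\<^sup>2 - ?V\<bar> \<le> \<delta> * (2 * R + 1)"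
  proof -
    have "(norm e)\<^sup>2 - ?V = (norm e - norm p) * (norm e + norm p)"
      by (simp add: power2_eq_square algebra_simps)
    then have "\<bar>(norm e)\<^sup>2 - ?V\<bar> = \<bar>norm p - norm e\<bar> * (norm e + norm p)"
      by (simp add: abs_mult abs_minus_commute)
    also have "\<dots> \<le> \<delta> * (2 * R + 1)"
      using np p R \<delta>0 by (intro mult_mono) auto
    finally show ?thesis .
  qed
  have a: "2 * (p \<bullet> m) + (norm g)\<^sup>2 \<le> A * ?V + ?c1 * \<delta>"
  proof -
    have "\<bar>(p - e) \<bullet> m\<bar> \<le> \<delta> * C"
      using Cauchy_Schwarz_ineq2[of "p - e" m] mult_mono[OF \<delta>(1) C(2)] \<delta>0 by simp
    moreover have "p \<bullet> m = e \<bullet> m + (p - e) \<bullet> m"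
      by (simp add: inner_diff_left)
    moreover have "A * (norm e)\<^sup>2 \<le> A * ?V + \<bar>A\<bar> * (\<delta> * (2 * R + 1))"
    proof -
      have "A * ((norm e)\<^sup>2 - ?V) \<le> \<bar>A\<bar> * \<bar>(norm e)\<^sup>2 - ?V\<bar>"
        by (metis abs_ge_self abs_mult)
      also have "\<dots> \<le> \<bar>A\<bar> * (\<delta> * (2 * R + 1))"
        using V by (intro mult_left_mono) auto
      finally show ?thesis by (simp add: algebra_simps)
    qed
    moreover have "?c1 * \<delta> = \<bar>A\<bar> * (\<delta> * (2 * R + 1)) + 2 * (\<delta> * C)"
      by (simp add: algebra_simps)
    ultimately show ?thesis
      using diss by linarith
  qed
  have b: "D * ?V\<^sup>2 - ?c2 / 2 * \<delta> \<le> (p \<bullet> g)\<^sup>2"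
  proof -
    have bd: "\<bar>p \<bullet> g - e \<bullet> g\<bar> \<le> \<delta> * C"
      using Cauchy_Schwarz_ineq2[of "p - e" g] mult_mono[OF \<delta>(1) C(3)] \<delta>0 by (simp add: inner_diff_left)
    have "\<bar>p \<bullet> g\<bar> \<le> (R + 1) * C" "\<bar>e \<bullet> g\<bar> \<le> R * C"
      using Cauchy_Schwarz_ineq2[of p g] Cauchy_Schwarz_ineq2[of e g] mult_mono[OF p C(3)] mult_mono[OF R(2) C(3)] R
      by auto
    then have bs: "\<bar>p \<bullet> g + e \<bullet> g\<bar> \<le> (2 * R + 1) * C"
      by (simp add: algebra_simps)
    have "(p \<bullet> g)\<^sup>2 - (e \<bullet> g)\<^sup>2 = (p \<bullet> g - e \<bullet> g) * (p \<bullet> g + e \<bullet> g)"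
      by (simp add: power2_eq_square algebra_simps)
    then have "\<bar>(p \<bullet> g)\<^sup>2 - (e \<bullet> g)\<^sup>2\<bar> = \<bar>p \<bullet> g - e \<bullet> g\<bar> * \<bar>p \<bullet> g + e \<bullet> g\<bar>"
      by (simp only: abs_mult)
    also have "\<dots> \<le> \<delta> * C * ((2 * R + 1) * C)"
      using \<delta>0 C by (intro mult_mono bd bs) auto
    finally have "\<bar>(p \<bullet> g)\<^sup>2 - (e \<bullet> g)\<^sup>2\<bar> \<le> \<delta> * C * ((2 * R + 1) * C)" .
    moreover have "D * ?V\<^sup>2 \<le> D * (norm e) ^ 4 + D * (\<delta> * (2 * R + 1) * (R\<^sup>2 + (R + 1)\<^sup>2))"
    proof -
      have "?V\<^sup>2 - (norm e) ^ 4 = (?V - (norm e)\<^sup>2) * ((norm e)\<^sup>2 + ?V)"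
        by (simp add: power2_eq_square power4_eq_xxxx algebra_simps)
      also have "\<dots> \<le> \<delta> * (2 * R + 1) * (R\<^sup>2 + (R + 1)\<^sup>2)"
        using V power_mono[OF p norm_ge_zero, of 2] power_mono[OF R(2) norm_ge_zero, of 2] \<delta>0 R
        by (intro mult_mono add_mono) auto
      finally have "D * (?V\<^sup>2 - (norm e) ^ 4) \<le> D * (\<delta> * (2 * R + 1) * (R\<^sup>2 + (R + 1)\<^sup>2))"
        using D by (rule mult_left_mono)
      then show ?thesis by (simp add: algebra_simps)
    qed
    moreover have "?c2 / 2 * \<delta> = \<delta> * C * ((2 * R + 1) * C) + D * (\<delta> * (2 * R + 1) * (R\<^sup>2 + (R + 1)\<^sup>2))"
      by (simp add: power2_eq_square algebra_simps)
    ultimately show ?thesis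
      using noise by linarith
  qed
  \<comment> \<open>With the factor \<open>q * u powr (q - 2)\<close> taken out, the claim is
    polynomial in \<open>u\<close>. Writing \<open>(norm p)\<^sup>2\<close> as
    \<open>u - \<epsilon>\<close> produces the term linear in \<epsilon>.\<close>
  have main: "(2 * (p \<bullet> m) + (norm g)\<^sup>2) * u - 2 * (1 - q) * (p \<bullet> g)\<^sup>2
    \<le> - c * u\<^sup>2 + (\<bar>A\<bar> + 4 * D) * \<epsilon> * u + (?c1 * (1 + (R + 1)\<^sup>2) + ?c2) * \<delta>"
  proof -
    have c1: "0 \<le> ?c1" and c2: "0 \<le> ?c2"
      using R C D by auto
    have "(2 * (p \<bullet> m) + (norm g)\<^sup>2) * u \<le> (A * ?V + ?c1 * \<delta>) * u"
      using a u by (intro mult_right_mono) auto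
    also have "\<dots> = A * u\<^sup>2 - A * \<epsilon> * u + ?c1 * \<delta> * u"
      unfolding u(4) by (simp add: power2_eq_square algebra_simps)
    finally have "(2 * (p \<bullet> m) + (norm g)\<^sup>2) * u \<le> A * u\<^sup>2 - A * \<epsilon> * u + ?c1 * \<delta> * u" .
    moreover have "- A * \<epsilon> * u \<le> \<bar>A\<bar> * \<epsilon> * u"
      using \<epsilon> u by (intro mult_right_mono) auto
    moreover have "?c1 * \<delta> * u \<le> ?c1 * \<delta> * (1 + (R + 1)\<^sup>2)"
      using u c1 \<delta>0 by (intro mult_left_mono) auto
    ultimately have 1: "(2 * (p \<bullet> m) + (norm g)\<^sup>2) * u \<le> A * u\<^sup>2 + \<bar>A\<bar> * \<epsilon> * u + ?c1 * \<delta> * (1 + (R + 1)\<^sup>2)"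
      by linarith
    have "?V\<^sup>2 \<ge> u\<^sup>2 - 2 * \<epsilon> * u"
      unfolding u(4) by (simp add: power2_eq_square algebra_simps)
    then have "D * (u\<^sup>2 - 2 * \<epsilon> * u) \<le> D * ?V\<^sup>2"
      using D by (rule mult_left_mono)
    then have "D * (u\<^sup>2 - 2 * \<epsilon> * u) - ?c2 / 2 * \<delta> \<le> (p \<bullet> g)\<^sup>2"
      using b by linarith
    then have "2 * (1 - q) * (D * (u\<^sup>2 - 2 * \<epsilon> * u) - ?c2 / 2 * \<delta>) \<le> 2 * (1 - q) * (p \<bullet> g)\<^sup>2"
      using q by (intro mult_left_mono) auto
    moreover have "2 * (1 - q) * (D * (u\<^sup>2 - 2 * \<epsilon> * u) - k / 2 * \<delta>)
      = 2 * (1 - q) * D * u\<^sup>2 - (1 - q) * (4 * D * \<epsilon> * u) - (1 - q) * (k * \<delta>)" for k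
      by (simp add: field_simps)
    note this[of ?c2]
    moreover have "(1 - q) * (4 * D * \<epsilon> * u) \<le> 4 * D * \<epsilon> * u"
      using q D \<epsilon> u by (intro mult_left_le_one_le) auto
    moreover have "(1 - q) * (?c2 * \<delta>) \<le> ?c2 * \<delta>"
      using q c2 \<delta>0 by (intro mult_left_le_one_le mult_nonneg_nonneg) auto
    ultimately have 2: "- (2 * (1 - q) * (p \<bullet> g)\<^sup>2) \<le> - (2 * (1 - q) * D * u\<^sup>2) + 4 * D * \<epsilon> * u + ?c2 * \<delta>"
      by linarith
    have "(A - 2 * (1 - q) * D) * u\<^sup>2 \<le> - c * u\<^sup>2"
      using A by (intro mult_right_mono) auto
    with 1 2 show ?thesis
      by (simp add: algebra_simps)
  qed
  let ?c3 = "?c1 * (1 + (R + 1)\<^sup>2) + ?c2"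
  have c3: "0 \<le> ?c3"
    using R C D by (intro add_nonneg_nonneg mult_nonneg_nonneg) auto
  have pw: "u powr (q - 1) = u powr (q - 2) * u" "u powr q = u powr (q - 2) * u\<^sup>2"
    using u powr_add[of u "q - 2" 1] powr_add[of u "q - 2" 2] by (auto simp: powr_numeral)
  have "q * u powr (q - 1) * (2 * (p \<bullet> m)) + (q * u powr (q - 1) * (norm g)\<^sup>2
      - 2 * (q * (1 - q) * u powr (q - 2)) * (p \<bullet> g)\<^sup>2)
    = q * u powr (q - 2) * ((2 * (p \<bullet> m) + (norm g)\<^sup>2) * u - 2 * (1 - q) * (p \<bullet> g)\<^sup>2)"
    unfolding pw by (simp add: algebra_simps)
  also have "\<dots> \<le> q * u powr (q - 2) * (- c * u\<^sup>2 + (\<bar>A\<bar> + 4 * D) * \<epsilon> * u + ?c3 * \<delta>)"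
    using main q by (intro mult_left_mono) auto
  also have "\<dots> = - (c * q) * u powr q + q * ((\<bar>A\<bar> + 4 * D) * (\<epsilon> * u powr (q - 1))) + q * (?c3 * \<delta> * u powr (q - 2))"
    unfolding pw by (simp add: algebra_simps)
  also have "q * ((\<bar>A\<bar> + 4 * D) * (\<epsilon> * u powr (q - 1))) \<le> 1 * ((\<bar>A\<bar> + 4 * D) * \<epsilon> powr q)"
  proof -
    have "\<epsilon> * u powr (q - 1) \<le> \<epsilon> * \<epsilon> powr (q - 1)"
      using q u \<epsilon> by (intro mult_left_mono powr_mono2') auto
    also have "\<dots> = \<epsilon> powr q"
      using \<epsilon> powr_add[of \<epsilon> 1 "q - 1"] by simp
    finally show ?thesis
      using q D \<epsilon> by (intro mult_mono) auto
  qed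
  also have "q * (?c3 * \<delta> * u powr (q - 2)) \<le> 1 * (?c3 * \<delta> * \<epsilon> powr (q - 2))"
    using q u \<epsilon> c3 \<delta>0 by (intro mult_mono mult_left_mono powr_mono2') auto
  finally show ?thesis by simp
qed

context brownian_filtration
begin

text \<open>On an event known at time \<open>s\<close> the term linear in the increment averages
  out, and the square of the increment becomes r^2. By the Gaussian moments and r \<le> 1, the
  expectation of \<open>step_error\<close> is at most 1 + 1 + 3 + 15 = 20 times r^3.\<close>

lemma one_step_expectation:
  assumes st: "0 \<le> s" "t = s + r\<^sup>2" and r: "0 < r" "r \<le> 1" and K: "0 \<le> K"
    and A: "A \<in> sets (Fl s)"
    and G: "G0 \<in> borel_measurable (Fl s)" "G1 \<in> borel_measurable (Fl s)" "G2 \<in> borel_measurable (Fl s)"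
    and bound: "\<And>\<omega>. \<omega> \<in> A \<Longrightarrow> \<bar>G0 \<omega>\<bar> \<le> C" "\<And>\<omega>. \<omega> \<in> A \<Longrightarrow> \<bar>G1 \<omega>\<bar> \<le> C" "\<And>\<omega>. \<omega> \<in> A \<Longrightarrow> \<bar>G2 \<omega>\<bar> \<le> C"
    and \<Phi>: "\<Phi> \<in> borel_measurable M" "\<And>\<omega>. 0 \<le> \<Phi> \<omega>"
      "\<And>\<omega>. \<omega> \<in> A \<Longrightarrow> \<Phi> \<omega> \<le> G0 \<omega> + G1 \<omega> * (b t \<omega> - b s \<omega>) + G2 \<omega> * (b t \<omega> - b s \<omega>)\<^sup>2
        + K * step_error r (b t \<omega> - b s \<omega>)"
  shows "integrable M (\<lambda>\<omega>. indicator A \<omega> * \<Phi> \<omega>)"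
    and "expectation (\<lambda>\<omega>. indicator A \<omega> * \<Phi> \<omega>)
      \<le> expectation (\<lambda>\<omega>. indicator A \<omega> * (G0 \<omega> + r\<^sup>2 * G2 \<omega>)) + 20 * K * r ^ 3"
proof -
  let ?\<xi> = "\<lambda>\<omega>. b t \<omega> - b s \<omega>"
  have s_t: "s < t" using st r by simp
  have ts: "t - s = r\<^sup>2" using st by simp
  note mom = increment_moments[OF st(1) s_t]
  have AM: "A \<in> events"
    using A by (rule sets_Fl)
  have iG: "(\<lambda>\<omega>. indicator A \<omega> * G' \<omega>) \<in> borel_measurable (Fl s)" "integrable M (\<lambda>\<omega>. indicator A \<omega> * G' \<omega> :: real)"
    if "G' \<in> borel_measurable (Fl s)" "\<And>\<omega>. \<omega> \<in> A \<Longrightarrow> \<bar>G' \<omega>\<bar> \<le> C" for G'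
  proof -
    show m: "(\<lambda>\<omega>. indicator A \<omega> * G' \<omega>) \<in> borel_measurable (Fl s)"
      using that(1) A by (intro borel_measurable_times borel_measurable_indicator)
    have "\<bar>indicator A \<omega> * G' \<omega>\<bar> \<le> \<bar>C\<bar>" for \<omega>
      using that(2)[of \<omega>] by (auto simp: indicator_def)
    then show "integrable M (\<lambda>\<omega>. indicator A \<omega> * G' \<omega> :: real)"
      using Fl_measurable[OF m] by (intro integrable_const_bound[where B = "\<bar>C\<bar>"]) auto
  qed
  have i1: "integrable M (\<lambda>\<omega>. indicator A \<omega> * G1 \<omega> * ?\<xi> \<omega>)" "expectation (\<lambda>\<omega>. indicator A \<omega> * G1 \<omega> * ?\<xi> \<omega>) = 0"
    using increment_independent[OF st(1) s_t iG[OF G(2) bound(2)], of "\<lambda>x. x"] mom(1)[of 1] mom(2) by auto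
  have i2: "integrable M (\<lambda>\<omega>. indicator A \<omega> * G2 \<omega> * (?\<xi> \<omega>)\<^sup>2)"
    "expectation (\<lambda>\<omega>. indicator A \<omega> * G2 \<omega> * (?\<xi> \<omega>)\<^sup>2) = expectation (\<lambda>\<omega>. indicator A \<omega> * G2 \<omega>) * r\<^sup>2"
    using increment_independent[OF st(1) s_t iG[OF G(3) bound(3)], of "\<lambda>x. x\<^sup>2"] mom(1)[of 2] mom(3) ts by auto
  have iS: "integrable M (\<lambda>\<omega>. step_error r (?\<xi> \<omega>))"
    unfolding step_error_def using mom(1)
    by (intro Bochner_Integration.integrable_add integrable_mult_right integrable_divide) auto
  have "expectation (\<lambda>\<omega>. step_error r (?\<xi> \<omega>)) = r ^ 3 + r * (t - s) + 3 * (t - s)\<^sup>2 / r + 15 * (t - s) ^ 3"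
    unfolding step_error_def using mom
    by (simp add: prob_space)
  also have "\<dots> = r ^ 3 + r ^ 3 + 3 * r ^ 3 + 15 * r ^ 6"
    unfolding ts using r by (simp add: field_simps eval_nat_numeral)
  also have "\<dots> \<le> 20 * r ^ 3"
    using power_decreasing[of 3 6 r] r by simp
  finally have eS: "expectation (\<lambda>\<omega>. step_error r (?\<xi> \<omega>)) \<le> 20 * r ^ 3" .
  define U where "U \<omega> = indicator A \<omega> * G0 \<omega> + indicator A \<omega> * G1 \<omega> * ?\<xi> \<omega> + indicator A \<omega> * G2 \<omega> * (?\<xi> \<omega>)\<^sup>2
    + K * step_error r (?\<xi> \<omega>)" for \<omega>
  have iU: "integrable M U"
    unfolding U_def using iG(2)[OF G(1) bound(1)] i1 i2 iS by auto
  have le: "indicator A \<omega> * \<Phi> \<omega> \<le> U \<omega>" for \<omega>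
    using \<Phi>(3)[of \<omega>] K step_error_bounds(1)[OF r, of "?\<xi> \<omega>"] by (auto simp: U_def indicator_def)
  have nonneg: "0 \<le> indicator A \<omega> * \<Phi> \<omega>" for \<omega>
    using \<Phi>(2) by simp
  show int: "integrable M (\<lambda>\<omega>. indicator A \<omega> * \<Phi> \<omega>)"
  proof (rule Bochner_Integration.integrable_bound[OF iU])
    show "(\<lambda>\<omega>. indicator A \<omega> * \<Phi> \<omega>) \<in> borel_measurable M"
      using \<Phi>(1) AM by (intro borel_measurable_times borel_measurable_indicator)
    show "AE \<omega> in M. norm (indicator A \<omega> * \<Phi> \<omega>) \<le> norm (U \<omega>)"
      using le nonneg by (intro AE_I2) (smt (verit) real_norm_def)
  qed
  have "expectation (\<lambda>\<omega>. indicator A \<omega> * \<Phi> \<omega>) \<le> expectation U"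
    using int iU le by (rule integral_mono)
  also have "expectation U = expectation (\<lambda>\<omega>. indicator A \<omega> * G0 \<omega>) + expectation (\<lambda>\<omega>. indicator A \<omega> * G2 \<omega>) * r\<^sup>2
      + K * expectation (\<lambda>\<omega>. step_error r (?\<xi> \<omega>))"
    unfolding U_def using iG(2)[OF G(1) bound(1)] i1 i2 iS by simp
  also have "K * expectation (\<lambda>\<omega>. step_error r (?\<xi> \<omega>)) \<le> K * (20 * r ^ 3)"
    using eS K by (rule mult_left_mono)
  also have "expectation (\<lambda>\<omega>. indicator A \<omega> * G0 \<omega>) + expectation (\<lambda>\<omega>. indicator A \<omega> * G2 \<omega>) * r\<^sup>2
    = expectation (\<lambda>\<omega>. indicator A \<omega> * (G0 \<omega> + r\<^sup>2 * G2 \<omega>))"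
  proof -
    have "indicator A \<omega> * (G0 \<omega> + r\<^sup>2 * G2 \<omega>) = indicator A \<omega> * G0 \<omega> + indicator A \<omega> * G2 \<omega> * r\<^sup>2" for \<omega>
      by (simp add: algebra_simps)
    then show ?thesis
      using iG(2)[OF G(1) bound(1)] iG(2)[OF G(3) bound(3)] by simp
  qed
  finally show "expectation (\<lambda>\<omega>. indicator A \<omega> * \<Phi> \<omega>)
      \<le> expectation (\<lambda>\<omega>. indicator A \<omega> * (G0 \<omega> + r\<^sup>2 * G2 \<omega>)) + 20 * K * r ^ 3"
    by simp
qed

end

section \<open>The stopped Lyapunov function\<close>

text \<open>Writes a stopped process as a sum, so that expectations can be taken term by term;
  \<open>l\<close> is the first index at which \<open>a\<close> fails, or \<open>k\<close> if there
  is none before.\<close>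

lemma stopped_sum_eq:
  fixes Z :: "nat \<Rightarrow> real"
  assumes "\<And>i j. a j \<Longrightarrow> i \<le> j \<Longrightarrow> a i"
  shows "\<exists>l\<le>k. Z 0 + (\<Sum>j<k. of_bool (a j) * (Z (Suc j) - Z j)) = Z l \<and> (\<forall>i<l. a i) \<and> (l < k \<longrightarrow> \<not> a l)"
proof (induction k)
  case (Suc k)
  then obtain l where l: "l \<le> k" "Z 0 + (\<Sum>j<k. of_bool (a j) * (Z (Suc j) - Z j)) = Z l"
    "\<forall>i<l. a i" "l < k \<longrightarrow> \<not> a l"
    by blast
  show ?case
  proof (cases "a k")
    case True
    then have "l = k"
      using l(1,4) assms[of k l] by (cases "l < k") auto
    with True l show ?thesis
      by (intro exI[of _ "Suc k"]) (auto simp: less_Suc_eq)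
  next
    case False
    with l show ?thesis
      by (intro exI[of _ l]) (auto simp: le_less)
  qed
qed simp

text \<open>\<open>P\<close> selects the part of the state that is to decay. For V = |P x|^2 the two
  inequalities bound the generator on V^q by q (A - 2 (1 - q) D) V^q, where D enters through the
  second derivative of V^q along the noise. Under \<open>A < 2 * D\<close> this is negative for
  small q.\<close>

locale stable_sde = ito_sde M Fl b \<mu> g X I
  for M :: "'w measure" and Fl b and \<mu> g :: "real \<Rightarrow> 'a::euclidean_space \<Rightarrow> 'a" and X I +
  fixes P :: "'a \<Rightarrow> 'c::euclidean_space" and A D :: real
  assumes P_linear: "bounded_linear P" and norm_P: "norm (P x) \<le> norm x"
    and dissipation: "t \<ge> 0 \<Longrightarrow> 2 * (P x \<bullet> P (\<mu> t x)) + (norm (P (g t x)))\<^sup>2 \<le> A * (norm (P x))\<^sup>2"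
    and noise_lower: "t \<ge> 0 \<Longrightarrow> D * (norm (P x)) ^ 4 \<le> (P x \<bullet> P (g t x))\<^sup>2"
    and D: "0 \<le> D" and AD: "A < 2 * D"
begin

definition decay :: real where "decay = D - A / 2"

text \<open>The condition to meet is 2 q D \<le> \<open>decay\<close>: the factor 1 - q then gives
  away at most half of the gap \<open>2 * D - A\<close>. The 1 in the denominator allows for
  \<open>D = 0\<close>.\<close>

definition exponent :: real where "exponent = min 1 (decay / (2 * (D + 1)))"

lemma decay_pos: "decay > 0"
  using AD by (simp add: decay_def)

lemma exponent: "0 < exponent" "exponent \<le> 1" "A - 2 * (1 - exponent) * D \<le> - decay"
proof -
  show "0 < exponent" "exponent \<le> 1"
    using decay_pos D by (auto simp: exponent_def)
  have "exponent * (2 * D) \<le> decay / (2 * (D + 1)) * (2 * (D + 1))"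
    using D decay_pos by (intro mult_mono) (auto simp: exponent_def)
  also have "\<dots> = decay"
    using D by simp
  finally show "A - 2 * (1 - exponent) * D \<le> - decay"
    by (simp add: decay_def algebra_simps)
qed

definition rate :: real where "rate = decay * exponent"

lemma rate_pos: "rate > 0"
  using decay_pos exponent by (simp add: rate_def)

definition lyapunov :: "real \<Rightarrow> nat \<Rightarrow> nat \<Rightarrow> 'w \<Rightarrow> real" where
  "lyapunov \<epsilon> n k \<omega> = exp (rate * dyadic n k) * (\<epsilon> + (norm (P (scheme n k \<omega>)))\<^sup>2) powr exponent"

lemma lyapunov_adapted: "lyapunov \<epsilon> n k \<in> borel_measurable (Fl (dyadic n k))"
proof -
  note [measurable] = scheme_adapted[of n k] borel_measurable_continuous_onI[OF linear_continuous_on[OF P_linear]]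
  show ?thesis
    unfolding lyapunov_def by measurable
qed

lemma lyapunov_nonneg: "0 \<le> lyapunov \<epsilon> n k \<omega>"
  by (simp add: lyapunov_def)

text \<open>The events, known at grid time \<open>k\<close>, on which the stopped sum goes on.
  \<open>R\<close> keeps the coefficients bounded, \<delta> ties the scheme to the solution, and
  \<open>l\<close> is the level of the maximal inequality. The initial value has its own radius
  \<open>R0\<close>, because \<open>R\<close> is later enlarged with \<open>R0\<close>
  fixed.\<close>

definition alive :: "real \<Rightarrow> real \<Rightarrow> real \<Rightarrow> real \<Rightarrow> real \<Rightarrow> nat \<Rightarrow> nat \<Rightarrow> 'w set" where
  "alive R0 R \<epsilon> \<delta> l n k = {\<omega> \<in> space M. norm (X 0 \<omega>) \<le> R0 \<and> (\<forall>j\<in>{..k}. norm (X (dyadic n j) \<omega>) \<le> R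
    \<and> norm (scheme n j \<omega> - X (dyadic n j) \<omega>) \<le> \<delta> \<and> lyapunov \<epsilon> n j \<omega> < l)}"

lemma alive_events: "alive R0 R \<epsilon> \<delta> l n k \<in> sets (Fl (dyadic n k))"
proof -
  have "{\<omega> \<in> space (Fl (dyadic n k)). norm (X 0 \<omega>) \<le> R0 \<and> (\<forall>j\<in>{..k}. norm (X (dyadic n j) \<omega>) \<le> R
    \<and> norm (scheme n j \<omega> - X (dyadic n j) \<omega>) \<le> \<delta> \<and> lyapunov \<epsilon> n j \<omega> < l)} \<in> sets (Fl (dyadic n k))"
  proof (intro sets.sets_Collect_conj sets.sets_Collect_finite_All' finite_atMost)
    have [measurable]: "X 0 \<in> borel_measurable (Fl (dyadic n k))"
      by (rule Fl_measurable_mono[OF _ X_adapted]) auto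
    show "{\<omega> \<in> space (Fl (dyadic n k)). norm (X 0 \<omega>) \<le> R0} \<in> sets (Fl (dyadic n k))"
      by measurable
    fix j assume "j \<in> {..k}"
    then have "dyadic n j \<le> dyadic n k" by simp
    note [measurable] = Fl_measurable_mono[OF this X_adapted[OF dyadic_nonneg]]
      Fl_measurable_mono[OF this scheme_adapted] Fl_measurable_mono[OF this lyapunov_adapted[of \<epsilon>]]
    show "{\<omega> \<in> space (Fl (dyadic n k)). norm (X (dyadic n j) \<omega>) \<le> R} \<in> sets (Fl (dyadic n k))"
      by measurable
    show "{\<omega> \<in> space (Fl (dyadic n k)). norm (scheme n j \<omega> - X (dyadic n j) \<omega>) \<le> \<delta>} \<in> sets (Fl (dyadic n k))"
      by measurable
    show "{\<omega> \<in> space (Fl (dyadic n k)). lyapunov \<epsilon> n j \<omega> < l} \<in> sets (Fl (dyadic n k))"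
      by measurable
  qed auto
  then show ?thesis
    by (simp add: alive_def)
qed

lemma alive_antimono: "\<omega> \<in> alive R0 R \<epsilon> \<delta> l n j \<Longrightarrow> i \<le> j \<Longrightarrow> \<omega> \<in> alive R0 R \<epsilon> \<delta> l n i"
  by (auto simp: alive_def)

text \<open>The error terms of \<open>generator_bound\<close> and of \<open>powr_step_bound\<close>, with \<open>C\<close> bounding both
  coefficients on the ball of radius \<open>R\<close>.\<close>

definition generator_error :: "real \<Rightarrow> real \<Rightarrow> real \<Rightarrow> real \<Rightarrow> real" where
  "generator_error R C \<epsilon> \<delta> = (\<bar>A\<bar> + 4 * D) * \<epsilon> powr exponent
    + ((\<bar>A\<bar> * (2 * R + 1) + 2 * C) * (1 + (R + 1)\<^sup>2)
      + 2 * ((2 * R + 1) * C\<^sup>2 + D * ((2 * R + 1) * (R\<^sup>2 + (R + 1)\<^sup>2)))) * \<delta> * \<epsilon> powr (exponent - 2)"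

definition discretisation_error :: "real \<Rightarrow> real \<Rightarrow> real \<Rightarrow> real" where
  "discretisation_error R C \<epsilon> = 1800 * \<epsilon> powr (exponent - 3) * ((R + 1) * C\<^sup>2) ^ 3"

section \<open>Supermartingale estimate on a fixed grid\<close>

context
  fixes R0 R C \<epsilon> \<delta> l :: real and n T :: nat
  assumes R: "0 \<le> R" "R \<le> real n" and C: "1 \<le> C" and \<epsilon>: "0 < \<epsilon>" "\<epsilon> \<le> 1" and \<delta>: "0 < \<delta>" "\<delta> \<le> 1" "\<delta>\<^sup>2 \<le> \<epsilon>"
    and l: "0 < l"
    and coefficient_bound: "\<And>t x. t \<in> {0..real T} \<Longrightarrow> norm x \<le> R \<Longrightarrow> norm (\<mu> t x) \<le> C \<and> norm (g t x) \<le> C"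
begin

text \<open>One step of the supermartingale property, up to an error. Over a step of length r^2 the
  generator multiplies the power by at most 1 - rate r^2, apart from the error terms, while the
  exponential weight gains exp (rate r^2); 1 - x \<le> exp (- x) lets the two cancel.\<close>

lemma lyapunov_step:
  assumes k: "k < T * 2 ^ n"
  defines "r \<equiv> sqrt (1 / 2 ^ n)" and "B \<equiv> alive R0 R \<epsilon> \<delta> l n k"
  shows "integrable M (\<lambda>\<omega>. indicator B \<omega> * lyapunov \<epsilon> n (Suc k) \<omega>)" (is ?int)
    and "integrable M (\<lambda>\<omega>. indicator B \<omega> * lyapunov \<epsilon> n k \<omega>)" (is ?int')
    and "expectation (\<lambda>\<omega>. indicator B \<omega> * lyapunov \<epsilon> n (Suc k) \<omega>)
      \<le> expectation (\<lambda>\<omega>. indicator B \<omega> * lyapunov \<epsilon> n k \<omega>)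
        + exp (rate * T) * (r\<^sup>2 * generator_error R C \<epsilon> \<delta> + 20 * discretisation_error R C \<epsilon> * r ^ 3)"
proof -
  interpret P: bounded_linear P by (rule P_linear)
  let ?q = exponent and ?s = "dyadic n k" and ?t = "dyadic n (Suc k)"
  let ?\<xi> = "\<lambda>\<omega>. b ?t \<omega> - b ?s \<omega>"
  define p where "p \<omega> = P (scheme n k \<omega>)" for \<omega>
  define m where "m \<omega> = P (\<mu> ?s (X ?s \<omega>))" for \<omega>
  define h where "h \<omega> = P (g ?s (X ?s \<omega>))" for \<omega>
  define u where "u \<omega> = \<epsilon> + (norm (p \<omega>))\<^sup>2" for \<omega>
  define \<theta>1 where "\<theta>1 \<omega> = ?q * u \<omega> powr (?q - 1)" for \<omega>
  define \<theta>2 where "\<theta>2 \<omega> = ?q * (1 - ?q) * u \<omega> powr (?q - 2)" for \<omega>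
  define \<Phi> where "\<Phi> \<omega> = (\<epsilon> + (norm (P (scheme n (Suc k) \<omega>)))\<^sup>2) powr ?q" for \<omega>
  \<comment> \<open>One bound for all five inner products and squared norms in the
    expansion.\<close>
  define C' where "C' = (R + 1) * C\<^sup>2"
  define K where "K = discretisation_error R C \<epsilon>"
  have r: "0 < r" "r \<le> 1" "r\<^sup>2 = 1 / 2 ^ n"
    by (auto simp: r_def real_sqrt_le_1_iff)
  have expand: "(norm (x + a *\<^sub>R y + c *\<^sub>R z))\<^sup>2 = (norm x)\<^sup>2 + 2 * a * (x \<bullet> y) + 2 * c * (x \<bullet> z)
    + a\<^sup>2 * (norm y)\<^sup>2 + 2 * a * c * (y \<bullet> z) + c\<^sup>2 * (norm z)\<^sup>2" for x y z :: 'c and a c :: real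
    unfolding power2_norm_eq_inner
    by (simp add: inner_add_left inner_add_right inner_commute power2_eq_square algebra_simps)
  have t: "?t = ?s + r\<^sup>2" "?t \<le> real T" "?s \<in> {0..real T}"
    using k r dyadic_le_of_nat[of "Suc k" T n] dyadic_le_of_nat[of k T n] by (auto simp: dyadic_Suc)
  have C': "1 \<le> C'" "C \<le> C'" "C\<^sup>2 \<le> C'" "(R + 1) * C \<le> C'"
  proof -
    have CC: "1 \<le> C\<^sup>2" "C \<le> C\<^sup>2"
      using C power_increasing[of 0 2 C] power_increasing[of 1 2 C] by auto
    have "1 * C\<^sup>2 \<le> (R + 1) * C\<^sup>2" "(R + 1) * C \<le> (R + 1) * C\<^sup>2"
      using R CC by (intro mult_right_mono mult_left_mono; simp)+
    then show "1 \<le> C'" "C \<le> C'" "C\<^sup>2 \<le> C'" "(R + 1) * C \<le> C'"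
      using CC by (auto simp: C'_def)
  qed
  have K: "0 \<le> K" and K_eq: "K = 1800 * \<epsilon> powr (?q - 3) * C' ^ 3"
    using C' by (auto simp: K_def discretisation_error_def C'_def)
  have BF: "B \<in> sets (Fl ?s)"
    unfolding B_def by (rule alive_events)
  have meas: "p \<in> borel_measurable (Fl ?s)" "m \<in> borel_measurable (Fl ?s)" "h \<in> borel_measurable (Fl ?s)"
  proof -
    note [measurable] = borel_measurable_continuous_onI[OF linear_continuous_on[OF P_linear]]
      scheme_adapted[of n k] coefficient_adapted[OF cont_\<mu> dyadic_nonneg[of n k]]
      coefficient_adapted[OF cont_g dyadic_nonneg[of n k]]
    show "p \<in> borel_measurable (Fl ?s)" "m \<in> borel_measurable (Fl ?s)" "h \<in> borel_measurable (Fl ?s)"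
      unfolding p_def m_def h_def by measurable
  qed
  note [measurable] = meas
  have umeas [measurable]: "u \<in> borel_measurable (Fl ?s)"
    unfolding u_def by measurable
  have \<theta>meas [measurable]: "\<theta>1 \<in> borel_measurable (Fl ?s)" "\<theta>2 \<in> borel_measurable (Fl ?s)"
    unfolding \<theta>1_def \<theta>2_def by measurable
  define G0 where "G0 \<omega> = u \<omega> powr ?q + \<theta>1 \<omega> * (2 * r\<^sup>2 * (p \<omega> \<bullet> m \<omega>))" for \<omega>
  define G1 where "G1 \<omega> = \<theta>1 \<omega> * (2 * (p \<omega> \<bullet> h \<omega>) + 2 * r\<^sup>2 * (m \<omega> \<bullet> h \<omega>))" for \<omega>
  define G2 where "G2 \<omega> = \<theta>1 \<omega> * (norm (h \<omega>))\<^sup>2 - 2 * \<theta>2 \<omega> * (p \<omega> \<bullet> h \<omega>)\<^sup>2" for \<omega>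
  have Gmeas: "G0 \<in> borel_measurable (Fl ?s)" "G1 \<in> borel_measurable (Fl ?s)" "G2 \<in> borel_measurable (Fl ?s)"
    unfolding G0_def G1_def G2_def by measurable
  have onB: "norm (P (X ?s \<omega>)) \<le> R" "norm (m \<omega>) \<le> C" "norm (h \<omega>) \<le> C" "norm (p \<omega> - P (X ?s \<omega>)) \<le> \<delta>"
    "norm (p \<omega>) \<le> R + 1" "\<epsilon> \<le> u \<omega>" "u \<omega> \<le> 1 + (R + 1)\<^sup>2" "norm (X ?s \<omega>) \<le> R" "lyapunov \<epsilon> n k \<omega> < l"
    if "\<omega> \<in> B" for \<omega>
  proof -
    have a: "norm (X ?s \<omega>) \<le> R" "norm (scheme n k \<omega> - X ?s \<omega>) \<le> \<delta>" "lyapunov \<epsilon> n k \<omega> < l"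
      using that by (auto simp: B_def alive_def)
    show "norm (P (X ?s \<omega>)) \<le> R"
      using norm_P a(1) order_trans by blast
    have "norm (\<mu> ?s (X ?s \<omega>)) \<le> C" "norm (g ?s (X ?s \<omega>)) \<le> C"
      using coefficient_bound[OF t(3) a(1)] by auto
    then show "norm (m \<omega>) \<le> C" "norm (h \<omega>) \<le> C"
      unfolding m_def h_def using norm_P order_trans by blast+
    have "p \<omega> - P (X ?s \<omega>) = P (scheme n k \<omega> - X ?s \<omega>)"
      by (simp add: p_def P.diff)
    then show pe: "norm (p \<omega> - P (X ?s \<omega>)) \<le> \<delta>"
      using norm_P[of "scheme n k \<omega> - X ?s \<omega>"] a(2) by simp
    show p: "norm (p \<omega>) \<le> R + 1"
      using norm_triangle_sub[of "p \<omega>" "P (X ?s \<omega>)"] pe \<open>norm (P (X ?s \<omega>)) \<le> R\<close> \<delta> by linarith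
    show "\<epsilon> \<le> u \<omega>" "u \<omega> \<le> 1 + (R + 1)\<^sup>2"
      using power_mono[OF p norm_ge_zero, of 2] \<epsilon> by (auto simp: u_def)
    show "norm (X ?s \<omega>) \<le> R" "lyapunov \<epsilon> n k \<omega> < l" by fact+
  qed
  have inner: "\<bar>p \<omega> \<bullet> m \<omega>\<bar> \<le> C'" "\<bar>p \<omega> \<bullet> h \<omega>\<bar> \<le> C'" "\<bar>m \<omega> \<bullet> h \<omega>\<bar> \<le> C'" "(norm (h \<omega>))\<^sup>2 \<le> C'" "(norm (m \<omega>))\<^sup>2 \<le> C'"
    if "\<omega> \<in> B" for \<omega>
  proof -
    note o = onB[OF that]
    have "norm (p \<omega>) * norm (m \<omega>) \<le> (R + 1) * C" "norm (p \<omega>) * norm (h \<omega>) \<le> (R + 1) * C"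
      "norm (m \<omega>) * norm (h \<omega>) \<le> C * C"
      using o R C by (intro mult_mono; simp)+
    then show "\<bar>p \<omega> \<bullet> m \<omega>\<bar> \<le> C'" "\<bar>p \<omega> \<bullet> h \<omega>\<bar> \<le> C'" "\<bar>m \<omega> \<bullet> h \<omega>\<bar> \<le> C'"
      using Cauchy_Schwarz_ineq2[of "p \<omega>" "m \<omega>"] Cauchy_Schwarz_ineq2[of "p \<omega>" "h \<omega>"]
        Cauchy_Schwarz_ineq2[of "m \<omega>" "h \<omega>"] C' unfolding power2_eq_square by linarith+
    show "(norm (h \<omega>))\<^sup>2 \<le> C'" "(norm (m \<omega>))\<^sup>2 \<le> C'"
      using power_mono[OF o(3) norm_ge_zero, of 2] power_mono[OF o(2) norm_ge_zero, of 2] C' by linarith+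
  qed
  have Phi_le: "\<Phi> \<omega> \<le> G0 \<omega> + G1 \<omega> * ?\<xi> \<omega> + G2 \<omega> * (?\<xi> \<omega>)\<^sup>2 + K * step_error r (?\<xi> \<omega>)" if \<omega>: "\<omega> \<in> B" for \<omega>
  proof -
    define w where "w = 2 * r\<^sup>2 * (p \<omega> \<bullet> m \<omega>) + 2 * ?\<xi> \<omega> * (p \<omega> \<bullet> h \<omega>) + r ^ 4 * (norm (m \<omega>))\<^sup>2
      + 2 * r\<^sup>2 * ?\<xi> \<omega> * (m \<omega> \<bullet> h \<omega>) + (?\<xi> \<omega>)\<^sup>2 * (norm (h \<omega>))\<^sup>2"
    \<comment> \<open>The radius \<open>R\<close> is at most \<open>n\<close>, so the truncation is
      inactive on \<open>B\<close>.\<close>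
    have "truncated_noise n k \<omega> = g ?s (X ?s \<omega>)"
      using onB(8)[OF \<omega>] R by (simp add: truncated_noise_def)
    then have "P (scheme n (Suc k) \<omega>) = p \<omega> + r\<^sup>2 *\<^sub>R m \<omega> + ?\<xi> \<omega> *\<^sub>R h \<omega>"
      by (simp add: scheme_Suc P.add P.scaleR p_def m_def h_def r)
    then have "\<epsilon> + (norm (P (scheme n (Suc k) \<omega>)))\<^sup>2 = u \<omega> + w"
      unfolding u_def w_def by (simp only: expand) simp
    then have \<Phi>: "\<Phi> \<omega> = (u \<omega> + w) powr ?q" and uw: "\<epsilon> \<le> u \<omega> + w"
      by (auto simp: \<Phi>_def) (metis add_increasing2 order_refl zero_le_power2)
    show ?thesis
      unfolding \<Phi> G0_def G1_def G2_def K_eq \<theta>1_def \<theta>2_def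
      by (rule powr_step_bound[OF exponent(1,2) \<epsilon> onB(6)[OF \<omega>] uw r(1,2) C'(1) w_def inner(1,2,3)[OF \<omega>]
          _ inner(4)[OF \<omega>] _ inner(5)[OF \<omega>]]) auto
  qed
  have \<theta>_bound: "0 \<le> \<theta>1 \<omega>" "\<theta>1 \<omega> \<le> \<epsilon> powr (?q - 1)" "0 \<le> \<theta>2 \<omega>" "\<theta>2 \<omega> \<le> \<epsilon> powr (?q - 2)" if "\<omega> \<in> B" for \<omega>
  proof -
    have p1: "u \<omega> powr (?q - 1) \<le> \<epsilon> powr (?q - 1)" and p2: "u \<omega> powr (?q - 2) \<le> \<epsilon> powr (?q - 2)"
      using exponent \<epsilon> onB(6)[OF that] by (intro powr_mono2'; simp)+
    have "?q * (1 - ?q) \<le> 1 * 1"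
      using exponent by (intro mult_mono) auto
    with p1 p2 have "?q * u \<omega> powr (?q - 1) \<le> 1 * \<epsilon> powr (?q - 1)" "?q * (1 - ?q) * u \<omega> powr (?q - 2) \<le> 1 * \<epsilon> powr (?q - 2)"
      using exponent by (intro mult_mono; simp)+
    then show "0 \<le> \<theta>1 \<omega>" "\<theta>1 \<omega> \<le> \<epsilon> powr (?q - 1)" "0 \<le> \<theta>2 \<omega>" "\<theta>2 \<omega> \<le> \<epsilon> powr (?q - 2)"
      using exponent by (auto simp: \<theta>1_def \<theta>2_def)
  qed
  \<comment> \<open>Serves integrability; its size does not enter the estimate.\<close>
  define L where "L = (1 + (R + 1)\<^sup>2) powr ?q + \<epsilon> powr (?q - 1) * (4 * C') + \<epsilon> powr (?q - 1) * C' + 2 * \<epsilon> powr (?q - 2) * C'\<^sup>2"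
  have Gbound: "\<bar>G0 \<omega>\<bar> \<le> L" "\<bar>G1 \<omega>\<bar> \<le> L" "\<bar>G2 \<omega>\<bar> \<le> L" if "\<omega> \<in> B" for \<omega>
  proof -
    note \<theta> = \<theta>_bound[OF that] and i = inner[OF that]
    have up: "0 \<le> u \<omega> powr ?q" "u \<omega> powr ?q \<le> (1 + (R + 1)\<^sup>2) powr ?q"
      using onB(6,7)[OF that] exponent \<epsilon> by (auto intro!: powr_mono2)
    have r2: "0 \<le> r\<^sup>2" "r\<^sup>2 \<le> 1"
      using r by (auto simp: power_le_one)
    have "\<bar>2 * r\<^sup>2 * (p \<omega> \<bullet> m \<omega>)\<bar> \<le> 2 * (1 * C')" "\<bar>2 * r\<^sup>2 * (m \<omega> \<bullet> h \<omega>)\<bar> \<le> 2 * (1 * C')"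
      using mult_mono[OF r2(2) i(1)] mult_mono[OF r2(2) i(3)] by (auto simp: abs_mult)
    then have "\<bar>2 * r\<^sup>2 * (p \<omega> \<bullet> m \<omega>)\<bar> \<le> 4 * C'" "\<bar>2 * (p \<omega> \<bullet> h \<omega>) + 2 * r\<^sup>2 * (m \<omega> \<bullet> h \<omega>)\<bar> \<le> 4 * C'"
      using i(2) C' by linarith+
    then have a: "\<bar>\<theta>1 \<omega> * (2 * r\<^sup>2 * (p \<omega> \<bullet> m \<omega>))\<bar> \<le> \<epsilon> powr (?q - 1) * (4 * C')"
      "\<bar>\<theta>1 \<omega> * (2 * (p \<omega> \<bullet> h \<omega>) + 2 * r\<^sup>2 * (m \<omega> \<bullet> h \<omega>))\<bar> \<le> \<epsilon> powr (?q - 1) * (4 * C')"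
      unfolding abs_mult[of "\<theta>1 \<omega>"] using \<theta> by (intro mult_mono; simp)+
    have b: "0 \<le> \<theta>1 \<omega> * (norm (h \<omega>))\<^sup>2" "\<theta>1 \<omega> * (norm (h \<omega>))\<^sup>2 \<le> \<epsilon> powr (?q - 1) * C'"
      using \<theta> i by (auto intro!: mult_mono)
    have "(p \<omega> \<bullet> h \<omega>)\<^sup>2 \<le> C'\<^sup>2"
      using i(2) C' by (simp add: abs_le_square_iff[symmetric])
    then have c: "0 \<le> \<theta>2 \<omega> * (p \<omega> \<bullet> h \<omega>)\<^sup>2" "\<theta>2 \<omega> * (p \<omega> \<bullet> h \<omega>)\<^sup>2 \<le> \<epsilon> powr (?q - 2) * C'\<^sup>2"
      using \<theta> by (auto intro!: mult_mono)
    have n: "0 \<le> \<epsilon> powr (?q - 1) * (4 * C')" "0 \<le> \<epsilon> powr (?q - 1) * C'" "0 \<le> \<epsilon> powr (?q - 2) * C'\<^sup>2"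
      using C' by auto
    show "\<bar>G0 \<omega>\<bar> \<le> L"
      using up a(1) n unfolding G0_def L_def by linarith
    show "\<bar>G1 \<omega>\<bar> \<le> L"
      using up a(2) n unfolding G1_def L_def by linarith
    have "2 * \<theta>2 \<omega> * (p \<omega> \<bullet> h \<omega>)\<^sup>2 = 2 * (\<theta>2 \<omega> * (p \<omega> \<bullet> h \<omega>)\<^sup>2)" by simp
    then show "\<bar>G2 \<omega>\<bar> \<le> L"
      using up b c n unfolding G2_def L_def by linarith
  qed
  have \<Phi>meas: "\<Phi> \<in> borel_measurable M"
  proof -
    note [measurable] = Fl_measurable[OF scheme_adapted[of n "Suc k"]] borel_measurable_continuous_onI[OF linear_continuous_on[OF P_linear]]
    show ?thesis unfolding \<Phi>_def by measurable
  qed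
  have \<Phi>nonneg: "0 \<le> \<Phi> \<omega>" for \<omega>
    by (simp add: \<Phi>_def)
  note step = one_step_expectation[OF dyadic_nonneg t(1) r(1,2) K BF Gmeas Gbound \<Phi>meas \<Phi>nonneg Phi_le]
  have lyap_Suc: "lyapunov \<epsilon> n (Suc k) \<omega> = exp (rate * ?t) * \<Phi> \<omega>" for \<omega>
    by (simp add: lyapunov_def \<Phi>_def)
  have lyap: "lyapunov \<epsilon> n k \<omega> = exp (rate * ?s) * u \<omega> powr ?q" for \<omega>
    by (simp add: lyapunov_def u_def p_def)
  have swap: "indicator B \<omega> * lyapunov \<epsilon> n (Suc k) \<omega> = exp (rate * ?t) * (indicator B \<omega> * \<Phi> \<omega>)" for \<omega>
    by (simp add: lyap_Suc)
  show ?int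
    unfolding swap using step(1) by simp
  have BM: "B \<in> events"
    using BF by (rule sets_Fl)
  show int': ?int'
  proof (rule integrable_const_bound[where B = l])
    show "AE \<omega> in M. norm (indicator B \<omega> * lyapunov \<epsilon> n k \<omega>) \<le> l"
      using onB(9) lyapunov_nonneg l by (intro AE_I2) (auto simp: indicator_def less_imp_le)
    show "(\<lambda>\<omega>. indicator B \<omega> * lyapunov \<epsilon> n k \<omega>) \<in> borel_measurable M"
      using Fl_measurable[OF lyapunov_adapted] BM by (intro borel_measurable_times borel_measurable_indicator)
  qed
  let ?E = "generator_error R C \<epsilon> \<delta>"
  have E: "0 \<le> ?E"
    unfolding generator_error_def using D R C \<delta>
    by (intro add_nonneg_nonneg mult_nonneg_nonneg) auto
  have rate_le: "exp (rate * ?t) \<le> exp (rate * T)"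
    using t(2) rate_pos by simp
  have pointwise: "exp (rate * ?t) * (indicator B \<omega> * (G0 \<omega> + r\<^sup>2 * G2 \<omega>))
    \<le> indicator B \<omega> * lyapunov \<epsilon> n k \<omega> + exp (rate * T) * (r\<^sup>2 * ?E)" for \<omega>
  proof (cases "\<omega> \<in> B")
    case True
    have "?q * u \<omega> powr (?q - 1) * (2 * (p \<omega> \<bullet> m \<omega>)) + (?q * u \<omega> powr (?q - 1) * (norm (h \<omega>))\<^sup>2
        - 2 * (?q * (1 - ?q) * u \<omega> powr (?q - 2)) * (p \<omega> \<bullet> h \<omega>)\<^sup>2) \<le> - rate * u \<omega> powr ?q + ?E"
      unfolding rate_def generator_error_def u_def add.assoc[symmetric]
      using generator_bound[OF exponent(1,2) D exponent(3) less_imp_le[OF decay_pos] \<epsilon> R(1) onB(1)[OF True] _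
          onB(2)[OF True] onB(3)[OF True] onB(4)[OF True] \<delta>(2)] C
        dissipation[OF dyadic_nonneg, of "X ?s \<omega>"] noise_lower[OF dyadic_nonneg, of "X ?s \<omega>"]
      by (simp add: m_def h_def)
    then have "\<theta>1 \<omega> * (2 * (p \<omega> \<bullet> m \<omega>)) + G2 \<omega> \<le> - rate * u \<omega> powr ?q + ?E"
      by (simp add: G2_def \<theta>1_def \<theta>2_def)
    from mult_left_mono[OF this, of "r\<^sup>2"]
    have "G0 \<omega> + r\<^sup>2 * G2 \<omega> \<le> (1 - rate * r\<^sup>2) * u \<omega> powr ?q + r\<^sup>2 * ?E"
      by (simp add: G0_def algebra_simps)
    also have "(1 - rate * r\<^sup>2) * u \<omega> powr ?q \<le> exp (- (rate * r\<^sup>2)) * u \<omega> powr ?q"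
      using exp_ge_add_one_self[of "- (rate * r\<^sup>2)"] by (intro mult_right_mono) auto
    finally have "exp (rate * ?t) * (G0 \<omega> + r\<^sup>2 * G2 \<omega>)
      \<le> exp (rate * ?t) * (exp (- (rate * r\<^sup>2)) * u \<omega> powr ?q + r\<^sup>2 * ?E)"
      by (intro mult_left_mono) auto
    also have "\<dots> = exp (rate * ?s) * u \<omega> powr ?q + exp (rate * ?t) * (r\<^sup>2 * ?E)"
      by (simp add: t(1) distrib_left exp_add exp_minus)
    also have "exp (rate * ?t) * (r\<^sup>2 * ?E) \<le> exp (rate * T) * (r\<^sup>2 * ?E)"
      using rate_le E by (intro mult_right_mono) auto
    finally show ?thesis
      using True by (simp add: lyap)
  next
    case False
    then show ?thesis using E by simp
  qed
  have iG: "integrable M (\<lambda>\<omega>. indicator B \<omega> * (G0 \<omega> + r\<^sup>2 * G2 \<omega>))"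
  proof (rule integrable_const_bound[where B = "\<bar>L + r\<^sup>2 * L\<bar>"])
    have "\<bar>G0 \<omega> + r\<^sup>2 * G2 \<omega>\<bar> \<le> L + r\<^sup>2 * L" if "\<omega> \<in> B" for \<omega>
      using Gbound[OF that] mult_left_mono[OF Gbound(3)[OF that], of "r\<^sup>2"] abs_triangle_ineq[of "G0 \<omega>" "r\<^sup>2 * G2 \<omega>"]
      by (simp add: abs_mult)
    then show "AE \<omega> in M. norm (indicator B \<omega> * (G0 \<omega> + r\<^sup>2 * G2 \<omega>)) \<le> \<bar>L + r\<^sup>2 * L\<bar>"
      by (intro AE_I2) (auto simp: indicator_def intro: order_trans[OF _ abs_ge_self])
    show "(\<lambda>\<omega>. indicator B \<omega> * (G0 \<omega> + r\<^sup>2 * G2 \<omega>)) \<in> borel_measurable M"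
      using Fl_measurable[OF Gmeas(1)] Fl_measurable[OF Gmeas(3)] BM
      by (intro borel_measurable_times borel_measurable_indicator borel_measurable_add borel_measurable_const)
  qed
  have "expectation (\<lambda>\<omega>. indicator B \<omega> * lyapunov \<epsilon> n (Suc k) \<omega>)
      = exp (rate * ?t) * expectation (\<lambda>\<omega>. indicator B \<omega> * \<Phi> \<omega>)"
    unfolding swap by simp
  also have "\<dots> \<le> exp (rate * ?t) * (expectation (\<lambda>\<omega>. indicator B \<omega> * (G0 \<omega> + r\<^sup>2 * G2 \<omega>)) + 20 * K * r ^ 3)"
    using step(2) by (intro mult_left_mono) auto
  also have "\<dots> = expectation (\<lambda>\<omega>. exp (rate * ?t) * (indicator B \<omega> * (G0 \<omega> + r\<^sup>2 * G2 \<omega>))) + exp (rate * ?t) * (20 * K * r ^ 3)"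
    unfolding integral_mult_right_zero by (rule distrib_left)
  also have "expectation (\<lambda>\<omega>. exp (rate * ?t) * (indicator B \<omega> * (G0 \<omega> + r\<^sup>2 * G2 \<omega>)))
    \<le> expectation (\<lambda>\<omega>. indicator B \<omega> * lyapunov \<epsilon> n k \<omega> + exp (rate * T) * (r\<^sup>2 * ?E))"
    using iG int' pointwise by (intro integral_mono) auto
  also have "\<dots> = expectation (\<lambda>\<omega>. indicator B \<omega> * lyapunov \<epsilon> n k \<omega>) + exp (rate * T) * (r\<^sup>2 * ?E)"
    using int' by (simp add: prob_space)
  also have "exp (rate * ?t) * (20 * K * r ^ 3) \<le> exp (rate * T) * (20 * K * r ^ 3)"
    using rate_le K r by (intro mult_right_mono) auto
  finally show "expectation (\<lambda>\<omega>. indicator B \<omega> * lyapunov \<epsilon> n (Suc k) \<omega>)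
      \<le> expectation (\<lambda>\<omega>. indicator B \<omega> * lyapunov \<epsilon> n k \<omega>)
        + exp (rate * T) * (r\<^sup>2 * ?E + 20 * discretisation_error R C \<epsilon> * r ^ 3)"
    by (simp add: K_def algebra_simps)
qed

text \<open>Markov's inequality for the stopped process \<open>U\<close>. While the solution stays
  in the ball and close to the scheme, only reaching the level \<open>l\<close> can stop
  \<open>U\<close>. As \<delta>^2 \<le> \<epsilon>, the squared norm for the solution is at most
  twice the shifted squared norm for the scheme, hence the threshold \<open>2 * l\<close>.\<close>

lemma exceedance_probability:
  "prob {\<omega> \<in> space M. norm (X 0 \<omega>) \<le> R0 \<and>
      (\<forall>j\<in>{..T * 2 ^ n}. norm (X (dyadic n j) \<omega>) \<le> R \<and> norm (scheme n j \<omega> - X (dyadic n j) \<omega>) \<le> \<delta>) \<and>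
      (\<exists>k\<in>{..T * 2 ^ n}. 2 * l < exp (rate * dyadic n k) * ((norm (P (X (dyadic n k) \<omega>)))\<^sup>2) powr exponent)}
    \<le> ((1 + R0\<^sup>2) powr exponent
      + exp (rate * T) * T * (generator_error R C \<epsilon> \<delta> + 20 * discretisation_error R C \<epsilon> * sqrt (1 / 2 ^ n))) / l"
  (is "prob ?bad \<le> (?c0 + _ * _ * (?E + 20 * ?K * ?r)) / l")
proof -
  interpret P: bounded_linear P by (rule P_linear)
  let ?N = "T * 2 ^ n" and ?Z = "lyapunov \<epsilon> n" and ?A = "alive R0 R \<epsilon> \<delta> l n" and ?q = exponent
  define B where "B = {\<omega> \<in> space M. norm (X 0 \<omega>) \<le> R0}"
  \<comment> \<open>The increments are multiplied out, because
    \<open>lyapunov \<epsilon> n (Suc j)\<close> is known to be integrable only together with the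
    indicator of \<open>alive\<close> at \<open>j\<close>.\<close>
  define U where "U k \<omega> = indicator B \<omega> * ?Z 0 \<omega>
    + (\<Sum>j<k. indicator (?A j) \<omega> * ?Z (Suc j) \<omega> - indicator (?A j) \<omega> * ?Z j \<omega>)" for k \<omega>
  have [measurable]: "X 0 \<in> borel_measurable M"
    by (rule X_measurable) simp
  have B: "B \<in> events"
    unfolding B_def by measurable
  have Z0: "indicator B \<omega> * ?Z 0 \<omega> \<le> ?c0" for \<omega>
  proof (cases "\<omega> \<in> B")
    case True
    then have "norm (P (X 0 \<omega>)) \<le> R0"
      using norm_P order_trans by (auto simp: B_def)
    from power_mono[OF this norm_ge_zero, of 2]
    have "(\<epsilon> + (norm (P (X 0 \<omega>)))\<^sup>2) powr ?q \<le> (1 + R0\<^sup>2) powr ?q"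
      using exponent \<epsilon> by (intro powr_mono2) auto
    then show ?thesis
      using True by (simp add: lyapunov_def scheme_0)
  qed simp
  have int0: "integrable M (\<lambda>\<omega>. indicator B \<omega> * ?Z 0 \<omega>)"
    using Z0 lyapunov_nonneg Fl_measurable[OF lyapunov_adapted] B
    by (intro integrable_const_bound[where B = ?c0] AE_I2 borel_measurable_times borel_measurable_indicator) auto
  have U: "integrable M (U k) \<and> expectation (U k) \<le> ?c0 + real k * (exp (rate * T) * (?r\<^sup>2 * ?E + 20 * ?K * ?r ^ 3))"
    if "k \<le> ?N" for k
    using that
  proof (induction k)
    case 0
    have "expectation (\<lambda>\<omega>. indicator B \<omega> * ?Z 0 \<omega>) \<le> expectation (\<lambda>_. ?c0)"
      using int0 Z0 by (intro integral_mono) auto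
    then show ?case
      using int0 by (simp add: U_def[abs_def] prob_space)
  next
    case (Suc k)
    then have k: "k < ?N" by simp
    note step = lyapunov_step[OF k]
    have eq: "U (Suc k) \<omega> = U k \<omega> + (indicator (?A k) \<omega> * ?Z (Suc k) \<omega> - indicator (?A k) \<omega> * ?Z k \<omega>)" for \<omega>
      by (simp add: U_def)
    have "expectation (U (Suc k)) = expectation (U k)
      + (expectation (\<lambda>\<omega>. indicator (?A k) \<omega> * ?Z (Suc k) \<omega>) - expectation (\<lambda>\<omega>. indicator (?A k) \<omega> * ?Z k \<omega>))"
      unfolding eq using Suc step by simp
    also have "\<dots> \<le> ?c0 + real k * (exp (rate * T) * (?r\<^sup>2 * ?E + 20 * ?K * ?r ^ 3))
        + exp (rate * T) * (?r\<^sup>2 * ?E + 20 * ?K * ?r ^ 3)"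
      using Suc step(3) by simp
    finally have "expectation (U (Suc k)) \<le> ?c0 + real (Suc k) * (exp (rate * T) * (?r\<^sup>2 * ?E + 20 * ?K * ?r ^ 3))"
      unfolding of_nat_Suc distrib_right mult_1_left by linarith
    moreover have "integrable M (U (Suc k))"
      unfolding eq using Suc step by simp
    ultimately show ?case by blast
  qed
  have stop: "(\<exists>i\<le>?N. U ?N \<omega> = ?Z i \<omega> \<and> (\<forall>j<i. \<omega> \<in> ?A j) \<and> (i < ?N \<longrightarrow> \<omega> \<notin> ?A i))" if "\<omega> \<in> B" for \<omega>
  proof -
    have eq: "U ?N \<omega> = ?Z 0 \<omega> + (\<Sum>j<?N. of_bool (\<omega> \<in> ?A j) * (?Z (Suc j) \<omega> - ?Z j \<omega>))"
      using that by (simp add: U_def indicator_def of_bool_def right_diff_distrib)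
    show ?thesis
      unfolding eq by (rule stopped_sum_eq) (rule alive_antimono)
  qed
  have nonneg: "0 \<le> U ?N \<omega>" for \<omega>
  proof (cases "\<omega> \<in> B")
    case True
    then show ?thesis using stop lyapunov_nonneg by metis
  next
    case False
    have "\<omega> \<notin> ?A j" for j
      using False by (auto simp: B_def alive_def)
    then show ?thesis using False by (simp add: U_def)
  qed
  have "prob ?bad \<le> prob {\<omega> \<in> space M. U ?N \<omega> \<ge> l}"
  proof (rule finite_measure_mono)
    have "U ?N \<in> borel_measurable M"
      using U[of ?N] by auto
    then show "{\<omega> \<in> space M. U ?N \<omega> \<ge> l} \<in> events"
      by measurable
    show "?bad \<subseteq> {\<omega> \<in> space M. U ?N \<omega> \<ge> l}"
    proof
      fix \<omega> assume "\<omega> \<in> ?bad"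
      then obtain k where \<omega>: "\<omega> \<in> B" "\<omega> \<in> space M" and k: "k \<le> ?N"
        "2 * l < exp (rate * dyadic n k) * ((norm (P (X (dyadic n k) \<omega>)))\<^sup>2) powr ?q"
        and good: "\<And>j. j \<le> ?N \<Longrightarrow> norm (X (dyadic n j) \<omega>) \<le> R"
          "\<And>j. j \<le> ?N \<Longrightarrow> norm (scheme n j \<omega> - X (dyadic n j) \<omega>) \<le> \<delta>"
        by (auto simp: B_def)
      have Zk: "l \<le> ?Z k \<omega>"
      proof -
        let ?e = "P (X (dyadic n k) \<omega>)" and ?p = "P (scheme n k \<omega>)"
        have "norm (?p - ?e) \<le> \<delta>"
          using norm_P[of "scheme n k \<omega> - X (dyadic n k) \<omega>"] good(2)[OF k(1)] by (simp add: P.diff)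
        then have "norm ?e \<le> norm ?p + \<delta>"
          using norm_triangle_sub[of ?e ?p] by (simp add: norm_minus_commute)
        then have "(norm ?e)\<^sup>2 \<le> (norm ?p + \<delta>)\<^sup>2"
          by (intro power_mono) auto
        also have "\<dots> \<le> 2 * (norm ?p)\<^sup>2 + 2 * \<delta>\<^sup>2"
          using sum_squares_bound[of "norm ?p" \<delta>] by (simp add: power2_sum)
        also have "\<dots> \<le> 2 * (\<epsilon> + (norm ?p)\<^sup>2)"
          using \<delta> by simp
        finally have "((norm ?e)\<^sup>2) powr ?q \<le> (2 * (\<epsilon> + (norm ?p)\<^sup>2)) powr ?q"
          using exponent by (intro powr_mono2) auto
        also have "\<dots> = 2 powr ?q * (\<epsilon> + (norm ?p)\<^sup>2) powr ?q"
          by (rule powr_mult)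
        also have "\<dots> \<le> 2 powr 1 * (\<epsilon> + (norm ?p)\<^sup>2) powr ?q"
          using exponent by (intro mult_right_mono powr_mono) auto
        finally have "exp (rate * dyadic n k) * ((norm ?e)\<^sup>2) powr ?q
          \<le> exp (rate * dyadic n k) * (2 powr 1 * (\<epsilon> + (norm ?p)\<^sup>2) powr ?q)"
          by (intro mult_left_mono) auto
        moreover have "exp (rate * dyadic n k) * (2 powr 1 * (\<epsilon> + (norm ?p)\<^sup>2) powr ?q) = 2 * ?Z k \<omega>"
          by (simp add: lyapunov_def)
        ultimately show ?thesis
          using k(2) by linarith
      qed
      obtain i where i: "i \<le> ?N" "U ?N \<omega> = ?Z i \<omega>" "\<forall>j<i. \<omega> \<in> ?A j" "i < ?N \<longrightarrow> \<omega> \<notin> ?A i"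
        using stop[OF \<omega>(1)] by auto
      have below: "?Z j \<omega> < l" if "j < i" for j
        using i(3) that by (auto simp: alive_def)
      have "l \<le> ?Z i \<omega>"
      proof (cases "i < ?N")
        case True
        \<comment> \<open>The other conditions in \<open>alive\<close> hold on the event considered,
          so the level has been reached; by \<open>below\<close> this happens at \<open>i\<close>
          and not earlier.\<close>
        have "\<exists>j\<le>i. l \<le> ?Z j \<omega>"
          using i(4) True good \<omega> by (force simp: alive_def B_def not_less)
        then show ?thesis
          using below by (metis le_neq_implies_less not_le)
      next
        case False
        then show ?thesis
          using Zk below[of k] k(1) i(1) by (cases "k = i") auto
      qed
      then show "\<omega> \<in> {\<omega> \<in> space M. U ?N \<omega> \<ge> l}"
        using i \<omega> by simp
    qed
  qed
  also have "\<dots> \<le> expectation (U ?N) / l"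
    using U[of ?N] nonneg l
    by (intro integral_Markov_inequality_measure[where A = "space M"]) auto
  also have "\<dots> \<le> (?c0 + real ?N * (exp (rate * T) * (?r\<^sup>2 * ?E + 20 * ?K * ?r ^ 3))) / l"
    using U[of ?N] l by (intro divide_right_mono) auto
  \<comment> \<open>There are T * 2^n steps of length r^2 = 1 / 2^n: the generator error adds up to
    a multiple of \<open>T\<close>, while the discretisation error keeps one factor r.\<close>
  also have "real ?N * (exp (rate * T) * (?r\<^sup>2 * ?E + 20 * ?K * ?r ^ 3)) = exp (rate * T) * T * (?E + 20 * ?K * ?r)"
  proof -
    have r3: "?r ^ 3 = ?r\<^sup>2 * ?r"
      by (simp add: power2_eq_square power3_eq_cube)
    have r2: "real ?N * ?r\<^sup>2 = T"
      by simp
    have "real ?N * (exp (rate * T) * (?r\<^sup>2 * ?E + 20 * ?K * ?r ^ 3))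
      = exp (rate * T) * (real ?N * ?r\<^sup>2) * (?E + 20 * ?K * ?r)"
      unfolding r3 by (simp only: algebra_simps)
    then show ?thesis
      unfolding r2 .
  qed
  finally show ?thesis .
qed

end

end

section \<open>Almost sure exponential stability\<close>

text \<open>Level and horizon are both \<open>n\<close>, so these grids exhaust the dyadic times;
  rounding \<open>t\<close> down at each level gives grid points that converge to
  \<open>t\<close>.\<close>

lemma dyadic_dense_closed:
  assumes cont: "continuous_on {0..} \<phi>" and S: "closed S"
    and dy: "\<And>n k. k \<le> n * 2 ^ n \<Longrightarrow> \<phi> (dyadic n k) \<in> S" and t: "0 \<le> t"
  shows "\<phi> t \<in> S"
proof -
  define k where "k n = nat \<lfloor>t * 2 ^ n\<rfloor>" for n
  have k: "real (k n) \<le> t * 2 ^ n" "t * 2 ^ n < real (k n) + 1" for n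
    using t floor_correct[of "t * 2 ^ n"] by (auto simp: k_def of_nat_nat)
  have d: "dyadic n (k n) \<le> t" "t \<le> dyadic n (k n) + (1 / 2) ^ n" for n
    using k[of n] by (auto simp: dyadic_def divide_le_eq power_one_over field_simps)
  have "(\<lambda>n. dyadic n (k n)) \<longlonglongrightarrow> t"
  proof (rule tendsto_sandwich)
    show "(\<lambda>n. t - (1 / 2) ^ n) \<longlonglongrightarrow> t"
      using tendsto_diff[OF tendsto_const[of t] LIMSEQ_power_zero[of "1 / 2 :: real"]] by simp
    show "\<forall>\<^sub>F n in sequentially. t - (1 / 2) ^ n \<le> dyadic n (k n)"
      using d(2) by (intro always_eventually allI) (simp add: algebra_simps)
    show "\<forall>\<^sub>F n in sequentially. dyadic n (k n) \<le> t"
      using d(1) by (intro always_eventually allI)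
  qed (rule tendsto_const)
  then have lim: "(\<lambda>n. \<phi> (dyadic n (k n))) \<longlonglongrightarrow> \<phi> t"
    using t by (intro continuous_on_tendsto_compose[OF cont]) auto
  obtain n0 :: nat where n0: "t \<le> real n0"
    using real_arch_simple by blast
  have "\<forall>\<^sub>F n in sequentially. \<phi> (dyadic n (k n)) \<in> S"
    using eventually_ge_at_top[of n0]
  proof eventually_elim
    case (elim n)
    have "real (k n) \<le> real n * 2 ^ n"
      using k(1)[of n] n0 elim by (meson mult_right_mono of_nat_mono order_trans zero_le_numeral zero_le_power)
    then have "real (k n) \<le> real (n * 2 ^ n)"
      by simp
    then show ?case
      by (intro dy) (simp only: of_nat_le_iff)
  qed
  with S lim show ?thesis
    by (intro Lim_in_closed_set[of S _ sequentially]) auto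
qed

section \<open>Removal of the localisation\<close>

context stable_sde
begin

lemma coefficients_bounded:
  obtains C where "1 \<le> C" "\<And>t x. t \<in> {0..real T} \<Longrightarrow> norm x \<le> R \<Longrightarrow> norm (\<mu> t x) \<le> C \<and> norm (g t x) \<le> C"
proof -
  have "\<exists>C. \<forall>t\<in>{0..real T}. \<forall>x. norm x \<le> R \<longrightarrow> norm (h t x) \<le> C"
    if h: "continuous_on ({0..} \<times> UNIV) (\<lambda>(t, x). h t x)" for h :: "real \<Rightarrow> 'a \<Rightarrow> 'a"
  proof -
    have "compact ((\<lambda>(t, x). h t x) ` ({0..real T} \<times> cball 0 R))"
      by (intro compact_continuous_image continuous_on_subset[OF h] compact_Times) auto
    then have "bounded ((\<lambda>(t, x). h t x) ` ({0..real T} \<times> cball 0 R))"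
      by (rule compact_imp_bounded)
    then obtain C where "\<forall>y\<in>(\<lambda>(t, x). h t x) ` ({0..real T} \<times> cball 0 R). norm y \<le> C"
      unfolding bounded_iff by blast
    then show ?thesis
      by (intro exI[of _ C]) auto
  qed
  from this[OF cont_\<mu>] this[OF cont_g] obtain C1 C2 where
    "\<And>t x. t \<in> {0..real T} \<Longrightarrow> norm x \<le> R \<Longrightarrow> norm (\<mu> t x) \<le> C1"
    "\<And>t x. t \<in> {0..real T} \<Longrightarrow> norm x \<le> R \<Longrightarrow> norm (g t x) \<le> C2"
    by blast
  then show ?thesis
    by (intro that[of "max 1 (max C1 C2)"]) (auto simp: le_max_iff_disj)
qed

text \<open>Continuous paths are bounded on \<open>{0..T}\<close>. The event unites all levels
  \<open>n\<close>, so that the radius can be fixed before the mesh.\<close>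

lemma prob_leave_ball_tendsto:
  "(\<lambda>R. prob {\<omega> \<in> space M. \<exists>n. \<exists>k\<in>{..T * 2 ^ n}. norm (X (dyadic n k) \<omega>) > real R}) \<longlonglongrightarrow> 0"
proof (rule prob_tendsto_zero_if_AE_eventually)
  fix R :: nat
  show "{\<omega> \<in> space M. \<exists>n. \<exists>k\<in>{..T * 2 ^ n}. norm (X (dyadic n k) \<omega>) > real R} \<in> events"
    by (intro sets.sets_Collect_countable_Ex norm_exceeds_events X_measurable) simp_all
next
  show "AE \<omega> in M. \<forall>\<^sub>F R in sequentially. \<omega> \<notin> {\<omega> \<in> space M. \<exists>n. \<exists>k\<in>{..T * 2 ^ n}. norm (X (dyadic n k) \<omega>) > real R}"
    using AE_space
  proof eventually_elim
    case (elim \<omega>)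
    obtain R :: nat where R: "\<And>t. t \<in> {0..real T} \<Longrightarrow> norm (X t \<omega>) \<le> real R"
      using path_bounded[OF elim] by blast
    show ?case
      using eventually_ge_at_top[of R]
    proof eventually_elim
      case (elim R')
      have "norm (X (dyadic n k) \<omega>) \<le> real R'" if "k \<le> T * 2 ^ n" for n k
        using R[of "dyadic n k"] dyadic_le_of_nat[OF that] elim by simp
      then show ?case
        by (auto simp: not_less)
    qed
  qed
qed

text \<open>The coefficient of \<delta> contains the factor
  \<open>\<epsilon> powr (exponent - 2)\<close>, which may blow up as \<epsilon> shrinks; so
  \<epsilon> is fixed through the first term and \<delta> is chosen afterwards. Each term is brought
  below 1 / 4.\<close>

lemma generator_error_small:
  assumes "0 \<le> R" "0 \<le> C" "0 \<le> W"
  obtains \<epsilon> \<delta> where "0 < \<epsilon>" "\<epsilon> \<le> 1" "0 < \<delta>" "\<delta> \<le> 1" "\<delta>\<^sup>2 \<le> \<epsilon>" "W * generator_error R C \<epsilon> \<delta> \<le> 1 / 2"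
proof -
  define a where "a = W * (\<bar>A\<bar> + 4 * D)"
  have a: "0 \<le> a" using assms D by (simp add: a_def)
  define \<epsilon> where "\<epsilon> = min 1 ((1 / (4 * (a + 1))) powr (1 / exponent))"
  have \<epsilon>: "0 < \<epsilon>" "\<epsilon> \<le> 1"
    using a by (auto simp: \<epsilon>_def)
  have "\<epsilon> powr exponent \<le> ((1 / (4 * (a + 1))) powr (1 / exponent)) powr exponent"
    using exponent \<epsilon> by (intro powr_mono2) (auto simp: \<epsilon>_def)
  also have "\<dots> = 1 / (4 * (a + 1))"
    using exponent a by (simp add: powr_powr)
  finally have "a * \<epsilon> powr exponent \<le> a * (1 / (4 * (a + 1)))"
    using a by (rule mult_left_mono)
  also have "\<dots> \<le> 1 / 4"
    using a by (simp add: divide_le_eq)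
  finally have 1: "a * \<epsilon> powr exponent \<le> 1 / 4" .
  define c where "c = W * (((\<bar>A\<bar> * (2 * R + 1) + 2 * C) * (1 + (R + 1)\<^sup>2)
      + 2 * ((2 * R + 1) * C\<^sup>2 + D * ((2 * R + 1) * (R\<^sup>2 + (R + 1)\<^sup>2)))) * \<epsilon> powr (exponent - 2))"
  have c: "0 \<le> c"
    unfolding c_def using assms D by (intro add_nonneg_nonneg mult_nonneg_nonneg) auto
  define \<delta> where "\<delta> = min \<epsilon> (1 / (4 * (c + 1)))"
  have \<delta>: "0 < \<delta>" "\<delta> \<le> \<epsilon>"
    using c \<epsilon> by (auto simp: \<delta>_def)
  have "\<delta>\<^sup>2 \<le> \<delta>"
    using \<delta> \<epsilon> by (simp add: power2_eq_square mult_left_le_one_le)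
  have "c * \<delta> \<le> c * (1 / (4 * (c + 1)))"
    using c by (intro mult_left_mono) (auto simp: \<delta>_def)
  also have "\<dots> \<le> 1 / 4"
    using c by (simp add: divide_le_eq)
  finally have 2: "c * \<delta> \<le> 1 / 4" .
  have "W * generator_error R C \<epsilon> \<delta> = a * \<epsilon> powr exponent + c * \<delta>"
    by (simp only: generator_error_def a_def c_def distrib_left mult_ac)
  with 1 2 \<epsilon> \<delta> \<open>\<delta>\<^sup>2 \<le> \<delta>\<close> show ?thesis
    by (intro that[of \<epsilon> \<delta>]) auto
qed

text \<open>The event is that of \<open>exceedance_probability\<close> on a finer grid, up to two
  events of probability below \<eta> / 2: the solution leaves the ball, or the scheme departs from
  the solution by more than \<delta>. The two error terms are at most 1 / 2 each, which gives the
  summand 1. The bound is free of \<open>T\<close> and \<open>m\<close>.\<close>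

lemma lyapunov_maximal_inequality:
  assumes l: "0 < l"
  shows "prob {\<omega> \<in> space M. norm (X 0 \<omega>) \<le> R0 \<and>
      (\<exists>k\<in>{..T * 2 ^ m}. 2 * l < exp (rate * dyadic m k) * ((norm (P (X (dyadic m k) \<omega>)))\<^sup>2) powr exponent)}
    \<le> ((1 + R0\<^sup>2) powr exponent + 1) / l" (is "prob ?S \<le> ?c")
proof (rule field_le_epsilon)
  fix \<eta> :: real assume \<eta>: "0 < \<eta>"
  have "\<forall>\<^sub>F R in sequentially. prob {\<omega> \<in> space M. \<exists>n. \<exists>k\<in>{..T * 2 ^ n}. norm (X (dyadic n k) \<omega>) > real R} < \<eta> / 2"
    using prob_leave_ball_tendsto[of T] \<eta> by (intro order_tendstoD) auto
  then obtain R :: nat where R: "prob {\<omega> \<in> space M. \<exists>n. \<exists>k\<in>{..T * 2 ^ n}. norm (X (dyadic n k) \<omega>) > real R} < \<eta> / 2"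
    by (auto simp: eventually_sequentially)
  obtain C where C: "1 \<le> C" "\<And>t x. t \<in> {0..real T} \<Longrightarrow> norm x \<le> real R \<Longrightarrow> norm (\<mu> t x) \<le> C \<and> norm (g t x) \<le> C"
    using coefficients_bounded[of T "real R"] by blast
  let ?W = "exp (rate * T) * T"
  obtain \<epsilon> \<delta> where ed: "0 < \<epsilon>" "\<epsilon> \<le> 1" "0 < \<delta>" "\<delta> \<le> 1" "\<delta>\<^sup>2 \<le> \<epsilon>" "?W * generator_error R C \<epsilon> \<delta> \<le> 1 / 2"
    using generator_error_small[of "real R" C ?W] C(1) by auto
  define F where "F n = {\<omega> \<in> space M. \<exists>k\<in>{..T * 2 ^ n}. norm (scheme n k \<omega> - X (dyadic n k) \<omega>) > \<delta>}" for n
  have "\<forall>\<^sub>F n in sequentially. prob (F n) < \<eta> / 2"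
    unfolding F_def using scheme_tendsto[OF ed(3), of T] \<eta> by (intro order_tendstoD) auto
  moreover have "(\<lambda>n. ?W * (20 * discretisation_error R C \<epsilon> * sqrt ((1 / 2) ^ n))) \<longlonglongrightarrow> ?W * (20 * discretisation_error R C \<epsilon> * sqrt 0)"
    by (intro tendsto_intros LIMSEQ_power_zero) auto
  then have "\<forall>\<^sub>F n in sequentially. ?W * (20 * discretisation_error R C \<epsilon> * sqrt ((1 / 2) ^ n)) < 1 / 2"
    by (intro order_tendstoD) auto
  moreover have "\<forall>\<^sub>F n in sequentially. max R m \<le> n"
    by (rule eventually_ge_at_top)
  ultimately have "\<forall>\<^sub>F n in sequentially. prob (F n) < \<eta> / 2 \<and> max R m \<le> n
      \<and> ?W * (20 * discretisation_error R C \<epsilon> * sqrt ((1 / 2) ^ n)) < 1 / 2"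
    by eventually_elim simp
  then obtain n where n: "prob (F n) < \<eta> / 2" "R \<le> n" "m \<le> n"
    "?W * (20 * discretisation_error R C \<epsilon> * sqrt (1 / 2 ^ n)) < 1 / 2"
    by (auto simp: eventually_sequentially power_one_over)
  define G where "G = {\<omega> \<in> space M. \<exists>n. \<exists>k\<in>{..T * 2 ^ n}. norm (X (dyadic n k) \<omega>) > real R}"
  define H where "H = {\<omega> \<in> space M. norm (X 0 \<omega>) \<le> R0 \<and>
      (\<forall>j\<in>{..T * 2 ^ n}. norm (X (dyadic n j) \<omega>) \<le> real R \<and> norm (scheme n j \<omega> - X (dyadic n j) \<omega>) \<le> \<delta>) \<and>
      (\<exists>k\<in>{..T * 2 ^ n}. 2 * l < exp (rate * dyadic n k) * ((norm (P (X (dyadic n k) \<omega>)))\<^sup>2) powr exponent)}"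
  have X0 [measurable]: "X 0 \<in> borel_measurable M"
    by (rule X_measurable) simp
  note Pm [measurable] = borel_measurable_continuous_onI[OF linear_continuous_on[OF P_linear]]
  have G_events: "G \<in> events"
    unfolding G_def by (intro sets.sets_Collect_countable_Ex norm_exceeds_events X_measurable) simp_all
  have F_events: "F n \<in> events"
    unfolding F_def
    by (intro norm_exceeds_events borel_measurable_diff X_measurable Fl_measurable[OF scheme_adapted]) simp_all
  have H_events: "H \<in> events"
    unfolding H_def
  proof (intro sets.sets_Collect_conj sets.sets_Collect_finite_Ex sets.sets_Collect_finite_All' finite_atMost)
    show "{\<omega> \<in> space M. norm (X 0 \<omega>) \<le> R0} \<in> events" by measurable
    fix k
    note [measurable] = X_measurable[OF dyadic_nonneg[of n k]] Fl_measurable[OF scheme_adapted[of n k]]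
    show "{\<omega> \<in> space M. norm (scheme n k \<omega> - X (dyadic n k) \<omega>) \<le> \<delta>} \<in> events" by measurable
    show "{\<omega> \<in> space M. norm (X (dyadic n k) \<omega>) \<le> real R} \<in> events" by measurable
    show "{\<omega> \<in> space M. 2 * l < exp (rate * dyadic n k) * ((norm (P (X (dyadic n k) \<omega>)))\<^sup>2) powr exponent} \<in> events" by measurable
  qed auto
  have "prob ?S \<le> prob (H \<union> (F n \<union> G))"
  proof (intro finite_measure_mono sets.Un H_events F_events G_events subsetI)
    fix \<omega> assume "\<omega> \<in> ?S"
    then obtain k where \<omega>: "\<omega> \<in> space M" "norm (X 0 \<omega>) \<le> R0" and k: "k \<le> T * 2 ^ m"
      "2 * l < exp (rate * dyadic m k) * ((norm (P (X (dyadic m k) \<omega>)))\<^sup>2) powr exponent"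
      by auto
    \<comment> \<open>The grid of level \<open>m\<close> is part of the finer grid of level
      \<open>n\<close>.\<close>
    have eq: "dyadic m k = dyadic n (k * 2 ^ (n - m))"
      using dyadic_refine[of m k "n - m"] n(3) by simp
    have "k * 2 ^ (n - m) \<le> T * 2 ^ m * 2 ^ (n - m)"
      using k(1) by (rule mult_right_mono) simp
    also have "\<dots> = T * 2 ^ n"
      using n(3) by (simp flip: power_add)
    finally have "\<exists>k\<in>{..T * 2 ^ n}. 2 * l < exp (rate * dyadic n k) * ((norm (P (X (dyadic n k) \<omega>)))\<^sup>2) powr exponent"
      using k(2) unfolding eq by blast
    then have "\<omega> \<in> H" if "\<omega> \<notin> F n" "\<omega> \<notin> G"
      using \<omega> that unfolding H_def F_def G_def by (auto simp: not_less)
    then show "\<omega> \<in> H \<union> (F n \<union> G)"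
      by blast
  qed
  also have "\<dots> \<le> prob H + (prob (F n) + prob G)"
    by (intro order_trans[OF measure_Un_le] add_left_mono measure_Un_le sets.Un H_events F_events G_events)
  also have "prob H \<le> ((1 + R0\<^sup>2) powr exponent
      + ?W * (generator_error R C \<epsilon> \<delta> + 20 * discretisation_error R C \<epsilon> * sqrt (1 / 2 ^ n))) / l"
    unfolding H_def using n(2) C ed l by (intro exceedance_probability) auto
  also have "\<dots> \<le> ?c"
    using ed(6) n(4) l by (intro divide_right_mono) (simp_all add: distrib_left)
  finally show "prob ?S \<le> ?c + \<eta>"
    using n(1) R by (simp add: G_def)
qed

text \<open>For initial values in a fixed ball, the supremum over all dyadic times exceeds
  \<open>2 * l\<close> with probability at most a constant over \<open>l\<close>. So it is almost
  surely finite; countably many balls cover all initial values, and continuity reaches the other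
  times.\<close>

theorem exponential_stability:
  "AE \<omega> in M. \<exists>\<Lambda>. \<forall>t\<ge>0. exp (rate * t) * ((norm (P (X t \<omega>)))\<^sup>2) powr exponent \<le> \<Lambda>"
proof -
  let ?\<phi> = "\<lambda>t \<omega>. exp (rate * t) * ((norm (P (X t \<omega>)))\<^sup>2) powr exponent"
  \<comment> \<open>Mesh and horizon are refined together, which makes these events increase with
    \<open>n\<close>.\<close>
  define S where "S R l n = {\<omega> \<in> space M. norm (X 0 \<omega>) \<le> R \<and> (\<exists>k\<in>{..n * 2 ^ n}. 2 * l < ?\<phi> (dyadic n k) \<omega>)}" for R l and n :: nat
  have S_events: "S R l n \<in> events" for R l n
    unfolding S_def
  proof (intro sets.sets_Collect_conj sets.sets_Collect_finite_Ex finite_atMost)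
    note [measurable] = X_measurable[OF order_refl] borel_measurable_continuous_onI[OF linear_continuous_on[OF P_linear]]
    show "{\<omega> \<in> space M. norm (X 0 \<omega>) \<le> R} \<in> events" by measurable
    fix k
    note [measurable] = X_measurable[OF dyadic_nonneg[of n k]]
    show "{\<omega> \<in> space M. 2 * l < ?\<phi> (dyadic n k) \<omega>} \<in> events" by measurable
  qed
  have S_incseq: "incseq (S R l)" for R l
  proof (rule incseq_SucI, rule subsetI)
    fix n \<omega> assume "\<omega> \<in> S R l n"
    then obtain k where k: "\<omega> \<in> space M" "norm (X 0 \<omega>) \<le> R" "k \<le> n * 2 ^ n" "2 * l < ?\<phi> (dyadic n k) \<omega>"
      by (auto simp: S_def)
    have eq: "dyadic n k = dyadic (Suc n) (k * 2)"
      using dyadic_refine[of n k 1] by simp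
    have "k * 2 \<le> Suc n * 2 ^ Suc n"
      using k(3) by simp
    with k show "\<omega> \<in> S R l (Suc n)"
      unfolding S_def eq by blast
  qed
  have union: "prob (\<Union>n. S R l n) \<le> ((1 + R\<^sup>2) powr exponent + 1) / l" if "0 < l" for R l
  proof (rule LIMSEQ_le_const2)
    show "(\<lambda>n. prob (S R l n)) \<longlonglongrightarrow> prob (\<Union>n. S R l n)"
      using S_events S_incseq by (intro finite_Lim_measure_incseq) auto
    show "\<exists>N. \<forall>n\<ge>N. prob (S R l n) \<le> ((1 + R\<^sup>2) powr exponent + 1) / l"
      unfolding S_def using lyapunov_maximal_inequality[OF that] by blast
  qed
  have AE_R: "AE \<omega> in M. \<exists>l::nat. \<forall>n. \<omega> \<notin> S (real R) (real (Suc l)) n" for R :: nat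
  proof -
    \<comment> \<open>The paths that start in the ball and have infinite supremum over the dyadic
      times.\<close>
    define B where "B = (\<Inter>l::nat. \<Union>n. S (real R) (real (Suc l)) n)"
    have B: "B \<in> events"
      unfolding B_def using S_events by (intro sets.countable_INT' sets.countable_UN) auto
    let ?c = "(1 + (real R)\<^sup>2) powr exponent + 1"
    have "prob B \<le> ?c * inverse (real (Suc l))" for l
    proof -
      have "prob B \<le> prob (\<Union>n. S (real R) (real (Suc l)) n)"
        unfolding B_def using S_events by (intro finite_measure_mono sets.countable_UN) auto
      also have "\<dots> \<le> ?c / real (Suc l)"
        by (rule union) simp
      finally show ?thesis
        by (simp add: divide_inverse)
    qed
    moreover have "(\<lambda>l. ?c * inverse (real (Suc l))) \<longlonglongrightarrow> ?c * 0"
      by (intro tendsto_mult tendsto_const LIMSEQ_inverse_real_of_nat)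
    ultimately have "prob B \<le> ?c * 0"
      by (intro LIMSEQ_le_const) auto
    then have "prob B = 0"
      by (simp add: measure_le_0_iff)
    then have "AE \<omega> in M. \<omega> \<notin> B"
      using B by (simp add: prob_eq_0)
    then show ?thesis
      by eventually_elim (auto simp: B_def)
  qed
  then have "AE \<omega> in M. \<forall>R::nat. \<exists>l::nat. \<forall>n. \<omega> \<notin> S (real R) (real (Suc l)) n"
    by (simp add: AE_all_countable)
  then show ?thesis
    using AE_space
  proof eventually_elim
    case (elim \<omega>)
    obtain R :: nat where R: "norm (X 0 \<omega>) \<le> real R"
      using real_arch_simple by blast
    obtain l :: nat where l: "\<And>n. \<omega> \<notin> S (real R) (real (Suc l)) n"
      using elim(1) by blast
    have le: "?\<phi> (dyadic n k) \<omega> \<le> 2 * real (Suc l)" if "k \<le> n * 2 ^ n" for n k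
      using l[of n] R elim(2) that by (auto simp: S_def not_less)
    have "continuous_on {0..} (\<lambda>t. P (X t \<omega>))"
      by (rule continuous_on_compose2[OF linear_continuous_on[OF P_linear] X_continuous[OF elim(2)]]) auto
    \<comment> \<open>A positive exponent keeps the power continuous where
      \<open>P (X t \<omega>)\<close> vanishes.\<close>
    then have "continuous_on {0..} (\<lambda>t. ?\<phi> t \<omega>)"
      using exponent by (intro continuous_intros continuous_on_powr') auto
    from dyadic_dense_closed[OF this closed_atMost]
    have "?\<phi> t \<omega> \<in> {..2 * real (Suc l)}" if "0 \<le> t" for t
      using that le atMost_iff by blast
    then show ?case
      unfolding atMost_iff by blast
  qed
qed

end

section \<open>From exponential decay to the logarithmic rate\<close>

text \<open>Taking logarithms gives \<gamma> + 2 q ln (y t) / t \<le> ln K / t; once the right side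
  is below \<gamma> / 2, the quotient ln (y t) / t is at most - \<gamma> / (4 q). Times with
  \<open>y t = 0\<close> contribute -\<infinity>.\<close>

lemma Limsup_elog_neg:
  assumes \<gamma>: "\<gamma> > 0" and q: "q > 0" and y: "\<And>t. 0 \<le> y t"
    and le: "\<And>t. 0 \<le> t \<Longrightarrow> exp (\<gamma> * t) * ((y t)\<^sup>2) powr q \<le> \<Lambda>"
  shows "Limsup at_top (\<lambda>t::real. ereal (1 / t) * elog (y t)) < 0"
proof -
  define K where "K = max \<Lambda> 1"
  have "((\<lambda>t::real. ln K / t) \<longlongrightarrow> 0) at_top"
    by (intro tendsto_divide_0[OF tendsto_const] filterlim_at_top_imp_at_infinity filterlim_ident)
  then have "\<forall>\<^sub>F t in at_top. ln K / t < \<gamma> / 2"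
    using \<gamma> by (intro order_tendstoD) auto
  with eventually_gt_at_top[of 0]
  have "\<forall>\<^sub>F t in at_top. ereal (1 / t) * elog (y t) \<le> ereal (- \<gamma> / (4 * q))"
  proof eventually_elim
    case (elim t)
    show ?case
    proof (cases "y t = 0")
      case True
      then show ?thesis using elim by (simp add: elog_def)
    next
      case False
      with y[of t] have pos: "y t > 0" by simp
      have "exp (\<gamma> * t) * ((y t)\<^sup>2) powr q \<le> K"
        using le[of t] elim by (simp add: K_def)
      then have "ln (exp (\<gamma> * t) * ((y t)\<^sup>2) powr q) \<le> ln K"
        using pos by (intro ln_mono) (auto simp: K_def)
      then have "\<gamma> * t + q * (2 * ln (y t)) \<le> ln K"
        using pos by (simp add: ln_mult ln_powr ln_realpow)
      then have "(\<gamma> * t + q * (2 * ln (y t))) / t \<le> ln K / t"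
        using elim by (intro divide_right_mono) auto
      then have "\<gamma> + 2 * q * (ln (y t) / t) \<le> ln K / t"
        using elim by (simp add: add_divide_distrib mult_ac)
      then have "2 * q * (ln (y t) / t) \<le> - \<gamma> / 2"
        using elim by linarith
      then have "ln (y t) / t \<le> - \<gamma> / (4 * q)"
        using q by (simp add: field_simps)
      then show ?thesis
        using False by (simp add: elog_def)
    qed
  qed
  then have "Limsup at_top (\<lambda>t::real. ereal (1 / t) * elog (y t)) \<le> ereal (- \<gamma> / (4 * q))"
    by (rule Limsup_bounded)
  also have "\<dots> < 0"
    using \<gamma> q by simp
  finally show ?thesis .
qed

section \<open>The network\<close>

definition node_mean :: "real^'n^'m \<Rightarrow> real^'n" where
  "node_mean x = (1 / real CARD('m)) *\<^sub>R (\<Sum>i\<in>UNIV. x $ i)"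

definition node_const :: "real^'n \<Rightarrow> real^'n^'m" where
  "node_const v = (\<chi> i. v)"

text \<open>The orthogonal projection onto the complement of the synchronous states, those whose
  nodes all agree. It is self-adjoint and does not increase norms, and it becomes the
  \<open>P\<close> of \<open>stable_sde\<close>.\<close>

definition deviation :: "real^'n^'m \<Rightarrow> real^'n^'m" where
  "deviation x = x - node_const (node_mean x)"

lemma bounded_linear_node_mean: "bounded_linear (node_mean :: real^'n^'m \<Rightarrow> real^'n)"
  unfolding linear_conv_bounded_linear[symmetric] node_mean_def
  by (rule linearI) (simp_all add: sum.distrib scaleR_add_right scaleR_sum_right[symmetric] mult.commute)

lemma bounded_linear_deviation: "bounded_linear (deviation :: real^'n^'m \<Rightarrow> real^'n^'m)"
proof -
  interpret mean: bounded_linear "node_mean :: real^'n^'m \<Rightarrow> real^'n"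
    by (rule bounded_linear_node_mean)
  show ?thesis
    unfolding linear_conv_bounded_linear[symmetric] deviation_def
    by (rule linearI) (simp_all add: mean.add mean.scaleR node_const_def vec_eq_iff algebra_simps)
qed

lemma sum_deviation: "(\<Sum>i\<in>UNIV. deviation x $ i) = 0"
  by (simp add: deviation_def node_const_def node_mean_def sum_subtractf sum_constant_scaleR del: sum_constant)

lemma deviation_inner_const: "deviation x \<bullet> node_const v = 0"
proof -
  have "deviation x \<bullet> node_const v = (\<Sum>i\<in>UNIV. deviation x $ i) \<bullet> v"
    by (simp add: inner_vec_def[of "deviation x"] node_const_def inner_sum_left)
  then show ?thesis
    by (simp add: sum_deviation)
qed

lemma deviation_inner_deviation: "deviation x \<bullet> deviation y = deviation x \<bullet> y"
  by (subst (2) deviation_def) (simp add: inner_diff_right deviation_inner_const)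

lemma norm_deviation_le: "norm (deviation x) \<le> norm x"
proof -
  have "(norm (deviation x))\<^sup>2 = deviation x \<bullet> x"
    by (simp add: power2_norm_eq_inner deviation_inner_deviation)
  also have "\<dots> \<le> norm (deviation x) * norm x"
    by (rule norm_cauchy_schwarz)
  finally show ?thesis
    by (cases "deviation x = 0") (simp_all add: power2_eq_square)
qed

lemma node_mean_eq_0_iff: "node_mean x = 0 \<longleftrightarrow> (\<Sum>i\<in>UNIV. x $ i) = 0"
  by (simp add: node_mean_def)

lemma kron_id_laplacian_deviation: "kron_id (laplacian E) (deviation x) = kron_id (laplacian E) x"
  unfolding vec_eq_iff[of "kron_id (laplacian E) (deviation x)"]
  by (simp add: kron_id_laplacian_nth deviation_def node_const_def)

text \<open>The sum of the differences along all edges changes sign when every edge is read from its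
  other end, so it vanishes. Hence neither the coupling nor the noise moves the average.\<close>

lemma node_mean_kron_id_laplacian:
  fixes x :: "real^'n^'m"
  assumes "simple_graph E"
  shows "node_mean (kron_id (laplacian E) x) = 0"
proof -
  let ?s = "\<Sum>i\<in>UNIV. \<Sum>j\<in>E `` {i}. x $ i - x $ j"
  have "?s = (\<Sum>i\<in>UNIV. \<Sum>j\<in>E `` {i}. x $ j - x $ i)"
    by (rule sum_edges_swap[OF assms])
  also have "\<dots> = - ?s"
    by (simp add: sum_negf[symmetric])
  finally have "2 *\<^sub>R ?s = 0"
    unfolding scaleR_2 by (simp only: eq_neg_iff_add_eq_0)
  then show ?thesis
    by (simp add: node_mean_eq_0_iff kron_id_laplacian_nth)
qed

lemma deviation_eq: "node_mean x = 0 \<Longrightarrow> deviation x = x"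
  by (simp add: deviation_def node_const_def vec_eq_iff)

lemma node_mean_network_diffusion:
  fixes x :: "real^'n^'m"
  assumes "simple_graph E"
  shows "node_mean (network_diffusion \<sigma> E t x) = 0"
proof -
  interpret mean: bounded_linear "node_mean :: real^'n^'m \<Rightarrow> real^'n"
    by (rule bounded_linear_node_mean)
  show ?thesis
    unfolding network_diffusion_compact mean.scaleR node_mean_kron_id_laplacian[OF assms] by simp
qed

lemma node_mean_network_drift:
  fixes x :: "real^'n^'m"
  assumes "simple_graph E"
  shows "node_mean (network_drift f \<sigma> E t x) = (1 / real CARD('m)) *\<^sub>R (\<Sum>i\<in>UNIV. f t (x $ i))"
proof -
  interpret mean: bounded_linear "node_mean :: real^'n^'m \<Rightarrow> real^'n"
    by (rule bounded_linear_node_mean)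
  show ?thesis
    unfolding network_drift_compact mean.diff mean.scaleR node_mean_kron_id_laplacian[OF assms]
    by (simp add: node_mean_def stacked_def)
qed

text \<open>The one-sided Lipschitz bound is applied to the state and the synchronous state of the
  same average. At the latter \<open>stacked f t\<close> is again synchronous, hence orthogonal to
  the deviation, and may be subtracted freely. The coupling is handled by the algebraic
  connectivity.\<close>

lemma network_drift_dissipative:
  fixes x :: "real^'n^'m"
  assumes E: "simple_graph E" and n: "CARD('m) \<ge> 2" and \<sigma>: "\<sigma> \<ge> 0"
    and lip: "\<And>Y Z :: real^'n^'m. (Y - Z) \<bullet> (stacked f t Y - stacked f t Z) \<le> K * ((Y - Z) \<bullet> (Y - Z))"
  shows "deviation x \<bullet> deviation (network_drift f \<sigma> E t x)
    \<le> (K - \<sigma> * algebraic_connectivity (laplacian E)) * (norm (deviation x))\<^sup>2"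
proof -
  have st: "stacked f t (node_const v) = node_const (f t v)" for v
    by (simp add: stacked_def node_const_def)
  have "deviation x \<bullet> deviation (network_drift f \<sigma> E t x)
    = deviation x \<bullet> stacked f t x - \<sigma> * (deviation x \<bullet> kron_id (laplacian E) (deviation x))"
    by (simp add: deviation_inner_deviation network_drift_compact inner_diff_right kron_id_laplacian_deviation)
  also have "deviation x \<bullet> stacked f t x = deviation x \<bullet> (stacked f t x - stacked f t (node_const (node_mean x)))"
    by (simp add: inner_diff_right st deviation_inner_const)
  also have "\<dots> \<le> K * (deviation x \<bullet> deviation x)"
    using lip[of x "node_const (node_mean x)"] by (simp add: deviation_def)
  finally have "deviation x \<bullet> deviation (network_drift f \<sigma> E t x)
    \<le> K * (deviation x \<bullet> deviation x) - \<sigma> * (deviation x \<bullet> kron_id (laplacian E) (deviation x))"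
    by simp
  moreover have "\<sigma> * (algebraic_connectivity (laplacian E) * (deviation x \<bullet> deviation x))
    \<le> \<sigma> * (deviation x \<bullet> kron_id (laplacian E) (deviation x))"
    using kron_id_laplacian_ge[OF E n sum_deviation] \<sigma> by (rule mult_left_mono)
  ultimately show ?thesis
    by (simp add: power2_norm_eq_inner algebra_simps)
qed

lemma norm_network_diffusion_le:
  fixes x :: "real^'n^'m"
  assumes E: "simple_graph E"
  shows "(norm (deviation (network_diffusion \<sigma> E t x)))\<^sup>2
    \<le> \<sigma>\<^sup>2 * (largest_eigenvalue (laplacian E))\<^sup>2 * (norm (deviation x))\<^sup>2"
proof -
  have "deviation (network_diffusion \<sigma> E t x) = - \<sigma> *\<^sub>R kron_id (laplacian E) (deviation x)"
    unfolding deviation_eq[OF node_mean_network_diffusion[OF E]]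
    by (simp add: network_diffusion_compact kron_id_laplacian_deviation)
  then show ?thesis
    using mult_left_mono[OF norm_kron_id_laplacian_le[OF E, of "deviation x"], of "\<sigma>\<^sup>2"]
    by (simp add: power_mult_distrib mult.assoc)
qed

text \<open>The noise coefficient is -\<sigma> times the Laplacian of the deviation. As the
  connectivity is nonnegative, its lower bound on the form may be squared, and the sign of the
  coefficient disappears.\<close>

lemma network_diffusion_lower:
  fixes x :: "real^'n^'m"
  assumes E: "simple_graph E" and n: "CARD('m) \<ge> 2"
  shows "\<sigma>\<^sup>2 * (algebraic_connectivity (laplacian E))\<^sup>2 * (norm (deviation x)) ^ 4
    \<le> (deviation x \<bullet> deviation (network_diffusion \<sigma> E t x))\<^sup>2"
proof -
  let ?l = "algebraic_connectivity (laplacian E)" and ?e = "deviation x"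
  have "(?l * (norm ?e)\<^sup>2)\<^sup>2 \<le> (?e \<bullet> kron_id (laplacian E) ?e)\<^sup>2"
    using kron_id_laplacian_ge[OF E n sum_deviation, of x] algebraic_connectivity_laplacian(2)[OF E n]
    by (intro power_mono) (auto simp: power2_norm_eq_inner)
  from mult_left_mono[OF this, of "\<sigma>\<^sup>2"]
  have "\<sigma>\<^sup>2 * ?l\<^sup>2 * (norm ?e) ^ 4 \<le> (- \<sigma> * (?e \<bullet> kron_id (laplacian E) ?e))\<^sup>2"
    by (simp add: power_mult_distrib mult.assoc power_mult[symmetric])
  also have "- \<sigma> * (?e \<bullet> kron_id (laplacian E) ?e) = ?e \<bullet> deviation (network_diffusion \<sigma> E t x)"
    by (simp add: deviation_inner_deviation network_diffusion_compact kron_id_laplacian_deviation)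
  finally show ?thesis .
qed

lemma continuous_network_drift:
  fixes f :: "real \<Rightarrow> real^'n \<Rightarrow> real^'n" and E :: "'m::finite rel"
  assumes "continuous_on ({0..} \<times> UNIV) (\<lambda>(t, x). f t x)"
  shows "continuous_on ({0..} \<times> UNIV) (\<lambda>(t, x :: real^'n^'m). network_drift f \<sigma> E t x)"
proof -
  have "continuous_on ({0..} \<times> UNIV) (\<lambda>y. case (fst y, snd y $ i) of (t, x) \<Rightarrow> f t x)" for i :: 'm
    by (rule continuous_on_compose2[OF assms]) (auto intro!: continuous_intros)
  then show ?thesis
    unfolding network_drift_def case_prod_beta'
    by (intro continuous_on_vec_lambda continuous_intros) simp
qed

lemma continuous_network_diffusion:
  fixes E :: "'m::finite rel"
  shows "continuous_on S (\<lambda>(t, x :: real^'n^'m). network_diffusion \<sigma> E t x)"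
  unfolding network_diffusion_def case_prod_beta'
  by (intro continuous_on_vec_lambda continuous_intros)

theorem theorem3:
  fixes M :: "'w measure" and Fl :: "real \<Rightarrow> 'w measure" and b :: "real \<Rightarrow> 'w \<Rightarrow> real"
    and f :: "real \<Rightarrow> real^'n \<Rightarrow> real^'n"
    and E E' :: "'m::finite rel"
    and \<sigma> \<sigma>' K\<^sub>f :: real
    and X :: "real \<Rightarrow> 'w \<Rightarrow> real^'n^'m"
    and s :: "real \<Rightarrow> 'w \<Rightarrow> real^'n"
  assumes nodes: "CARD('m) \<ge> 2"
    and graphs: "simple_graph E" "simple_graph E'"
    and coupling: "\<sigma> \<ge> 0"
    and probability: "prob_space M"
    and filtration: "filtration (space M) Fl" "\<And>t. subalgebra M (Fl t)"
    and brownian: "brownian_motion M Fl b"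
    and smooth: "smooth_on (\<lambda>(t, x). f t x) ({0..} \<times> UNIV)"
    and lipschitz: "local_lipschitz {0..} UNIV (network_drift f \<sigma> E)"
      "local_lipschitz {0..} UNIV
         (network_diffusion \<sigma>' E' :: real \<Rightarrow> real^'n^'m \<Rightarrow> real^'n^'m)"
    and growth: "linear_growth (network_drift f \<sigma> E)"
      "linear_growth (network_diffusion \<sigma>' E' :: real \<Rightarrow> real^'n^'m \<Rightarrow> real^'n^'m)"
    and solution: "sde_solution M Fl b (network_drift f \<sigma> E) (network_diffusion \<sigma>' E') X"
    and one_sided_lipschitz: "\<And>t (Y :: real^'n^'m) Z. t \<ge> 0 \<Longrightarrow>
      (Y - Z) \<bullet> (stacked f t Y - stacked f t Z) \<le> K\<^sub>f * ((Y - Z) \<bullet> (Y - Z))"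
    and noise: "\<sigma>'\<^sup>2 * ((algebraic_connectivity (laplacian E'))\<^sup>2
        - (largest_eigenvalue (laplacian E'))\<^sup>2 / 2)
      > K\<^sub>f - \<sigma> * algebraic_connectivity (laplacian E)"
    and mean_trajectory: "AE \<omega> in M.
      s 0 \<omega> = (1 / real CARD('m)) *\<^sub>R (\<Sum>i\<in>UNIV. X 0 \<omega> $ i) \<and>
      (\<forall>t\<ge>0. ((\<lambda>u. s u \<omega>) has_vector_derivative
        (1 / real CARD('m)) *\<^sub>R (\<Sum>i\<in>UNIV. f t (X t \<omega> $ i))) (at t within {0..}))"
  shows "\<forall>i. AE \<omega> in M.
    Limsup at_top (\<lambda>t. ereal (1 / t) * elog (norm (X t \<omega> $ i - s t \<omega>))) < 0"
proof
  fix i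
  from solution obtain I where
    ito: "ito_integral M Fl b (\<lambda>t \<omega>. network_diffusion \<sigma>' E' t (X t \<omega>)) I"
    and eq: "\<And>t. t \<ge> 0 \<Longrightarrow> AE \<omega> in M. (\<lambda>u. network_drift f \<sigma> E u (X u \<omega>)) absolutely_integrable_on {0..t} \<and>
      X t \<omega> = X 0 \<omega> + integral {0..t} (\<lambda>u. network_drift f \<sigma> E u (X u \<omega>)) + I t \<omega>"
    unfolding sde_solution_def by blast
  let ?l = "algebraic_connectivity (laplacian E)" and ?l' = "algebraic_connectivity (laplacian E')"
    and ?L' = "largest_eigenvalue (laplacian E')"
  \<comment> \<open>Twice the one-sided growth bound of the drift plus the bound on the squared
    noise. With \<open>D\<close> as below, the assumption \<open>noise\<close> reads
    \<open>A < 2 * D\<close>.\<close>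
  define A where "A = 2 * (K\<^sub>f - \<sigma> * ?l) + \<sigma>'\<^sup>2 * ?L'\<^sup>2"
  define D where "D = \<sigma>'\<^sup>2 * ?l'\<^sup>2"
  interpret prob_space M by (rule probability)
  have "C_k_on 0 (\<lambda>(t, x). f t x) ({0..} \<times> UNIV)"
    using smooth by (simp only: smooth_on_def)
  then have cont: "continuous_on ({0..} \<times> UNIV) (\<lambda>(t, x). f t x)"
    by simp
  interpret stable_sde M Fl b "network_drift f \<sigma> E" "network_diffusion \<sigma>' E'" X I deviation A D
  proof (intro stable_sde.intro ito_sde.intro brownian_filtration.intro brownian_filtration_axioms.intro
      ito_sde_axioms.intro stable_sde_axioms.intro)
    show "filtration (space M) Fl" "subalgebra M (Fl t)" "brownian_motion M Fl b" for t
      using filtration brownian by simp_all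
    show "continuous_on ({0..} \<times> UNIV) (\<lambda>(t, x :: real^'n^'m). network_drift f \<sigma> E t x)"
      by (rule continuous_network_drift[OF cont])
    show "continuous_on ({0..} \<times> UNIV) (\<lambda>(t, x :: real^'n^'m). network_diffusion \<sigma>' E' t x)"
      by (rule continuous_network_diffusion)
    show "t \<ge> 0 \<Longrightarrow> X t \<in> borel_measurable (Fl t)" "\<omega> \<in> space M \<Longrightarrow> continuous_on {0..} (\<lambda>t. X t \<omega>)" for t \<omega>
      using solution by (simp_all add: sde_solution_def)
    show "t \<ge> 0 \<Longrightarrow> AE \<omega> in M. X t \<omega> = X 0 \<omega> + integral {0..t} (\<lambda>u. network_drift f \<sigma> E u (X u \<omega>)) + I t \<omega>" for t
      using eq[of t] by (auto elim: eventually_mono)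
    show "t \<ge> 0 \<Longrightarrow> 2 * (deviation x \<bullet> deviation (network_drift f \<sigma> E t x)) +
      (norm (deviation (network_diffusion \<sigma>' E' t x)))\<^sup>2 \<le> A * (norm (deviation x))\<^sup>2" for t and x :: "real^'n^'m"
      using network_drift_dissipative[OF graphs(1) nodes coupling one_sided_lipschitz, of t x]
        norm_network_diffusion_le[OF graphs(2), of \<sigma>' t x]
      unfolding A_def distrib_right mult.assoc[of 2] by linarith
    show "D * (norm (deviation x)) ^ 4 \<le> (deviation x \<bullet> deviation (network_diffusion \<sigma>' E' t x))\<^sup>2"
      for t and x :: "real^'n^'m"
      unfolding D_def by (rule network_diffusion_lower[OF graphs(2) nodes])
    show "A < 2 * D"
      using noise by (simp add: A_def D_def algebra_simps)
  qed (simp_all add: ito bounded_linear_deviation norm_deviation_le D_def probability)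
  interpret mean: bounded_linear "node_mean :: real^'n^'m \<Rightarrow> real^'n"
    by (rule bounded_linear_node_mean)
  \<comment> \<open>The noise coefficient has mean zero over the nodes, so the average of the
    solution obeys an integral equation without noise.\<close>
  have "AE \<omega> in M. \<forall>n k. node_mean (I (dyadic n k) \<omega>) = 0"
    using ito_integral_linear_zero[OF bounded_linear_node_mean node_mean_network_diffusion[OF graphs(2)]]
    by (simp add: AE_all_countable)
  moreover have "AE \<omega> in M. \<forall>n k. X (dyadic n k) \<omega> = X 0 \<omega>
      + integral {0..dyadic n k} (\<lambda>u. network_drift f \<sigma> E u (X u \<omega>)) + I (dyadic n k) \<omega>"
    using X_eq[OF dyadic_nonneg] by (simp add: AE_all_countable)
  \<comment> \<open>\<open>s\<close> and the average have the same initial value and the same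
    increments from 0 to each dyadic time; continuity extends the equality to all times.\<close>
  ultimately have mean: "AE \<omega> in M. \<forall>t\<ge>0. s t \<omega> = node_mean (X t \<omega>)"
    using mean_trajectory AE_space
  proof eventually_elim
    case (elim \<omega>)
    let ?\<mu> = "\<lambda>u. network_drift f \<sigma> E u (X u \<omega>)"
    have s_deriv: "((\<lambda>u. s u \<omega>) has_vector_derivative node_mean (?\<mu> t)) (at t within {0..})" if "t \<ge> 0" for t
      using elim(3) that by (simp add: node_mean_network_drift[OF graphs(1)])
    have s_cont: "continuous_on {0..} (\<lambda>u. s u \<omega>)"
      using s_deriv by (auto simp: continuous_on_eq_continuous_within intro: has_vector_derivative_continuous)
    have diff_cont: "continuous_on {0..} (\<lambda>t. s t \<omega> - node_mean (X t \<omega>))"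
      by (intro continuous_on_diff s_cont continuous_on_compose2[OF linear_continuous_on[OF bounded_linear_node_mean]
            X_continuous[OF elim(4)]]) auto
    have diff_dyadic: "s (dyadic n k) \<omega> - node_mean (X (dyadic n k) \<omega>) \<in> {0}" for n k
    proof -
      let ?t = "dyadic n k"
      have "((\<lambda>u. node_mean (?\<mu> u)) has_integral s ?t \<omega> - s 0 \<omega>) {0..?t}"
        by (rule fundamental_theorem_of_calculus)
          (auto intro: has_vector_derivative_within_subset[OF s_deriv])
      moreover have "?\<mu> integrable_on {0..?t}"
        by (rule integrable_continuous_interval[OF continuous_on_subset[OF coefficient_continuous(1)[OF cont_\<mu> elim(4)]]]) auto
      then have "((\<lambda>u. node_mean (?\<mu> u)) has_integral node_mean (integral {0..?t} ?\<mu>)) {0..?t}"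
        using has_integral_linear[OF integrable_integral bounded_linear_node_mean] by (simp add: comp_def)
      ultimately have "s ?t \<omega> - s 0 \<omega> = node_mean (integral {0..?t} ?\<mu>)"
        by (rule has_integral_unique)
      moreover have "node_mean (X ?t \<omega>) = node_mean (X 0 \<omega>) + node_mean (integral {0..?t} ?\<mu>)"
        using elim(1) by (subst elim(2)[rule_format]) (simp add: mean.add)
      moreover have "s 0 \<omega> = node_mean (X 0 \<omega>)"
        using elim(3) by (simp add: node_mean_def)
      ultimately show ?thesis
        by (simp add: algebra_simps)
    qed
    have "s t \<omega> - node_mean (X t \<omega>) \<in> {0}" if "t \<ge> 0" for t
      by (rule dyadic_dense_closed[OF diff_cont closed_singleton diff_dyadic that])
    then show ?case
      by simp
  qed
  from exponential_stability mean
  show "AE \<omega> in M. Limsup at_top (\<lambda>t. ereal (1 / t) * elog (norm (X t \<omega> $ i - s t \<omega>))) < 0"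
  proof eventually_elim
    case (elim \<omega>)
    obtain \<Lambda> where \<Lambda>: "\<And>t. t \<ge> 0 \<Longrightarrow> exp (rate * t) * ((norm (deviation (X t \<omega>)))\<^sup>2) powr exponent \<le> \<Lambda>"
      using elim(1) by blast
    show ?case
    proof (rule Limsup_elog_neg[OF rate_pos exponent(1) norm_ge_zero])
      fix t :: real assume t: "0 \<le> t"
      \<comment> \<open>One block of the deviation, whose norm is at most that of the whole.\<close>
      have "X t \<omega> $ i - s t \<omega> = deviation (X t \<omega>) $ i"
        using elim(2) t by (simp add: deviation_def node_const_def)
      then have "norm (X t \<omega> $ i - s t \<omega>) \<le> norm (deviation (X t \<omega>))"
        by (simp add: Finite_Cartesian_Product.norm_nth_le)
      then have "((norm (X t \<omega> $ i - s t \<omega>))\<^sup>2) powr exponent \<le> ((norm (deviation (X t \<omega>)))\<^sup>2) powr exponent"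
        using exponent by (intro powr_mono2 power_mono) auto
      then have "exp (rate * t) * ((norm (X t \<omega> $ i - s t \<omega>))\<^sup>2) powr exponent
        \<le> exp (rate * t) * ((norm (deviation (X t \<omega>)))\<^sup>2) powr exponent"
        by (intro mult_left_mono) auto
      also have "\<dots> \<le> \<Lambda>"
        by (rule \<Lambda>[OF t])
      finally show "exp (rate * t) * ((norm (X t \<omega> $ i - s t \<omega>))\<^sup>2) powr exponent \<le> \<Lambda>" .
    qed
  qed
qed

end
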